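(* Let $\mathcal T$ be a rigidly-compactly generated tensor-triangulated category with $\mathrm{Spc}(\mathcal T^c)$ weakly noetherian. The following are equivalent: (a) The local-to-global principle holds for $\mathcal T$, and for each $\mathcal P\in \mathrm{Spc}(\mathcal T^c)$, $g(\mathcal P)\otimes\mathcal T=\mathrm{Loc}_\otimes\langle g(\mathcal P)\rangle$ is a minimal localizing $\otimes$-ideal of $\mathcal T$. (b) The map $$\{\text{localizing }\otimes\text{-ideals of }\mathcal T\}\longrightarrow\{\text{subsets of }\mathrm{Spc}(\mathcal T^c)\},\qquad \mathcal L\mapsto \bigcup_{t\in\mathcal L}\mathrm{Supp}(t),$$ is a bijection.
   Context: A tensor-triangulated (tt-)category is a triangulated category with a compatible closed symmetric monoidal structure $(\otimes,\mathbb 1)$ (in the sense of Hovey--Palmieri--Strickland, Appendix A). It is rigidly-compactly generated if it is compactly generated as a triangulated category (in particular has all small coproducts) and its compact objects coincide with its rigid (dualizable) objects; in particular $\mathbb 1$ is compact. $\mathcal T^c$ is the full subcategory of compact objects. A localizing $\otimes$-ideal is a triangulated subcategory closed under coproducts and under tensoring with arbitrary objects; $\mathrm{Loc}_\otimes\langle\mathcal E\rangle$ is the smallest one containing $\mathcal E$. A localizing $\otimes$-ideal is minimal if it is nonzero and contains no localizing $\otimes$-ideals other than $0$ and itself. $\mathrm{Spc}(\mathcal T^c)$ is the Balmer spectrum: the set of prime thick $\otimes$-ideals of $\mathcal T^c$, with the sets $\mathrm{supp}(x)=\{\mathcal P : x\notin\mathcal P\}$, $x\in\mathcal T^c$, as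 a basis of closed sets; it is a spectral space. A subset of a spectral space is Thomason if it is a union of closed subsets each with quasi-compact complement. For $Y\subseteq\mathrm{Spc}(\mathcal T^c)$ Thomason put $\mathcal T^c_Y=\{x\in\mathcal T^c:\mathrm{supp}(x)\subseteq Y\}$; there is an (essentially unique) exact triangle $e_Y\to\mathbb 1\to f_Y\to\Sigma e_Y$ with $e_Y\otimes f_Y=0$ and $\mathrm{Loc}_\otimes\langle e_Y\rangle=\mathrm{Ker}(f_Y\otimes-)=\mathrm{Loc}\langle\mathcal T^c_Y\rangle$. A point $\mathcal P$ of a spectral space is weakly visible if $\{\mathcal P\}=Y_1\cap Y_2^c$ for some Thomason subsets $Y_1,Y_2$; the space is weakly noetherian if every point is weakly visible. For a weakly visible $\mathcal P$ put $g(\mathcal P)=e_{Y_1}\otimes f_{Y_2}$ (independent of the choice of $Y_1,Y_2$ up to isomorphism). When $\mathrm{Spc}(\mathcal T^c)$ is weakly noetherian, the (Balmer--Favi) support of $t\in\mathcal T$ is $\mathrm{Supp}(t)=\{\mathcal P\in\mathrm{Spc}(\mathcal T^c): g(\mathcal P)\otimes t\ne0\}$. The local-to-global principle holds for $\mathcal T$ if $\mathrm{Loc}_\otimes\langle t\rangle=\mathrm{Loc}_\otimes\langle t\otimes g(\mathcal P)\mid \mathcal P\in\mathrm{Spc}(\mathcal T^c)\rangle$ for every $t\in\mathcal T$. (A priori the localizing $\otimes$-ideals need not form a set.) *)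

theory Defs
  imports "HOL-Analysis.Abstract_Topology" "HOL-Library.Equipollence" "HOL-Algebra.FiniteProduct"
begin

section \<open>Categories\<close>

text \<open>The objects of a category are all the elements of a type; a morphism of \<open>Hom C x y\<close> need not
  determine \<open>x\<close> and \<open>y\<close>.  All further structure is data, so that a statement about an arbitrary
  such record is a statement about an arbitrary structured category.\<close>

record ('o, 'm) cat =
  Hom :: "'o \<Rightarrow> 'o \<Rightarrow> 'm set"
  Id :: "'o \<Rightarrow> 'm"
  Comp :: "'m \<Rightarrow> 'm \<Rightarrow> 'm" (infixr "\<bullet>\<index>" 70)

locale category =
  fixes C :: "('o, 'm, 'z) cat_scheme" (structure)
  assumes Id_in: "Id C x \<in> Hom C x x"
    and Comp_in: "\<lbrakk>f \<in> Hom C x y; g \<in> Hom C y z\<rbrakk> \<Longrightarrow> g \<bullet> f \<in> Hom C x z"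
    and Comp_Id: "f \<in> Hom C x y \<Longrightarrow> f \<bullet> Id C x = f"
    and Id_Comp: "f \<in> Hom C x y \<Longrightarrow> Id C y \<bullet> f = f"
    and Comp_assoc: "\<lbrakk>f \<in> Hom C w x; g \<in> Hom C x y; h \<in> Hom C y z\<rbrakk>
      \<Longrightarrow> (h \<bullet> g) \<bullet> f = h \<bullet> (g \<bullet> f)"

definition is_inverse :: "('o, 'm, 'z) cat_scheme \<Rightarrow> 'o \<Rightarrow> 'o \<Rightarrow> 'm \<Rightarrow> 'm \<Rightarrow> bool" where
  "is_inverse C x y f g \<longleftrightarrow> g \<in> Hom C y x \<and> g \<bullet>\<^bsub>C\<^esub> f = Id C x \<and> f \<bullet>\<^bsub>C\<^esub> g = Id C y"

definition is_iso :: "('o, 'm, 'z) cat_scheme \<Rightarrow> 'o \<Rightarrow> 'o \<Rightarrow> 'm \<Rightarrow> bool" where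
  "is_iso C x y f \<longleftrightarrow> f \<in> Hom C x y \<and> (\<exists>g. is_inverse C x y f g)"

definition Inv :: "('o, 'm, 'z) cat_scheme \<Rightarrow> 'o \<Rightarrow> 'o \<Rightarrow> 'm \<Rightarrow> 'm" where
  "Inv C x y f = (THE g. is_inverse C x y f g)"

definition isomorphic :: "('o, 'm, 'z) cat_scheme \<Rightarrow> 'o \<Rightarrow> 'o \<Rightarrow> bool" where
  "isomorphic C x y \<longleftrightarrow> (\<exists>f. is_iso C x y f)"

definition is_zero :: "('o, 'm, 'z) cat_scheme \<Rightarrow> 'o \<Rightarrow> bool" where
  "is_zero C x \<longleftrightarrow> (\<forall>y. (\<exists>!f. f \<in> Hom C x y) \<and> (\<exists>!f. f \<in> Hom C y x))"

definition is_retract :: "('o, 'm, 'z) cat_scheme \<Rightarrow> 'o \<Rightarrow> 'o \<Rightarrow> bool" where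
  "is_retract C x y \<longleftrightarrow> (\<exists>i \<in> Hom C x y. \<exists>p \<in> Hom C y x. p \<bullet>\<^bsub>C\<^esub> i = Id C x)"

definition is_coproduct ::
    "('o, 'm, 'z) cat_scheme \<Rightarrow> 'i set \<Rightarrow> ('i \<Rightarrow> 'o) \<Rightarrow> ('i \<Rightarrow> 'm) \<Rightarrow> 'o \<Rightarrow> bool" where
  "is_coproduct C I X \<iota> c \<longleftrightarrow>
     (\<forall>i\<in>I. \<iota> i \<in> Hom C (X i) c) \<and>
     (\<forall>y g. (\<forall>i\<in>I. g i \<in> Hom C (X i) y) \<longrightarrow>
        (\<exists>!h. h \<in> Hom C c y \<and> (\<forall>i\<in>I. h \<bullet>\<^bsub>C\<^esub> \<iota> i = g i)))"


section \<open>Triangulated categories\<close>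

text \<open>\<open>Dist C x y z f g h\<close> says that \<open>x \<rightarrow> y \<rightarrow> z \<rightarrow> Susp x\<close>, with maps \<open>f\<close>, \<open>g\<close>, \<open>h\<close>, is an exact
  triangle.\<close>

record ('o, 'm) tri_cat = "('o, 'm) cat" +
  Zero :: "'o \<Rightarrow> 'o \<Rightarrow> 'm"
  Plus :: "'m \<Rightarrow> 'm \<Rightarrow> 'm"
  Susp :: "'o \<Rightarrow> 'o"
  SuspM :: "'m \<Rightarrow> 'm"
  Dist :: "'o \<Rightarrow> 'o \<Rightarrow> 'o \<Rightarrow> 'm \<Rightarrow> 'm \<Rightarrow> 'm \<Rightarrow> bool"

definition hom_group :: "('o, 'm, 'z) tri_cat_scheme \<Rightarrow> 'o \<Rightarrow> 'o \<Rightarrow> 'm monoid" where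
  "hom_group C x y = \<lparr>carrier = Hom C x y, monoid.mult = Plus C, one = Zero C x y\<rparr>"

abbreviation Neg :: "('o, 'm, 'z) tri_cat_scheme \<Rightarrow> 'o \<Rightarrow> 'o \<Rightarrow> 'm \<Rightarrow> 'm" where
  "Neg C x y f \<equiv> inv\<^bsub>hom_group C x y\<^esub> f"

locale additive_category = category C
  for C :: "('o, 'm, 'z) tri_cat_scheme" (structure) +
  assumes hom_group: "comm_group (hom_group C x y)"
    and Plus_Comp: "\<lbrakk>f \<in> Hom C x y; g \<in> Hom C y z; g' \<in> Hom C y z\<rbrakk>
      \<Longrightarrow> Plus C g g' \<bullet> f = Plus C (g \<bullet> f) (g' \<bullet> f)"
    and Comp_Plus: "\<lbrakk>f \<in> Hom C x y; f' \<in> Hom C x y; g \<in> Hom C y z\<rbrakk>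
      \<Longrightarrow> g \<bullet> Plus C f f' = Plus C (g \<bullet> f) (g \<bullet> f')"
    and zero_object: "\<exists>x. is_zero C x"
    and binary_coproduct: "\<exists>\<iota> c. is_coproduct C UNIV (\<lambda>b. if b then x else y) \<iota> c"

text \<open>The suspension is only required to be an equivalence, not an automorphism.\<close>

locale triangulated_category = additive_category C
  for C :: "('o, 'm, 'z) tri_cat_scheme" (structure) +
  assumes SuspM_bij: "bij_betw (SuspM C) (Hom C x y) (Hom C (Susp C x) (Susp C y))"
    and SuspM_Id: "SuspM C (Id C x) = Id C (Susp C x)"
    and SuspM_Comp: "\<lbrakk>f \<in> Hom C x y; g \<in> Hom C y z\<rbrakk>
      \<Longrightarrow> SuspM C (g \<bullet> f) = SuspM C g \<bullet> SuspM C f"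
    and SuspM_Plus: "\<lbrakk>f \<in> Hom C x y; g \<in> Hom C x y\<rbrakk>
      \<Longrightarrow> SuspM C (Plus C f g) = Plus C (SuspM C f) (SuspM C g)"
    and Susp_ess_surj: "\<exists>x. isomorphic C (Susp C x) y"
    and Dist_in: "Dist C x y z f g h
      \<Longrightarrow> f \<in> Hom C x y \<and> g \<in> Hom C y z \<and> h \<in> Hom C z (Susp C x)"
    and Dist_iso: "\<lbrakk>Dist C x y z f g h; is_iso C x x' a; is_iso C y y' b; is_iso C z z' c;
        f' \<in> Hom C x' y'; g' \<in> Hom C y' z'; h' \<in> Hom C z' (Susp C x');
        f' \<bullet> a = b \<bullet> f; g' \<bullet> b = c \<bullet> g; h' \<bullet> c = SuspM C a \<bullet> h\<rbrakk>
      \<Longrightarrow> Dist C x' y' z' f' g' h'"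
    and Dist_Id: "is_zero C z \<Longrightarrow> Dist C x x z (Id C x) (Zero C x z) (Zero C z (Susp C x))"
    and Dist_cone: "f \<in> Hom C x y \<Longrightarrow> \<exists>z g h. Dist C x y z f g h"
    and Dist_rotate: "\<lbrakk>f \<in> Hom C x y; g \<in> Hom C y z; h \<in> Hom C z (Susp C x)\<rbrakk>
      \<Longrightarrow> Dist C x y z f g h \<longleftrightarrow>
          Dist C y z (Susp C x) g h (Neg C (Susp C x) (Susp C y) (SuspM C f))"
    and Dist_fill: "\<lbrakk>Dist C x y z f g h; Dist C x' y' z' f' g' h';
        a \<in> Hom C x x'; b \<in> Hom C y y'; f' \<bullet> a = b \<bullet> f\<rbrakk>
      \<Longrightarrow> \<exists>c \<in> Hom C z z'. g' \<bullet> b = c \<bullet> g \<and> h' \<bullet> c = SuspM C a \<bullet> h"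
    and Dist_octahedron: "\<lbrakk>Dist C x y z' f f' f''; Dist C y z x' g g' g'';
        Dist C x z y' (g \<bullet> f) k k''\<rbrakk>
      \<Longrightarrow> \<exists>u v. Dist C z' y' x' u v (SuspM C f' \<bullet> g'') \<and>
            u \<bullet> f' = k \<bullet> g \<and> k'' \<bullet> u = f'' \<and> v \<bullet> k = g' \<and> g'' \<bullet> v = SuspM C f \<bullet> k''"


section \<open>Tensor-triangulated categories\<close>

text \<open>\<open>TSusp T x y\<close> is the comparison map from \<open>Susp x \<boxtimes> y\<close> to \<open>Susp (x \<boxtimes> y)\<close>, and \<open>Eval T x y\<close> the
  evaluation map from \<open>IHom x y \<boxtimes> x\<close> to \<open>y\<close>.\<close>

record ('o, 'm) tt_cat = "('o, 'm) tri_cat" +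
  Tens :: "'o \<Rightarrow> 'o \<Rightarrow> 'o" (infixl "\<boxtimes>\<index>" 75)
  TensM :: "'m \<Rightarrow> 'm \<Rightarrow> 'm" (infixl "\<boxtimes>\<^sub>m\<index>" 75)
  Unit :: "'o"
  Assoc :: "'o \<Rightarrow> 'o \<Rightarrow> 'o \<Rightarrow> 'm"
  LUnit :: "'o \<Rightarrow> 'm"
  RUnit :: "'o \<Rightarrow> 'm"
  Braid :: "'o \<Rightarrow> 'o \<Rightarrow> 'm"
  IHom :: "'o \<Rightarrow> 'o \<Rightarrow> 'o"
  Eval :: "'o \<Rightarrow> 'o \<Rightarrow> 'm"
  TSusp :: "'o \<Rightarrow> 'o \<Rightarrow> 'm"

locale closed_symmetric_monoidal_category = category T
  for T :: "('o, 'm, 'z) tt_cat_scheme" (structure) +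
  assumes TensM_in: "\<lbrakk>f \<in> Hom T x x'; g \<in> Hom T y y'\<rbrakk> \<Longrightarrow> f \<boxtimes>\<^sub>m g \<in> Hom T (x \<boxtimes> y) (x' \<boxtimes> y')"
    and TensM_Id: "Id T x \<boxtimes>\<^sub>m Id T y = Id T (x \<boxtimes> y)"
    and TensM_Comp: "\<lbrakk>f \<in> Hom T x x'; f' \<in> Hom T x' x''; g \<in> Hom T y y'; g' \<in> Hom T y' y''\<rbrakk>
      \<Longrightarrow> (f' \<bullet> f) \<boxtimes>\<^sub>m (g' \<bullet> g) = (f' \<boxtimes>\<^sub>m g') \<bullet> (f \<boxtimes>\<^sub>m g)"
    and Assoc_iso: "is_iso T ((x \<boxtimes> y) \<boxtimes> z) (x \<boxtimes> (y \<boxtimes> z)) (Assoc T x y z)"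
    and Assoc_natural: "\<lbrakk>f \<in> Hom T x x'; g \<in> Hom T y y'; h \<in> Hom T z z'\<rbrakk>
      \<Longrightarrow> Assoc T x' y' z' \<bullet> ((f \<boxtimes>\<^sub>m g) \<boxtimes>\<^sub>m h) = (f \<boxtimes>\<^sub>m (g \<boxtimes>\<^sub>m h)) \<bullet> Assoc T x y z"
    and LUnit_iso: "is_iso T (Unit T \<boxtimes> x) x (LUnit T x)"
    and LUnit_natural: "f \<in> Hom T x y \<Longrightarrow> LUnit T y \<bullet> (Id T (Unit T) \<boxtimes>\<^sub>m f) = f \<bullet> LUnit T x"
    and RUnit_iso: "is_iso T (x \<boxtimes> Unit T) x (RUnit T x)"
    and RUnit_natural: "f \<in> Hom T x y \<Longrightarrow> RUnit T y \<bullet> (f \<boxtimes>\<^sub>m Id T (Unit T)) = f \<bullet> RUnit T x"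
    and Braid_iso: "is_iso T (x \<boxtimes> y) (y \<boxtimes> x) (Braid T x y)"
    and Braid_natural: "\<lbrakk>f \<in> Hom T x x'; g \<in> Hom T y y'\<rbrakk>
      \<Longrightarrow> Braid T x' y' \<bullet> (f \<boxtimes>\<^sub>m g) = (g \<boxtimes>\<^sub>m f) \<bullet> Braid T x y"
    and pentagon: "Assoc T w x (y \<boxtimes> z) \<bullet> Assoc T (w \<boxtimes> x) y z =
      (Id T w \<boxtimes>\<^sub>m Assoc T x y z) \<bullet> Assoc T w (x \<boxtimes> y) z \<bullet> (Assoc T w x y \<boxtimes>\<^sub>m Id T z)"
    and triangle: "(Id T x \<boxtimes>\<^sub>m LUnit T y) \<bullet> Assoc T x (Unit T) y = RUnit T x \<boxtimes>\<^sub>m Id T y"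
    and hexagon: "Assoc T y z x \<bullet> Braid T x (y \<boxtimes> z) \<bullet> Assoc T x y z =
      (Id T y \<boxtimes>\<^sub>m Braid T x z) \<bullet> Assoc T y x z \<bullet> (Braid T x y \<boxtimes>\<^sub>m Id T z)"
    and symmetry: "Braid T y x \<bullet> Braid T x y = Id T (x \<boxtimes> y)"
    and Eval_in: "Eval T x y \<in> Hom T (IHom T x y \<boxtimes> x) y"
    and Eval_universal: "f \<in> Hom T (a \<boxtimes> x) y
      \<Longrightarrow> \<exists>!f'. f' \<in> Hom T a (IHom T x y) \<and> Eval T x y \<bullet> (f' \<boxtimes>\<^sub>m Id T x) = f"

definition Curry :: "('o, 'm, 'z) tt_cat_scheme \<Rightarrow> 'o \<Rightarrow> 'o \<Rightarrow> 'o \<Rightarrow> 'm \<Rightarrow> 'm" where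
  "Curry T a x y f =
     (THE f'. f' \<in> Hom T a (IHom T x y) \<and> Eval T x y \<bullet>\<^bsub>T\<^esub> (f' \<boxtimes>\<^sub>m\<^bsub>T\<^esub> Id T x) = f)"

text \<open>For \<open>f\<close> from \<open>x\<close> to \<open>y\<close>, the induced maps \<open>IHom y w \<rightarrow> IHom x w\<close> and \<open>IHom w x \<rightarrow> IHom w y\<close>.\<close>

definition IHom_contra :: "('o, 'm, 'z) tt_cat_scheme \<Rightarrow> 'o \<Rightarrow> 'o \<Rightarrow> 'o \<Rightarrow> 'm \<Rightarrow> 'm" where
  "IHom_contra T x y w f =
     Curry T (IHom T y w) x w (Eval T y w \<bullet>\<^bsub>T\<^esub> (Id T (IHom T y w) \<boxtimes>\<^sub>m\<^bsub>T\<^esub> f))"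

definition IHom_co :: "('o, 'm, 'z) tt_cat_scheme \<Rightarrow> 'o \<Rightarrow> 'o \<Rightarrow> 'o \<Rightarrow> 'm \<Rightarrow> 'm" where
  "IHom_co T w x y f = Curry T (IHom T w x) w y (f \<bullet>\<^bsub>T\<^esub> Eval T w x)"

definition TSuspR :: "('o, 'm, 'z) tt_cat_scheme \<Rightarrow> 'o \<Rightarrow> 'o \<Rightarrow> 'm" where
  "TSuspR T a x =
     SuspM T (Braid T x a) \<bullet>\<^bsub>T\<^esub> TSusp T x a \<bullet>\<^bsub>T\<^esub> Braid T a (Susp T x)"

text \<open>The canonical comparison isomorphisms \<open>Susp (IHom w x) \<rightarrow> IHom w (Susp x)\<close> and
  \<open>Susp (IHom (Susp x) w) \<rightarrow> IHom x w\<close>, adjoint to maps built from \<open>TSusp\<close> and evaluation.\<close>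

definition IHom_susp_co :: "('o, 'm, 'z) tt_cat_scheme \<Rightarrow> 'o \<Rightarrow> 'o \<Rightarrow> 'm" where
  "IHom_susp_co T w x =
     Curry T (Susp T (IHom T w x)) w (Susp T x)
       (SuspM T (Eval T w x) \<bullet>\<^bsub>T\<^esub> TSusp T (IHom T w x) w)"

definition IHom_susp_contra :: "('o, 'm, 'z) tt_cat_scheme \<Rightarrow> 'o \<Rightarrow> 'o \<Rightarrow> 'm" where
  "IHom_susp_contra T x w =
     Curry T (Susp T (IHom T (Susp T x) w)) x w
       (Eval T (Susp T x) w \<bullet>\<^bsub>T\<^esub>
        Inv T (IHom T (Susp T x) w \<boxtimes>\<^bsub>T\<^esub> Susp T x) (Susp T (IHom T (Susp T x) w \<boxtimes>\<^bsub>T\<^esub> x))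
          (TSuspR T (IHom T (Susp T x) w) x) \<bullet>\<^bsub>T\<^esub>
        TSusp T (IHom T (Susp T x) w) x)"

definition Sphere :: "('o, 'm, 'z) tt_cat_scheme \<Rightarrow> nat \<Rightarrow> 'o" where
  "Sphere T n = (Susp T ^^ n) (Unit T)"

primrec Sphere_mult :: "('o, 'm, 'z) tt_cat_scheme \<Rightarrow> nat \<Rightarrow> nat \<Rightarrow> 'm" where
  "Sphere_mult T 0 s = LUnit T (Sphere T s)"
| "Sphere_mult T (Suc r) s =
     SuspM T (Sphere_mult T r s) \<bullet>\<^bsub>T\<^esub> TSusp T (Sphere T r) (Sphere T s)"

text \<open>The compatibility axioms of Hovey--Palmieri--Strickland, Appendix A.2.  Since \<open>Susp\<close> need not be
  strictly invertible, their triangle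
  \<open>\<Sigma>\<^sup>-\<^sup>1 F(x,w) \<rightarrow> F(z,w) \<rightarrow> F(y,w) \<rightarrow> F(x,w)\<close>, whose first map is minus the one induced by \<open>h\<close>, is stated
  in rotated form in \<open>IHom_exact_contra\<close>; rotation turns the sign into a plus.  In
  \<open>graded_commutative\<close> it suffices to treat spheres of nonnegative dimension, since the negative
  spheres are their tensor inverses.\<close>

locale tt_category =
  triangulated_category T + closed_symmetric_monoidal_category T
  for T :: "('o, 'm, 'z) tt_cat_scheme" (structure) +
  assumes TSusp_iso: "is_iso T (Susp T x \<boxtimes> y) (Susp T (x \<boxtimes> y)) (TSusp T x y)"
    and TSusp_natural: "\<lbrakk>f \<in> Hom T x x'; g \<in> Hom T y y'\<rbrakk>
      \<Longrightarrow> TSusp T x' y' \<bullet> (SuspM T f \<boxtimes>\<^sub>m g) = SuspM T (f \<boxtimes>\<^sub>m g) \<bullet> TSusp T x y"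
    and TSusp_RUnit: "SuspM T (RUnit T x) \<bullet> TSusp T x (Unit T) = RUnit T (Susp T x)"
    and TSusp_Assoc: "SuspM T (Assoc T x y z) \<bullet> TSusp T (x \<boxtimes> y) z \<bullet> (TSusp T x y \<boxtimes>\<^sub>m Id T z) =
      TSusp T x (y \<boxtimes> z) \<bullet> Assoc T (Susp T x) y z"
    and TensM_Plus: "\<lbrakk>f \<in> Hom T x y; g \<in> Hom T x y\<rbrakk>
      \<Longrightarrow> Plus T f g \<boxtimes>\<^sub>m Id T w = Plus T (f \<boxtimes>\<^sub>m Id T w) (g \<boxtimes>\<^sub>m Id T w)"
    and Tens_exact: "Dist T x y z f g h
      \<Longrightarrow> Dist T (x \<boxtimes> w) (y \<boxtimes> w) (z \<boxtimes> w) (f \<boxtimes>\<^sub>m Id T w) (g \<boxtimes>\<^sub>m Id T w)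
            (TSusp T x w \<bullet> (h \<boxtimes>\<^sub>m Id T w))"
    and IHom_exact_co: "Dist T x y z f g h
      \<Longrightarrow> Dist T (IHom T w x) (IHom T w y) (IHom T w z) (IHom_co T w x y f) (IHom_co T w y z g)
            (Inv T (Susp T (IHom T w x)) (IHom T w (Susp T x)) (IHom_susp_co T w x) \<bullet>
             IHom_co T w z (Susp T x) h)"
    and IHom_exact_contra: "Dist T x y z f g h
      \<Longrightarrow> Dist T (IHom T z w) (IHom T y w) (IHom T x w)
            (IHom_contra T y z w g) (IHom_contra T x y w f)
            (SuspM T (IHom_contra T z (Susp T x) w h) \<bullet>
             Inv T (Susp T (IHom T (Susp T x) w)) (IHom T x w) (IHom_susp_contra T x w))"
    and graded_commutative: "Sphere_mult T s r \<bullet> Braid T (Sphere T r) (Sphere T s) =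
      (if even (r * s) then Sphere_mult T r s
       else Neg T (Sphere T r \<boxtimes> Sphere T s) (Sphere T (r + s)) (Sphere_mult T r s))"


section \<open>Rigidly-compactly generated tt-categories\<close>

text \<open>Size conventions.  A set is small if it has fewer elements than a fixed uncountable set \<open>U\<close> of
  regular cardinality, and small coproducts are indexed by small subsets of \<open>U\<close>.  The usual
  convention is the case where \<open>U\<close> is a Grothendieck universe.  That the cardinality of \<open>U\<close> is also a
  strong limit is not assumed, but it follows as soon as there is a nonzero locally small category
  with small coproducts: with \<open>c\<close> the coproduct of \<open>I\<close> copies of \<open>x \<noteq> 0\<close>, the set of morphisms from
  \<open>c\<close> to \<open>x\<close> has at least as many elements as \<open>Pow I\<close>.\<close>

definition regular_uncountable :: "'u set \<Rightarrow> bool" where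
  "regular_uncountable U \<longleftrightarrow> (UNIV :: nat set) \<prec> U \<and>
     (\<forall>I A. I \<subseteq> U \<and> I \<prec> U \<and> (\<forall>i\<in>I. A i \<subseteq> U \<and> A i \<prec> U) \<longrightarrow> (\<Union>i\<in>I. A i) \<prec> U)"

definition has_small_coproducts :: "'u set \<Rightarrow> ('o, 'm, 'z) cat_scheme \<Rightarrow> bool" where
  "has_small_coproducts U C \<longleftrightarrow>
     (\<forall>I (X :: 'u \<Rightarrow> 'o). I \<subseteq> U \<and> I \<prec> U \<longrightarrow> (\<exists>\<iota> c. is_coproduct C I X \<iota> c))"

definition locally_small :: "'u set \<Rightarrow> ('o, 'm, 'z) cat_scheme \<Rightarrow> bool" where
  "locally_small U C \<longleftrightarrow> (\<forall>x y. Hom C x y \<prec> U)"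

text \<open>\<open>c\<close> is compact if, for every small coproduct \<open>s\<close> of objects \<open>X i\<close>, the canonical map from the
  direct sum of the groups \<open>Hom c (X i)\<close> to \<open>Hom c s\<close> is bijective.  The elements of the direct sum
  are the finitely supported families \<open>h\<close>, and \<open>finprod\<close> is the sum in the abelian group \<open>Hom c s\<close>.\<close>

definition compact_object :: "'u set \<Rightarrow> ('o, 'm, 'z) tri_cat_scheme \<Rightarrow> 'o \<Rightarrow> bool" where
  "compact_object U C c \<longleftrightarrow>
     (\<forall>I (X :: 'u \<Rightarrow> 'o) \<iota> s. I \<subseteq> U \<and> I \<prec> U \<and> is_coproduct C I X \<iota> s \<longrightarrow>
        bij_betw
          (\<lambda>h. finprod (hom_group C c s) (\<lambda>i. \<iota> i \<bullet>\<^bsub>C\<^esub> h i) {i\<in>I. h i \<noteq> Zero C c (X i)})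
          {h \<in> (\<Pi>\<^sub>E i\<in>I. Hom C c (X i)). finite {i\<in>I. h i \<noteq> Zero C c (X i)}}
          (Hom C c s))"

definition compactly_generated :: "'u set \<Rightarrow> ('o, 'm, 'z) tri_cat_scheme \<Rightarrow> bool" where
  "compactly_generated U C \<longleftrightarrow> has_small_coproducts U C \<and>
     (\<exists>G. G \<prec> U \<and> (\<forall>g\<in>G. compact_object U C g) \<and>
        (\<forall>x. (\<forall>g\<in>G. Hom C g x = {Zero C g x}) \<longrightarrow> is_zero C x))"

definition rigid_object :: "('o, 'm, 'z) tt_cat_scheme \<Rightarrow> 'o \<Rightarrow> bool" where
  "rigid_object T x \<longleftrightarrow>
     (\<exists>d. \<exists>\<eta> \<in> Hom T (Unit T) (x \<boxtimes>\<^bsub>T\<^esub> d). \<exists>\<epsilon> \<in> Hom T (d \<boxtimes>\<^bsub>T\<^esub> x) (Unit T).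
        RUnit T x \<bullet>\<^bsub>T\<^esub> (Id T x \<boxtimes>\<^sub>m\<^bsub>T\<^esub> \<epsilon>) \<bullet>\<^bsub>T\<^esub> Assoc T x d x \<bullet>\<^bsub>T\<^esub> (\<eta> \<boxtimes>\<^sub>m\<^bsub>T\<^esub> Id T x)
          = LUnit T x \<and>
        LUnit T d \<bullet>\<^bsub>T\<^esub> (\<epsilon> \<boxtimes>\<^sub>m\<^bsub>T\<^esub> Id T d) \<bullet>\<^bsub>T\<^esub>
            Inv T ((d \<boxtimes>\<^bsub>T\<^esub> x) \<boxtimes>\<^bsub>T\<^esub> d) (d \<boxtimes>\<^bsub>T\<^esub> (x \<boxtimes>\<^bsub>T\<^esub> d)) (Assoc T d x d) \<bullet>\<^bsub>T\<^esub>
            (Id T d \<boxtimes>\<^sub>m\<^bsub>T\<^esub> \<eta>)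
          = RUnit T d)"

locale rigidly_compactly_generated_tt_category = tt_category T
  for U :: "'u set" and T :: "('o, 'm, 'z) tt_cat_scheme" (structure) +
  assumes universe: "regular_uncountable U"
    and locally_small: "locally_small U T"
    and compactly_generated: "compactly_generated U T"
    and compact_iff_rigid: "compact_object U T x \<longleftrightarrow> rigid_object T x"


section \<open>Localizing ideals\<close>

text \<open>Full subcategories are represented by their sets of objects.  Closure under isomorphism and under
  \<open>Susp\<close> and its inverse follows from the two-out-of-three condition below, applied to
  \<open>x \<rightarrow> y \<rightarrow> 0\<close> and \<open>x \<rightarrow> 0 \<rightarrow> Susp x\<close>.\<close>

definition triangulated_subcategory :: "('o, 'm, 'z) tri_cat_scheme \<Rightarrow> 'o set \<Rightarrow> bool" where
  "triangulated_subcategory C L \<longleftrightarrow>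
     {x. is_zero C x} \<subseteq> L \<and>
     (\<forall>x y z f g h. Dist C x y z f g h \<longrightarrow>
        (x \<in> L \<and> y \<in> L \<longrightarrow> z \<in> L) \<and> (y \<in> L \<and> z \<in> L \<longrightarrow> x \<in> L) \<and> (x \<in> L \<and> z \<in> L \<longrightarrow> y \<in> L))"

definition localizing :: "'u set \<Rightarrow> ('o, 'm, 'z) tri_cat_scheme \<Rightarrow> 'o set \<Rightarrow> bool" where
  "localizing U C L \<longleftrightarrow> triangulated_subcategory C L \<and>
     (\<forall>I (X :: 'u \<Rightarrow> 'o) \<iota> s. I \<subseteq> U \<and> I \<prec> U \<and> is_coproduct C I X \<iota> s \<and> (\<forall>i\<in>I. X i \<in> L) \<longrightarrow> s \<in> L)"

definition localizing_ideal :: "'u set \<Rightarrow> ('o, 'm, 'z) tt_cat_scheme \<Rightarrow> 'o set \<Rightarrow> bool" where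
  "localizing_ideal U T L \<longleftrightarrow> localizing U T L \<and> (\<forall>x\<in>L. \<forall>t. t \<boxtimes>\<^bsub>T\<^esub> x \<in> L)"

abbreviation Loc :: "'u set \<Rightarrow> ('o, 'm, 'z) tri_cat_scheme \<Rightarrow> 'o set \<Rightarrow> 'o set" where
  "Loc U C E \<equiv> localizing U C hull E"

abbreviation Loc_ideal :: "'u set \<Rightarrow> ('o, 'm, 'z) tt_cat_scheme \<Rightarrow> 'o set \<Rightarrow> 'o set" where
  "Loc_ideal U T E \<equiv> localizing_ideal U T hull E"

definition minimal_localizing_ideal ::
    "'u set \<Rightarrow> ('o, 'm, 'z) tt_cat_scheme \<Rightarrow> 'o set \<Rightarrow> bool" where
  "minimal_localizing_ideal U T L \<longleftrightarrow> localizing_ideal U T L \<and> L \<noteq> {x. is_zero T x} \<and>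
     (\<forall>L'. localizing_ideal U T L' \<and> L' \<subseteq> L \<longrightarrow> L' = {x. is_zero T x} \<or> L' = L)"


section \<open>The Balmer spectrum\<close>

definition thick_ideal :: "'u set \<Rightarrow> ('o, 'm, 'z) tt_cat_scheme \<Rightarrow> 'o set \<Rightarrow> bool" where
  "thick_ideal U T J \<longleftrightarrow> J \<subseteq> {x. compact_object U T x} \<and> triangulated_subcategory T J \<and>
     (\<forall>y\<in>J. \<forall>x. is_retract T x y \<longrightarrow> x \<in> J) \<and>
     (\<forall>x\<in>J. \<forall>a. compact_object U T a \<longrightarrow> a \<boxtimes>\<^bsub>T\<^esub> x \<in> J)"

definition prime_ideal :: "'u set \<Rightarrow> ('o, 'm, 'z) tt_cat_scheme \<Rightarrow> 'o set \<Rightarrow> bool" where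
  "prime_ideal U T P \<longleftrightarrow> thick_ideal U T P \<and> P \<noteq> {x. compact_object U T x} \<and>
     (\<forall>a b. compact_object U T a \<and> compact_object U T b \<and> a \<boxtimes>\<^bsub>T\<^esub> b \<in> P \<longrightarrow> a \<in> P \<or> b \<in> P)"

definition supp :: "'u set \<Rightarrow> ('o, 'm, 'z) tt_cat_scheme \<Rightarrow> 'o \<Rightarrow> 'o set set" where
  "supp U T x = {P. prime_ideal U T P \<and> x \<notin> P}"

text \<open>The complements of the sets \<open>supp U T x\<close> are closed under finite intersections, by additivity of
  the support on direct sums, and include the whole spectrum, the complement of the support of a
  zero object; so they form a basis of the topology they generate, whose carrier is the set of all
  primes.\<close>

definition Spc :: "'u set \<Rightarrow> ('o, 'm, 'z) tt_cat_scheme \<Rightarrow> 'o set topology" where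
  "Spc U T = topology_generated_by
     {{P. prime_ideal U T P} - supp U T x | x. compact_object U T x}"

definition Thomason :: "'a topology \<Rightarrow> 'a set \<Rightarrow> bool" where
  "Thomason X Y \<longleftrightarrow>
     (\<exists>\<C>. (\<forall>C\<in>\<C>. closedin X C \<and> compactin X (topspace X - C)) \<and> Y = \<Union>\<C>)"

definition weakly_visible :: "'a topology \<Rightarrow> 'a \<Rightarrow> bool" where
  "weakly_visible X p \<longleftrightarrow>
     (\<exists>Y1 Y2. Thomason X Y1 \<and> Thomason X Y2 \<and> {p} = Y1 \<inter> (topspace X - Y2))"

definition weakly_noetherian :: "'a topology \<Rightarrow> bool" where
  "weakly_noetherian X \<longleftrightarrow> (\<forall>p \<in> topspace X. weakly_visible X p)"


section \<open>Idempotent triangles and Balmer--Favi support\<close>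

definition compacts_supported_on ::
    "'u set \<Rightarrow> ('o, 'm, 'z) tt_cat_scheme \<Rightarrow> 'o set set \<Rightarrow> 'o set" where
  "compacts_supported_on U T Y = {x. compact_object U T x \<and> supp U T x \<subseteq> Y}"

text \<open>\<open>e\<close> and \<open>f\<close> are a choice of the objects \<open>e\<^sub>Y\<close> and \<open>f\<^sub>Y\<close>.\<close>

definition idempotent_triangle ::
    "'u set \<Rightarrow> ('o, 'm, 'z) tt_cat_scheme \<Rightarrow> 'o set set \<Rightarrow> 'o \<Rightarrow> 'o \<Rightarrow> bool" where
  "idempotent_triangle U T Y e f \<longleftrightarrow>
     (\<exists>a b c. Dist T e (Unit T) f a b c) \<and> is_zero T (e \<boxtimes>\<^bsub>T\<^esub> f) \<and>
     Loc_ideal U T {e} = {t. is_zero T (f \<boxtimes>\<^bsub>T\<^esub> t)} \<and>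
     {t. is_zero T (f \<boxtimes>\<^bsub>T\<^esub> t)} = Loc U T (compacts_supported_on U T Y)"

text \<open>The object \<open>g(P)\<close> is determined by \<open>P\<close> only up to isomorphism; \<open>point_objects U T P\<close> is the class
  of all objects which the construction yields, for all choices made in it.\<close>

definition point_objects ::
    "'u set \<Rightarrow> ('o, 'm, 'z) tt_cat_scheme \<Rightarrow> 'o set \<Rightarrow> 'o set" where
  "point_objects U T P = {e1 \<boxtimes>\<^bsub>T\<^esub> f2 | e1 f1 e2 f2 Y1 Y2.
     Thomason (Spc U T) Y1 \<and> Thomason (Spc U T) Y2 \<and> {P} = Y1 \<inter> (topspace (Spc U T) - Y2) \<and>
     idempotent_triangle U T Y1 e1 f1 \<and> idempotent_triangle U T Y2 e2 f2}"

definition Supp :: "'u set \<Rightarrow> ('o, 'm, 'z) tt_cat_scheme \<Rightarrow> 'o \<Rightarrow> 'o set set" where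
  "Supp U T t =
     {P \<in> topspace (Spc U T). \<exists>g \<in> point_objects U T P. \<not> is_zero T (g \<boxtimes>\<^bsub>T\<^esub> t)}"

definition local_to_global_principle :: "'u set \<Rightarrow> ('o, 'm, 'z) tt_cat_scheme \<Rightarrow> bool" where
  "local_to_global_principle U T \<longleftrightarrow>
     (\<forall>t. Loc_ideal U T {t} =
        Loc_ideal U T {t \<boxtimes>\<^bsub>T\<^esub> g | P g. P \<in> topspace (Spc U T) \<and> g \<in> point_objects U T P})"

text \<open>The essential image of the functor \<open>g \<boxtimes> -\<close>.\<close>

definition tensor_image :: "('o, 'm, 'z) tt_cat_scheme \<Rightarrow> 'o \<Rightarrow> 'o set" where
  "tensor_image T g = {x. \<exists>t. isomorphic T x (g \<boxtimes>\<^bsub>T\<^esub> t)}"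

end

theory Submission
  imports Defs
begin

text \<open>An annihilator \<open>{t. k \<otimes> t = 0}\<close> is a localizing ideal, so vanishing statements about \<open>g(P)\<close> can be
  checked on compact objects, where they follow from comparing supports.  This gives
  \<open>g(P) \<otimes> g(Q) = 0\<close> for \<open>P \<noteq> Q\<close>, and \<open>g \<otimes> g' \<cong> g\<close> for any two choices \<open>g\<close>, \<open>g'\<close> of \<open>g(P)\<close>.  Given
  minimality and the local-to-global principle, the inverse of the support map sends \<open>Y\<close> to
  \<open>Loc\<^sub>\<otimes>\<langle>g(P) | P \<in> Y\<rangle>\<close>.  Conversely, if the support map is injective, then ideals with the same
  support coincide, which gives the local-to-global principle, and minimality because \<open>{P}\<close> has no
  proper nonempty subset.  The existence of the idempotent triangles is never needed: minimality in
  one direction and surjectivity in the other already provide an object \<open>g(P)\<close> for every \<open>P\<close>.\<close>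

section \<open>Additive and triangulated categories\<close>

text \<open>Supports see a compact object only through the primes that omit it, so to derive a
  vanishing statement from supports one must produce a prime that contains a given annihilator.
  Zorn's lemma does this inside the compact objects, once these are known to be closed under
  triangles, retracts and tensor products; hence the long preparation on compactness. Rigidity
  enters at two places: it makes a tensor product of compact objects compact, and it makes
  annihilators among the compact objects radical.

  The comparison of supports is elementary. If {P} is the part of Y1 outside Y2, then a point of Y1
  outside Y2 can only be P. The factors e are built from compact objects supported on their Thomason
  set, while the factors f kill such objects. Therefore, in a product of several e and f, each e is
  replaced by a compact object and the f stay fixed as the annihilating factor.\<close>

context category
begin

lemma is_iso_in: "is_iso C x y f \<Longrightarrow> f \<in> Hom C x y"
  by (simp add: is_iso_def)

lemma is_iso_inverse:
  assumes "is_iso C x y f"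
  obtains g where "g \<in> Hom C y x" "g \<bullet> f = Id C x" "f \<bullet> g = Id C y"
  using assms by (auto simp: is_iso_def is_inverse_def)

lemma is_isoI:
  "\<lbrakk>f \<in> Hom C x y; g \<in> Hom C y x; g \<bullet> f = Id C x; f \<bullet> g = Id C y\<rbrakk> \<Longrightarrow> is_iso C x y f"
  by (auto simp: is_iso_def is_inverse_def)

lemma is_iso_Id: "is_iso C x x (Id C x)"
  by (rule is_isoI[OF Id_in Id_in]) (simp_all add: Comp_Id[OF Id_in])

lemma is_iso_Comp:
  assumes f: "is_iso C x y f" and g: "is_iso C y z g"
  shows "is_iso C x z (g \<bullet> f)"
proof -
  obtain f' where f': "f' \<in> Hom C y x" "f' \<bullet> f = Id C x" "f \<bullet> f' = Id C y"
    using f by (rule is_iso_inverse)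
  obtain g' where g': "g' \<in> Hom C z y" "g' \<bullet> g = Id C y" "g \<bullet> g' = Id C z"
    using g by (rule is_iso_inverse)
  have f_in: "f \<in> Hom C x y" and g_in: "g \<in> Hom C y z"
    using f g by (auto simp: is_iso_def)
  have "(f' \<bullet> g') \<bullet> (g \<bullet> f) = f' \<bullet> ((g' \<bullet> g) \<bullet> f)"
    using Comp_assoc[OF Comp_in[OF f_in g_in] g'(1) f'(1)] Comp_assoc[OF f_in g_in g'(1)] by simp
  moreover have "(g \<bullet> f) \<bullet> (f' \<bullet> g') = g \<bullet> ((f \<bullet> f') \<bullet> g')"
    using Comp_assoc[OF Comp_in[OF g'(1) f'(1)] f_in g_in] Comp_assoc[OF g'(1) f'(1) f_in] by simp
  ultimately show ?thesis
    using f' g' Comp_in[OF g'(1) f'(1)] Comp_in[OF f_in g_in]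
    by (intro is_isoI[of _ _ _ "f' \<bullet> g'"]) (simp_all add: Id_Comp[OF f_in] Id_Comp[OF g'(1)])
qed

lemma is_iso_left_right_inverse:
  assumes "f \<in> Hom C x y" "g \<in> Hom C y x" "h \<in> Hom C y x" "g \<bullet> f = Id C x" "f \<bullet> h = Id C y"
  shows "is_iso C x y f"
proof -
  have "g = h"
    using Comp_assoc[OF assms(3,1,2)] assms by (simp add: Id_Comp Comp_Id)
  then show ?thesis
    using assms by (intro is_isoI[OF assms(1,2,4)]) simp
qed

lemma isomorphic_refl: "isomorphic C x x"
  using is_iso_Id by (auto simp: isomorphic_def)

lemma isomorphic_sym: "isomorphic C x y \<Longrightarrow> isomorphic C y x"
  by (meson is_isoI is_iso_in is_iso_inverse isomorphic_def)

lemma isomorphic_trans [trans]: "\<lbrakk>isomorphic C x y; isomorphic C y z\<rbrakk> \<Longrightarrow> isomorphic C x z"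
  using is_iso_Comp by (fastforce simp: isomorphic_def)

end

section \<open>Zero morphisms, signs and zero objects\<close>

context additive_category
begin

lemma Zero_in: "Zero C x y \<in> Hom C x y"
  and Plus_in: "\<lbrakk>f \<in> Hom C x y; g \<in> Hom C x y\<rbrakk> \<Longrightarrow> Plus C f g \<in> Hom C x y"
  and Neg_in: "f \<in> Hom C x y \<Longrightarrow> Neg C x y f \<in> Hom C x y"
  and Plus_assoc: "\<lbrakk>f \<in> Hom C x y; g \<in> Hom C x y; h \<in> Hom C x y\<rbrakk>
    \<Longrightarrow> Plus C (Plus C f g) h = Plus C f (Plus C g h)"
  and Zero_Plus: "f \<in> Hom C x y \<Longrightarrow> Plus C (Zero C x y) f = f"
  and Plus_Zero: "f \<in> Hom C x y \<Longrightarrow> Plus C f (Zero C x y) = f"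
  and Plus_Neg: "f \<in> Hom C x y \<Longrightarrow> Plus C f (Neg C x y f) = Zero C x y"
  and Neg_Plus: "f \<in> Hom C x y \<Longrightarrow> Plus C (Neg C x y f) f = Zero C x y"
  and Neg_Neg: "f \<in> Hom C x y \<Longrightarrow> Neg C x y (Neg C x y f) = f"
  and Neg_unique: "\<lbrakk>f \<in> Hom C x y; g \<in> Hom C x y; Plus C f g = Zero C x y\<rbrakk> \<Longrightarrow> g = Neg C x y f"
  and Plus_self_eq_Zero: "\<lbrakk>f \<in> Hom C x y; Plus C f f = f\<rbrakk> \<Longrightarrow> f = Zero C x y"
proof -
  interpret comm_group "hom_group C x y" by (rule hom_group)
  note [simp] = hom_group_def
  show "Zero C x y \<in> Hom C x y" using one_closed by simp
  show "\<lbrakk>f \<in> Hom C x y; g \<in> Hom C x y\<rbrakk> \<Longrightarrow> Plus C f g \<in> Hom C x y" using m_closed[of f g] by simp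
  show "f \<in> Hom C x y \<Longrightarrow> Neg C x y f \<in> Hom C x y" using inv_closed[of f] by simp
  show "\<lbrakk>f \<in> Hom C x y; g \<in> Hom C x y; h \<in> Hom C x y\<rbrakk>
    \<Longrightarrow> Plus C (Plus C f g) h = Plus C f (Plus C g h)" using m_assoc[of f g h] by simp
  show "f \<in> Hom C x y \<Longrightarrow> Plus C (Zero C x y) f = f" using l_one[of f] by simp
  show "f \<in> Hom C x y \<Longrightarrow> Plus C f (Zero C x y) = f" using r_one[of f] by simp
  show "f \<in> Hom C x y \<Longrightarrow> Plus C f (Neg C x y f) = Zero C x y" using r_inv[of f] by simp
  show "f \<in> Hom C x y \<Longrightarrow> Plus C (Neg C x y f) f = Zero C x y" using l_inv[of f] by simp
  show "f \<in> Hom C x y \<Longrightarrow> Neg C x y (Neg C x y f) = f" using inv_inv[of f] by simp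
  show "\<lbrakk>f \<in> Hom C x y; g \<in> Hom C x y; Plus C f g = Zero C x y\<rbrakk> \<Longrightarrow> g = Neg C x y f"
    using inv_equality[of g f] m_comm[of f g] by simp
  show "\<lbrakk>f \<in> Hom C x y; Plus C f f = f\<rbrakk> \<Longrightarrow> f = Zero C x y" using l_cancel_one[of f f] by simp
qed

lemma Zero_Comp: "f \<in> Hom C x y \<Longrightarrow> Zero C y z \<bullet> f = Zero C x z"
  using Plus_Comp[of f x y "Zero C y z" z "Zero C y z"]
  by (intro Plus_self_eq_Zero Comp_in[of _ _ y] Zero_in) (simp_all add: Zero_in Zero_Plus)

lemma Comp_Zero: "f \<in> Hom C y z \<Longrightarrow> f \<bullet> Zero C x y = Zero C x z"
  using Comp_Plus[of "Zero C x y" x y "Zero C x y" f z]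
  by (intro Plus_self_eq_Zero Comp_in[of _ _ y] Zero_in) (simp_all add: Zero_in Zero_Plus)

lemma Neg_Comp:
  assumes "f \<in> Hom C x y" "g \<in> Hom C y z"
  shows "Neg C y z g \<bullet> f = Neg C x z (g \<bullet> f)"
proof (rule Neg_unique)
  show "Plus C (g \<bullet> f) (Neg C y z g \<bullet> f) = Zero C x z"
    using Plus_Comp[OF assms Neg_in[OF assms(2)]] assms by (simp add: Plus_Neg Zero_Comp)
qed (rule Comp_in[OF assms] Comp_in[OF assms(1) Neg_in[OF assms(2)]])+

lemma Comp_Neg:
  assumes "f \<in> Hom C x y" "g \<in> Hom C y z"
  shows "g \<bullet> Neg C x y f = Neg C x z (g \<bullet> f)"
proof (rule Neg_unique)
  show "Plus C (g \<bullet> f) (g \<bullet> Neg C x y f) = Zero C x z"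
    using Comp_Plus[OF assms(1) Neg_in[OF assms(1)] assms(2)] assms by (simp add: Plus_Neg Comp_Zero)
qed (rule Comp_in[OF assms] Comp_in[OF Neg_in[OF assms(1)] assms(2)])+

lemma is_zero_to: "\<lbrakk>is_zero C x; f \<in> Hom C y x\<rbrakk> \<Longrightarrow> f = Zero C y x"
  using Zero_in[of y x] unfolding is_zero_def by blast

lemma is_zero_from: "\<lbrakk>is_zero C x; f \<in> Hom C x y\<rbrakk> \<Longrightarrow> f = Zero C x y"
  using Zero_in[of x y] unfolding is_zero_def by blast

lemma is_zero_iff_Id: "is_zero C x \<longleftrightarrow> Id C x = Zero C x x"
proof
  show "is_zero C x \<Longrightarrow> Id C x = Zero C x x"
    by (rule is_zero_to[OF _ Id_in])
next
  assume *: "Id C x = Zero C x x"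
  have "f = Zero C x y" if "f \<in> Hom C x y" for f y
    using that * by (metis Comp_Id Comp_Zero)
  moreover have "f = Zero C y x" if "f \<in> Hom C y x" for f y
    using that * by (metis Id_Comp Zero_Comp)
  ultimately show "is_zero C x"
    using Zero_in unfolding is_zero_def by metis
qed

lemma is_zero_retract:
  assumes "is_retract C x y" "is_zero C y"
  shows "is_zero C x"
proof -
  obtain i p where "i \<in> Hom C x y" "p \<in> Hom C y x" "p \<bullet> i = Id C x"
    using assms(1) by (auto simp: is_retract_def)
  then show ?thesis
    using assms(2) Zero_Comp is_zero_from is_zero_iff_Id by metis
qed

lemma isomorphic_is_retract: "isomorphic C x y \<Longrightarrow> is_retract C x y"
  by (auto simp: isomorphic_def is_retract_def is_iso_def is_inverse_def)

lemma is_zero_isomorphic: "isomorphic C x y \<Longrightarrow> is_zero C x \<longleftrightarrow> is_zero C y"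
  using is_zero_retract isomorphic_is_retract isomorphic_sym by blast

text \<open>The identity and the zero map of \<open>s\<close> agree on every summand, because a zero
  object admits only one map into \<open>s\<close>; uniqueness in the universal property identifies
  them.\<close>

lemma is_coproduct_zero:
  assumes "is_coproduct C I X \<iota> s" "\<And>i. i \<in> I \<Longrightarrow> is_zero C (X i)"
  shows "is_zero C s"
proof -
  have \<iota>: "\<iota> i \<in> Hom C (X i) s" if "i \<in> I" for i
    using assms(1) that by (simp add: is_coproduct_def)
  have "\<exists>!h. h \<in> Hom C s s \<and> (\<forall>i\<in>I. h \<bullet> \<iota> i = \<iota> i)"
    using assms(1) \<iota> by (simp add: is_coproduct_def)
  moreover have "Id C s \<bullet> \<iota> i = \<iota> i" "Zero C s s \<bullet> \<iota> i = \<iota> i" if "i \<in> I" for i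
    using \<iota>[OF that] assms(2)[OF that] by (auto simp: Id_Comp Zero_Comp dest: is_zero_from)
  ultimately show ?thesis
    using Id_in[of s] Zero_in[of s s] unfolding is_zero_iff_Id by blast
qed

end

section \<open>Weak kernels and cokernels in exact triangles\<close>

context triangulated_category
begin

lemma SuspM_in: "f \<in> Hom C x y \<Longrightarrow> SuspM C f \<in> Hom C (Susp C x) (Susp C y)"
  using SuspM_bij by (metis bij_betwE)

lemma SuspM_inj: "\<lbrakk>f \<in> Hom C x y; g \<in> Hom C x y; SuspM C f = SuspM C g\<rbrakk> \<Longrightarrow> f = g"
  using SuspM_bij by (metis bij_betw_imp_inj_on inj_onD)

lemma SuspM_surj:
  assumes "f \<in> Hom C (Susp C x) (Susp C y)"
  obtains g where "g \<in> Hom C x y" "f = SuspM C g"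
  using assms SuspM_bij[of x y] by (auto simp: bij_betw_def)

lemma SuspM_Zero: "SuspM C (Zero C x y) = Zero C (Susp C x) (Susp C y)"
  using SuspM_Plus[of "Zero C x y" x y "Zero C x y"]
  by (intro Plus_self_eq_Zero SuspM_in Zero_in) (simp add: Zero_in Zero_Plus)

lemma SuspM_Neg: "f \<in> Hom C x y \<Longrightarrow> SuspM C (Neg C x y f) = Neg C (Susp C x) (Susp C y) (SuspM C f)"
  using SuspM_Plus[of f x y "Neg C x y f"]
  by (intro Neg_unique SuspM_in) (simp_all add: Neg_in Plus_Neg SuspM_Zero)

lemma is_zero_Susp: "is_zero C (Susp C x) \<longleftrightarrow> is_zero C x"
  using SuspM_inj[OF Id_in Zero_in, of x] by (auto simp: is_zero_iff_Id simp flip: SuspM_Id SuspM_Zero)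

lemma Dist_rotated:
  "Dist C x y z f g h \<Longrightarrow> Dist C y z (Susp C x) g h (Neg C (Susp C x) (Susp C y) (SuspM C f))"
  using Dist_in Dist_rotate by blast

text \<open>\<open>g\<close> is a weak cokernel of \<open>f\<close>: \<open>Dist_fill\<close> maps
  the given triangle to the triangle in which the identity of \<open>s\<close> follows a map from a
  zero object.\<close>

lemma Dist_extend:
  assumes "Dist C x y z f g h" "\<phi> \<in> Hom C y s" "\<phi> \<bullet> f = Zero C x s"
  obtains \<psi> where "\<psi> \<in> Hom C z s" "\<psi> \<bullet> g = \<phi>"
proof -
  obtain o' where o: "is_zero C o'" using zero_object by blast
  then have o2: "is_zero C (Susp C o')" by (simp add: is_zero_Susp)
  have "Neg C (Susp C o') (Susp C s) (SuspM C (Zero C o' s)) = Zero C (Susp C o') (Susp C s)"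
    using o2 by (meson Neg_in SuspM_in Zero_in is_zero_from)
  \<comment> \<open>\<open>Dist_Id\<close> provides this triangle one rotation later, with third
    term the zero object \<open>Susp C o'\<close>; rotating back costs only the sign of a zero
    map.\<close>
  then have d: "Dist C o' s s (Zero C o' s) (Id C s) (Zero C s (Susp C o'))"
    using Dist_Id[OF o2, of s] by (simp add: Dist_rotate Zero_in Id_in)
  note d1 = Dist_in[OF assms(1)]
  obtain c where "c \<in> Hom C z s" "Id C s \<bullet> \<phi> = c \<bullet> g"
    using Dist_fill[OF assms(1) d Zero_in assms(2)] assms(3) d1 by (auto simp: Comp_Zero Zero_in)
  with that show ?thesis using assms(2) by (simp add: Id_Comp)
qed

text \<open>Dually, \<open>f\<close> is a weak kernel of \<open>g\<close>. Since
  \<open>Dist_fill\<close> produces maps between third terms, the triangle on the identity of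
  \<open>w\<close> and the given one are both rotated once, and the filler, a map between
  suspensions, is desuspended.\<close>

lemma Dist_lift:
  assumes "Dist C x y z f g h" "\<phi> \<in> Hom C w y" "g \<bullet> \<phi> = Zero C w z"
  obtains \<psi> where "\<psi> \<in> Hom C w x" "f \<bullet> \<psi> = \<phi>"
proof -
  obtain o' where o: "is_zero C o'" using zero_object by blast
  note d = Dist_rotated[OF Dist_Id[OF o, of w]]
  note d1 = Dist_in[OF assms(1)]
  obtain c where c: "c \<in> Hom C (Susp C w) (Susp C x)"
    "Neg C (Susp C x) (Susp C y) (SuspM C f) \<bullet> c = SuspM C \<phi> \<bullet> Neg C (Susp C w) (Susp C w) (SuspM C (Id C w))"
    using Dist_fill[OF d Dist_rotated[OF assms(1)] assms(2) Zero_in] assms(3) Zero_Comp[OF Zero_in]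
    by metis
  obtain \<psi> where \<psi>: "\<psi> \<in> Hom C w x" "c = SuspM C \<psi>" using c(1) by (rule SuspM_surj)
  \<comment> \<open>Each of the two rotations contributes one sign, so both sides carry a
    \<open>Neg\<close>.\<close>
  have "SuspM C (Neg C w y (f \<bullet> \<psi>)) = SuspM C (Neg C w y \<phi>)"
    using c(2) \<psi> d1 assms(2) Neg_Comp[OF SuspM_in SuspM_in, of \<psi> w x f y]
      Comp_Neg[OF SuspM_in SuspM_in, of "Id C w" w w \<phi> y] Comp_in[of \<psi> w x f y]
      SuspM_Comp[of \<psi> w x f y] SuspM_Comp[of "Id C w" w w \<phi> y]
    by (simp add: Id_in SuspM_Neg Comp_Id)
  then have "Neg C w y (f \<bullet> \<psi>) = Neg C w y \<phi>"
    using \<psi> d1 assms(2) by (meson Comp_in Neg_in SuspM_inj)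
  then have "f \<bullet> \<psi> = \<phi>"
    using \<psi> d1 assms(2) by (metis Comp_in Neg_Neg)
  with \<psi> that show ?thesis by blast
qed

text \<open>Since \<open>Susp C x\<close> is zero, the identity of \<open>z\<close> lifts along
  \<open>g\<close> and thus factors through the zero object \<open>y\<close>.\<close>

lemma Dist_zero_zero_third:
  assumes "Dist C x y z f g h" "is_zero C x" "is_zero C y"
  shows "is_zero C z"
proof -
  note d = Dist_in[OF assms(1)]
  have "h \<bullet> Id C z = Zero C z (Susp C x)"
    using assms(2) d by (metis Comp_Id is_zero_Susp is_zero_to)
  then obtain \<psi> where "\<psi> \<in> Hom C z y" "g \<bullet> \<psi> = Id C z"
    using Dist_lift[OF Dist_rotated[OF assms(1)] Id_in] by blast
  then show ?thesis
    using assms(3) d by (metis Comp_Zero is_zero_iff_Id is_zero_to)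
qed

lemma Dist_zero_zero_first:
  "\<lbrakk>Dist C x y z f g h; is_zero C y; is_zero C z\<rbrakk> \<Longrightarrow> is_zero C x"
  using Dist_zero_zero_third[OF Dist_rotated] by (simp add: is_zero_Susp)

lemma Dist_zero_zero_second:
  "\<lbrakk>Dist C x y z f g h; is_zero C x; is_zero C z\<rbrakk> \<Longrightarrow> is_zero C y"
  using Dist_zero_zero_first[OF Dist_rotated] by (simp add: is_zero_Susp)

text \<open>A right inverse of \<open>f\<close> comes from lifting the identity of \<open>y\<close>.
  A left inverse comes from extending the identity of \<open>Susp C x\<close> in the twice rotated
  triangle, whose second map is minus the suspension of \<open>f\<close>; this explains the
  \<open>Neg\<close> in the left inverse.\<close>

lemma Dist_zero_third_iso:
  assumes "Dist C x y z f g h" "is_zero C z"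
  shows "is_iso C x y f"
proof -
  note d = Dist_in[OF assms(1)]
  have "g \<bullet> Id C y = Zero C y z"
    using assms(2) d by (metis Comp_Id is_zero_to)
  then obtain m where m: "m \<in> Hom C y x" "f \<bullet> m = Id C y"
    using Dist_lift[OF assms(1) Id_in] by blast
  have "Id C (Susp C x) \<bullet> h = Zero C z (Susp C x)"
    using assms(2) d by (metis Id_Comp is_zero_from)
  then obtain l where l: "l \<in> Hom C (Susp C y) (Susp C x)"
    "l \<bullet> Neg C (Susp C x) (Susp C y) (SuspM C f) = Id C (Susp C x)"
    using Dist_extend[OF Dist_rotated[OF Dist_rotated[OF assms(1)]] Id_in] by blast
  obtain k where k: "k \<in> Hom C y x" "l = SuspM C k" using l(1) by (rule SuspM_surj)
  have "SuspM C (Neg C y x k \<bullet> f) = SuspM C (Id C x)"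
    using l(2) k d Comp_Neg[OF SuspM_in SuspM_in[OF k(1)], of f x]
      Neg_Comp[of f x y k x] Comp_in[of f x y k x]
      SuspM_Comp[of f x y k x]
    by (simp add: SuspM_Neg SuspM_Id)
  then have "Neg C y x k \<bullet> f = Id C x"
    using k d by (meson Comp_in Id_in Neg_in SuspM_inj)
  with m k d show ?thesis
    using is_iso_left_right_inverse Neg_in by blast
qed

lemma Dist_zero_first_iso:
  "\<lbrakk>Dist C x y z f g h; is_zero C x\<rbrakk> \<Longrightarrow> is_iso C y z g"
  using Dist_zero_third_iso[OF Dist_rotated] by (simp add: is_zero_Susp)

text \<open>Transporting \<open>Dist_Id\<close> along an isomorphism puts the latter into an exact
  triangle with zero third term, where two-out-of-three applies.\<close>

lemma triangulated_subcategory_isomorphic: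
  assumes "triangulated_subcategory C L" "isomorphic C x y" "x \<in> L"
  shows "y \<in> L"
proof -
  obtain o' where o: "is_zero C o'" using zero_object by blast
  obtain b where b: "is_iso C x y b" using assms(2) by (auto simp: isomorphic_def)
  have "Dist C x y o' b (Zero C y o') (Zero C o' (Susp C x))"
    by (rule Dist_iso[OF Dist_Id[OF o, of x] is_iso_Id b is_iso_Id])
      (use is_iso_in[OF b] in \<open>simp_all add: Zero_in Zero_Comp SuspM_Id Id_Comp[OF Zero_in] Comp_Id[OF Zero_in]\<close>)
  moreover have "o' \<in> L" using assms(1) o by (auto simp: triangulated_subcategory_def)
  ultimately show ?thesis using assms(1,3) unfolding triangulated_subcategory_def by blast
qed

end

section \<open>Compact objects\<close>

text \<open>For a coproduct \<open>s\<close>, this is the image of the canonical map in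
  \<open>compact_object_def\<close>. The inductive form lets closure properties be proved one
  summand at a time, without handling finitely supported families.\<close>

inductive_set finite_sums ::
    "('o, 'm, 'z) tri_cat_scheme \<Rightarrow> 'i set \<Rightarrow> ('i \<Rightarrow> 'o) \<Rightarrow> ('i \<Rightarrow> 'm) \<Rightarrow> 'o \<Rightarrow> 'o \<Rightarrow> 'm set"
  for C I X \<iota> c s where
  zero: "Zero C c s \<in> finite_sums C I X \<iota> c s"
| add: "\<lbrakk>\<phi> \<in> finite_sums C I X \<iota> c s; i \<in> I; h \<in> Hom C c (X i)\<rbrakk>
    \<Longrightarrow> Plus C \<phi> (\<iota> i \<bullet>\<^bsub>C\<^esub> h) \<in> finite_sums C I X \<iota> c s"

lemma (in category) is_coproduct_in:
  "\<lbrakk>is_coproduct C I X \<iota> s; i \<in> I\<rbrakk> \<Longrightarrow> \<iota> i \<in> Hom C (X i) s"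
  by (simp add: is_coproduct_def)

lemma (in category) is_coproduct_map:
  assumes "is_coproduct C I X \<iota> s" "\<And>i. i \<in> I \<Longrightarrow> g i \<in> Hom C (X i) y"
  obtains h where "h \<in> Hom C s y" "\<And>i. i \<in> I \<Longrightarrow> h \<bullet> \<iota> i = g i"
proof -
  have "\<exists>!h. h \<in> Hom C s y \<and> (\<forall>i\<in>I. h \<bullet> \<iota> i = g i)"
    using assms unfolding is_coproduct_def by blast
  then show ?thesis using that by blast
qed

lemma (in category) is_coproduct_eq:
  assumes "is_coproduct C I X \<iota> s" "h \<in> Hom C s y" "h' \<in> Hom C s y"
    "\<And>i. i \<in> I \<Longrightarrow> h \<bullet> \<iota> i = h' \<bullet> \<iota> i"
  shows "h = h'"
proof -
  have "\<forall>i\<in>I. h \<bullet> \<iota> i \<in> Hom C (X i) y"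
    using assms(1,2) by (auto intro: Comp_in is_coproduct_in)
  then have "\<exists>!k. k \<in> Hom C s y \<and> (\<forall>i\<in>I. k \<bullet> \<iota> i = h \<bullet> \<iota> i)"
    by (rule assms(1)[unfolded is_coproduct_def, THEN conjunct2, THEN spec[of _ y], THEN spec, THEN mp])
  moreover have "h \<in> Hom C s y \<and> (\<forall>i\<in>I. h \<bullet> \<iota> i = h \<bullet> \<iota> i)"
    using assms(2) by simp
  moreover have "h' \<in> Hom C s y \<and> (\<forall>i\<in>I. h' \<bullet> \<iota> i = h \<bullet> \<iota> i)"
    using assms(3) assms(4)[symmetric] by blast
  ultimately show ?thesis by blast
qed

lemma (in category) is_coproductI:
  assumes "\<And>i. i \<in> I \<Longrightarrow> \<iota> i \<in> Hom C (X i) s"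
    and "\<And>y g. \<forall>i\<in>I. g i \<in> Hom C (X i) y \<Longrightarrow> \<exists>h\<in>Hom C s y. \<forall>i\<in>I. h \<bullet> \<iota> i = g i"
    and "\<And>y h h'. \<lbrakk>h \<in> Hom C s y; h' \<in> Hom C s y; \<forall>i\<in>I. h \<bullet> \<iota> i = h' \<bullet> \<iota> i\<rbrakk> \<Longrightarrow> h = h'"
  shows "is_coproduct C I X \<iota> s"
  unfolding is_coproduct_def
proof (intro conjI allI impI ballI)
  fix y g assume g: "\<forall>i\<in>I. g i \<in> Hom C (X i) y"
  obtain h where h: "h \<in> Hom C s y" "\<forall>i\<in>I. h \<bullet> \<iota> i = g i"
    using assms(2)[OF g] ..
  then show "\<exists>!h. h \<in> Hom C s y \<and> (\<forall>i\<in>I. h \<bullet> \<iota> i = g i)"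
  proof (intro ex1I[of _ h])
    fix k assume "k \<in> Hom C s y \<and> (\<forall>i\<in>I. k \<bullet> \<iota> i = g i)"
    with h show "k = h" by (intro assms(3)[of k y h]) simp_all
  qed simp
qed (rule assms(1))

section \<open>Maps into coproducts and a criterion for compactness\<close>

context additive_category
begin

lemma finite_sums_in:
  assumes "\<phi> \<in> finite_sums C I X \<iota> c s" "is_coproduct C I X \<iota> s"
  shows "\<phi> \<in> Hom C c s"
  using assms(1)
  by induction (auto intro!: Zero_in Plus_in Comp_in is_coproduct_in[OF assms(2)])

lemma finite_sums_single:
  assumes "is_coproduct C I X \<iota> s" "i \<in> I" "h \<in> Hom C c (X i)"
  shows "\<iota> i \<bullet> h \<in> finite_sums C I X \<iota> c s"
  using finite_sums.add[where X = X and \<iota> = \<iota> and s = s, OF finite_sums.zero assms(2,3)]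
    Zero_Plus[OF Comp_in[OF assms(3) is_coproduct_in[OF assms(1,2)]]] by simp

lemma finite_sums_Plus:
  assumes s: "is_coproduct C I X \<iota> s" and "\<phi> \<in> finite_sums C I X \<iota> c s"
    and "\<psi> \<in> finite_sums C I X \<iota> c s"
  shows "Plus C \<phi> \<psi> \<in> finite_sums C I X \<iota> c s"
  using assms(3)
proof induction
  case zero
  then show ?case
    using assms(2) Plus_Zero[OF finite_sums_in[OF assms(2) s]] by simp
next
  case (add \<psi> i h)
  then show ?case
    using finite_sums.add[OF add(4) add(2,3)]
      Plus_assoc[OF finite_sums_in[OF assms(2) s] finite_sums_in[OF add(1) s]
        Comp_in[OF add(3) is_coproduct_in[OF s add(2)]]] by simp
qed

text \<open>One induction serves every later change of coproduct: precomposition, suspension,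
  desuspension and transposition along a duality are all additive and respect the summands.\<close>

lemma finite_sums_transport:
  assumes s: "is_coproduct C I X \<iota> s" and s': "is_coproduct C I X' \<iota>' s'"
    and "\<phi> \<in> finite_sums C I X \<iota> c s"
    and \<Phi>_in: "\<And>f. f \<in> Hom C c s \<Longrightarrow> \<Phi> f \<in> Hom C c' s'"
    and \<Phi>_Plus: "\<And>f g. \<lbrakk>f \<in> Hom C c s; g \<in> Hom C c s\<rbrakk> \<Longrightarrow> \<Phi> (Plus C f g) = Plus C (\<Phi> f) (\<Phi> g)"
    and \<Phi>: "\<And>i h. \<lbrakk>i \<in> I; h \<in> Hom C c (X i)\<rbrakk> \<Longrightarrow> \<exists>h'\<in>Hom C c' (X' i). \<Phi> (\<iota> i \<bullet> h) = \<iota>' i \<bullet> h'"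
  shows "\<Phi> \<phi> \<in> finite_sums C I X' \<iota>' c' s'"
  using assms(3)
proof induction
  case zero
  have "\<Phi> (Zero C c s) = Zero C c' s'"
    using \<Phi>_Plus[OF Zero_in Zero_in] by (intro Plus_self_eq_Zero \<Phi>_in Zero_in) (simp add: Plus_Zero Zero_in)
  then show ?case by (simp add: finite_sums.zero)
next
  case (add \<psi> i h)
  obtain h' where h': "h' \<in> Hom C c' (X' i)" "\<Phi> (\<iota> i \<bullet> h) = \<iota>' i \<bullet> h'"
    using \<Phi> add(2,3) by blast
  have "\<Phi> (Plus C \<psi> (\<iota> i \<bullet> h)) = Plus C (\<Phi> \<psi>) (\<iota>' i \<bullet> h')"
    using \<Phi>_Plus[OF finite_sums_in[OF add(1) s] Comp_in[OF add(3) is_coproduct_in[OF s add(2)]]] h'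
    by simp
  then show ?case using finite_sums.add[OF add(4) add(2) h'(1)] by simp
qed

lemma finite_sums_Comp:
  assumes s: "is_coproduct C I X \<iota> s" and "\<phi> \<in> finite_sums C I X \<iota> c s" and f: "f \<in> Hom C c' c"
  shows "\<phi> \<bullet> f \<in> finite_sums C I X \<iota> c' s"
  using finite_sums_transport[OF s s assms(2), of "\<lambda>\<phi>. \<phi> \<bullet> f" c'] f
    Comp_assoc[OF f _ is_coproduct_in[OF s]] Comp_in[OF f] Plus_Comp[OF f] by meson

lemma coproduct_projections:
  assumes "is_coproduct C I X \<iota> s"
  obtains \<pi> where "\<And>i. i \<in> I \<Longrightarrow> \<pi> i \<in> Hom C s (X i)"
    "\<And>i j. \<lbrakk>i \<in> I; j \<in> I\<rbrakk> \<Longrightarrow> \<pi> i \<bullet> \<iota> j = (if i = j then Id C (X i) else Zero C (X j) (X i))"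
proof -
  have "\<exists>p. p \<in> Hom C s (X i) \<and> (\<forall>j\<in>I. p \<bullet> \<iota> j = (if i = j then Id C (X i) else Zero C (X j) (X i)))"
    if "i \<in> I" for i
    using is_coproduct_map[OF assms, of "\<lambda>j. if i = j then Id C (X i) else Zero C (X j) (X i)" "X i"]
    by (metis Id_in Zero_in)
  with that show ?thesis by metis
qed

text \<open>Adding a map through the summand \<open>j\<close> changes only the component at
  \<open>j\<close>. The product formula is claimed for all finite \<open>G\<close> above
  \<open>F\<close>, so that the induction step may insert \<open>j\<close> whether or not it already
  lies in \<open>F\<close>.\<close>

lemma finite_sums_eq_finprod:
  assumes s: "is_coproduct C I X \<iota> s" and "\<phi> \<in> finite_sums C I X \<iota> c s"
    and \<pi>: "\<And>i. i \<in> I \<Longrightarrow> \<pi> i \<in> Hom C s (X i)"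
    "\<And>i j. \<lbrakk>i \<in> I; j \<in> I\<rbrakk> \<Longrightarrow> \<pi> i \<bullet> \<iota> j = (if i = j then Id C (X i) else Zero C (X j) (X i))"
  shows "\<exists>F. finite F \<and> F \<subseteq> I \<and> (\<forall>i\<in>I - F. \<pi> i \<bullet> \<phi> = Zero C c (X i)) \<and>
     (\<forall>G. finite G \<and> F \<subseteq> G \<and> G \<subseteq> I \<longrightarrow> finprod (hom_group C c s) (\<lambda>i. \<iota> i \<bullet> (\<pi> i \<bullet> \<phi>)) G = \<phi>)"
  using assms(2)
proof induction
  interpret H: comm_group "hom_group C c s" by (rule hom_group)
  have H [simp]: "carrier (hom_group C c s) = Hom C c s" "mult (hom_group C c s) = Plus C"
    "one (hom_group C c s) = Zero C c s"
    by (auto simp: hom_group_def)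
  {
    case zero
    have 0: "\<iota> i \<bullet> (\<pi> i \<bullet> Zero C c s) = Zero C c s" if "i \<in> I" for i
      using Comp_Zero[OF \<pi>(1)[OF that]] Comp_Zero[OF is_coproduct_in[OF s that]] by simp
    have "finprod (hom_group C c s) (\<lambda>i. \<iota> i \<bullet> (\<pi> i \<bullet> Zero C c s)) G = Zero C c s" if "G \<subseteq> I" for G
      using H.finprod_one_eqI[of G "\<lambda>i. \<iota> i \<bullet> (\<pi> i \<bullet> Zero C c s)"] 0 that by auto
    then show ?case
      using Comp_Zero[OF \<pi>(1)] by (intro exI[of _ "{}"]) auto
  next
    case (add \<phi> j h)
    note \<iota> = is_coproduct_in[OF s]
    note \<phi> = finite_sums_in[OF add(1) s]
    have jh: "\<iota> j \<bullet> h \<in> Hom C c s" using Comp_in[OF add(3) \<iota>[OF add(2)]] .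
    have \<pi>jh: "\<pi> i \<bullet> (\<iota> j \<bullet> h) = (if i = j then h else Zero C c (X i))" if "i \<in> I" for i
      using Comp_assoc[OF add(3) \<iota>[OF add(2)] \<pi>(1)[OF that]] \<pi>(2)[OF that add(2)]
        Id_Comp[OF add(3)] Zero_Comp[OF add(3)] by (auto split: if_splits)
    have \<pi>add: "\<pi> i \<bullet> Plus C \<phi> (\<iota> j \<bullet> h) = Plus C (\<pi> i \<bullet> \<phi>) (\<pi> i \<bullet> (\<iota> j \<bullet> h))" if "i \<in> I" for i
      using Comp_Plus[OF \<phi> jh \<pi>(1)[OF that]] .
    have \<iota>add: "\<iota> i \<bullet> (\<pi> i \<bullet> Plus C \<phi> (\<iota> j \<bullet> h)) = Plus C (\<iota> i \<bullet> (\<pi> i \<bullet> \<phi>)) (if i = j then \<iota> j \<bullet> h else Zero C c s)"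
      if "i \<in> I" for i
      using \<pi>add[OF that] \<pi>jh[OF that] Comp_Zero[OF \<iota>[OF that], of c]
        Comp_Plus[OF Comp_in[OF \<phi> \<pi>(1)[OF that]] Comp_in[OF jh \<pi>(1)[OF that]] \<iota>[OF that]] by auto
    obtain F where F: "finite F" "F \<subseteq> I" "\<forall>i\<in>I - F. \<pi> i \<bullet> \<phi> = Zero C c (X i)"
      and F_prod: "\<forall>G. finite G \<and> F \<subseteq> G \<and> G \<subseteq> I \<longrightarrow>
        finprod (hom_group C c s) (\<lambda>i. \<iota> i \<bullet> (\<pi> i \<bullet> \<phi>)) G = \<phi>"
      using add(4) by (elim exE conjE)
    show ?case
    proof (intro exI[of _ "insert j F"] conjI ballI allI impI)
      fix i assume "i \<in> I - insert j F"
      then show "\<pi> i \<bullet> Plus C \<phi> (\<iota> j \<bullet> h) = Zero C c (X i)"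
        using \<pi>add \<pi>jh F(3) by (simp add: Plus_Zero Zero_in)
    next
      fix G assume G: "finite G \<and> insert j F \<subseteq> G \<and> G \<subseteq> I"
      have *: "\<iota> i \<bullet> (\<pi> i \<bullet> \<phi>) \<in> Hom C c s" if "i \<in> I" for i
        using Comp_in[OF Comp_in[OF \<phi> \<pi>(1)[OF that]] \<iota>[OF that]] .
      \<comment> \<open>The sum splits into the old one and a family concentrated at
        \<open>j\<close>; the latter contributes its only term because \<open>j\<close> lies in
        \<open>G\<close>.\<close>
      have "finprod (hom_group C c s) (\<lambda>i. \<iota> i \<bullet> (\<pi> i \<bullet> Plus C \<phi> (\<iota> j \<bullet> h))) G
        = finprod (hom_group C c s) (\<lambda>i. Plus C (\<iota> i \<bullet> (\<pi> i \<bullet> \<phi>)) (if j = i then \<iota> j \<bullet> h else Zero C c s)) G"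
        using G * jh by (intro H.finprod_cong') (auto simp: \<iota>add subset_iff intro!: Plus_in Zero_in)
      also have "\<dots> = Plus C (finprod (hom_group C c s) (\<lambda>i. \<iota> i \<bullet> (\<pi> i \<bullet> \<phi>)) G)
          (finprod (hom_group C c s) (\<lambda>i. if j = i then \<iota> j \<bullet> h else Zero C c s) G)"
        using H.finprod_multf[of "\<lambda>i. \<iota> i \<bullet> (\<pi> i \<bullet> \<phi>)" G "\<lambda>i. if j = i then \<iota> j \<bullet> h else Zero C c s"]
          G * jh by (auto simp: Zero_in subset_iff Pi_def)
      also have "\<dots> = Plus C \<phi> (\<iota> j \<bullet> h)"
        using F_prod[THEN spec, of G] H.finprod_singleton[of j G "\<lambda>_. \<iota> j \<bullet> h", unfolded H] G jh by simp
      finally show "finprod (hom_group C c s) (\<lambda>i. \<iota> i \<bullet> (\<pi> i \<bullet> Plus C \<phi> (\<iota> j \<bullet> h))) G = Plus C \<phi> (\<iota> j \<bullet> h)" .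
    qed (use F add in auto)
  }
qed

lemma finprod_in_finite_sums:
  assumes s: "is_coproduct C I X \<iota> s" and "finite F" "F \<subseteq> I" "\<And>i. i \<in> F \<Longrightarrow> h i \<in> Hom C c (X i)"
  shows "finprod (hom_group C c s) (\<lambda>i. \<iota> i \<bullet> h i) F \<in> finite_sums C I X \<iota> c s"
proof -
  interpret H: comm_group "hom_group C c s" by (rule hom_group)
  have H [simp]: "carrier (hom_group C c s) = Hom C c s" "mult (hom_group C c s) = Plus C"
    "one (hom_group C c s) = Zero C c s"
    by (auto simp: hom_group_def)
  show ?thesis
    using assms(2-4)
  proof (induction F)
    case empty
    then show ?case by (simp add: finite_sums.zero)
  next
    case (insert j F)
    have *: "\<iota> i \<bullet> h i \<in> Hom C c s" if "i \<in> insert j F" for i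
      using insert.prems that by (intro Comp_in[of _ _ "X i"] is_coproduct_in[OF s]) auto
    have "finprod (hom_group C c s) (\<lambda>i. \<iota> i \<bullet> h i) (insert j F)
      = Plus C (\<iota> j \<bullet> h j) (finprod (hom_group C c s) (\<lambda>i. \<iota> i \<bullet> h i) F)"
      using H.finprod_insert[of F j "\<lambda>i. \<iota> i \<bullet> h i"] insert * by (auto simp: Pi_def)
    also have "\<dots> \<in> finite_sums C I X \<iota> c s"
      using insert by (intro finite_sums_Plus[OF s] finite_sums_single[OF s]) auto
    finally show ?case .
  qed
qed

lemma finprod_Comp:
  assumes "finite F" "\<phi> \<in> Hom C x y" "\<And>i. i \<in> F \<Longrightarrow> f i \<in> Hom C y z"
  shows "finprod (hom_group C y z) f F \<bullet> \<phi> = finprod (hom_group C x z) (\<lambda>i. f i \<bullet> \<phi>) F"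
proof -
  interpret H: comm_group "hom_group C x z" by (rule hom_group)
  interpret K: comm_group "hom_group C y z" by (rule hom_group)
  have [simp]: "carrier (hom_group C v w) = Hom C v w" "mult (hom_group C v w) = Plus C"
    "one (hom_group C v w) = Zero C v w" for v w
    by (auto simp: hom_group_def)
  show ?thesis
    using assms(1,3)
  proof (induction F)
    case empty
    then show ?case using Zero_Comp[OF assms(2)] by simp
  next
    case (insert j F)
    have "finprod (hom_group C y z) f F \<in> Hom C y z"
      using K.finprod_closed[of f F] insert by (auto simp: Pi_def)
    then show ?case
      using insert K.finprod_insert[of F j f] H.finprod_insert[of F j "\<lambda>i. f i \<bullet> \<phi>"]
        Plus_Comp[OF assms(2), of "f j" z] Comp_in[OF assms(2)] by (auto simp: Pi_def)
  qed
qed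

text \<open>\<open>p\<close> truncates the identity of \<open>s\<close> to finitely many summands,
  as a sum of the maps \<open>\<iota> i \<bullet> \<pi> i\<close>. It fixes \<phi> and is itself a
  finite sum, which is what the two-out-of-three argument for compactness uses.\<close>

lemma finite_sums_eq_sum_components:
  assumes s: "is_coproduct C I X \<iota> s" and \<phi>: "\<phi> \<in> finite_sums C I X \<iota> c s"
  obtains p where "p \<in> finite_sums C I X \<iota> s s" "p \<bullet> \<phi> = \<phi>"
proof -
  obtain \<pi> where \<pi>: "\<And>i. i \<in> I \<Longrightarrow> \<pi> i \<in> Hom C s (X i)"
    "\<And>i j. \<lbrakk>i \<in> I; j \<in> I\<rbrakk> \<Longrightarrow> \<pi> i \<bullet> \<iota> j = (if i = j then Id C (X i) else Zero C (X j) (X i))"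
    using coproduct_projections[OF s] by blast
  obtain F where F: "finite F" "F \<subseteq> I"
    "finprod (hom_group C c s) (\<lambda>i. \<iota> i \<bullet> (\<pi> i \<bullet> \<phi>)) F = \<phi>"
    using finite_sums_eq_finprod[OF s \<phi> \<pi>] by blast
  let ?p = "finprod (hom_group C s s) (\<lambda>i. \<iota> i \<bullet> \<pi> i) F"
  have \<phi>_in: "\<phi> \<in> Hom C c s" by (rule finite_sums_in[OF \<phi> s])
  have "?p \<bullet> \<phi> = finprod (hom_group C c s) (\<lambda>i. (\<iota> i \<bullet> \<pi> i) \<bullet> \<phi>) F"
    using F(2) by (intro finprod_Comp[OF F(1) \<phi>_in] Comp_in[OF \<pi>(1) is_coproduct_in[OF s]]) auto
  also have "\<dots> = finprod (hom_group C c s) (\<lambda>i. \<iota> i \<bullet> (\<pi> i \<bullet> \<phi>)) F"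
  proof -
    interpret H: comm_group "hom_group C c s" by (rule hom_group)
    have "(\<iota> i \<bullet> \<pi> i) \<bullet> \<phi> = \<iota> i \<bullet> (\<pi> i \<bullet> \<phi>)" "\<iota> i \<bullet> (\<pi> i \<bullet> \<phi>) \<in> Hom C c s" if "i \<in> F" for i
      using that F(2) Comp_assoc[OF \<phi>_in \<pi>(1) is_coproduct_in[OF s]]
        Comp_in[OF Comp_in[OF \<phi>_in \<pi>(1)] is_coproduct_in[OF s]] by (auto simp: subset_iff)
    then show ?thesis
      by (intro H.finprod_cong') (auto simp: hom_group_def)
  qed
  finally have "?p \<bullet> \<phi> = \<phi>" using F(3) by simp
  moreover have "?p \<in> finite_sums C I X \<iota> s s"
    using F \<pi>(1) by (intro finprod_in_finite_sums[OF s]) auto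
  ultimately show ?thesis using that by blast
qed

text \<open>The canonical map is injective for every coproduct, since the projections recover the
  components of a finite sum; so surjectivity decides.\<close>

lemma compact_object_iff:
  "compact_object U C c \<longleftrightarrow>
    (\<forall>I X \<iota> s. I \<subseteq> U \<and> I \<prec> U \<and> is_coproduct C I X \<iota> s \<longrightarrow> Hom C c s \<subseteq> finite_sums C I X \<iota> c s)"
  (is "_ \<longleftrightarrow> ?R")
proof
  assume c: "compact_object U C c"
  show ?R
  proof (intro allI impI subsetI)
    fix I X \<iota> s \<phi>
    assume s: "I \<subseteq> U \<and> I \<prec> U \<and> is_coproduct C I X \<iota> s" and \<phi>: "\<phi> \<in> Hom C c s"
    have "\<phi> \<in> (\<lambda>h. finprod (hom_group C c s) (\<lambda>i. \<iota> i \<bullet> h i) {i\<in>I. h i \<noteq> Zero C c (X i)}) `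
          {h \<in> (\<Pi>\<^sub>E i\<in>I. Hom C c (X i)). finite {i\<in>I. h i \<noteq> Zero C c (X i)}}"
      using c s \<phi> unfolding compact_object_def bij_betw_def by blast
    then show "\<phi> \<in> finite_sums C I X \<iota> c s"
      using s by (auto intro!: finprod_in_finite_sums)
  qed
next
  assume R: ?R
  show "compact_object U C c"
    unfolding compact_object_def
  proof (intro allI impI)
    fix I X \<iota> s
    assume a: "I \<subseteq> U \<and> I \<prec> U \<and> is_coproduct C I X \<iota> s"
    then have s: "is_coproduct C I X \<iota> s" by blast
    have sub: "Hom C c s \<subseteq> finite_sums C I X \<iota> c s" using R a by blast
    obtain \<pi> where \<pi>: "\<And>i. i \<in> I \<Longrightarrow> \<pi> i \<in> Hom C s (X i)"
      "\<And>i j. \<lbrakk>i \<in> I; j \<in> I\<rbrakk> \<Longrightarrow> \<pi> i \<bullet> \<iota> j = (if i = j then Id C (X i) else Zero C (X j) (X i))"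
      using coproduct_projections[OF s] by blast
    let ?A = "{h \<in> (\<Pi>\<^sub>E i\<in>I. Hom C c (X i)). finite {i\<in>I. h i \<noteq> Zero C c (X i)}}"
    let ?f = "\<lambda>h. finprod (hom_group C c s) (\<lambda>i. \<iota> i \<bullet> h i) {i\<in>I. h i \<noteq> Zero C c (X i)}"
    interpret H: comm_group "hom_group C c s" by (rule hom_group)
    have H [simp]: "carrier (hom_group C c s) = Hom C c s" "mult (hom_group C c s) = Plus C"
      "one (hom_group C c s) = Zero C c s"
      by (auto simp: hom_group_def)
    have f_in: "?f h \<in> finite_sums C I X \<iota> c s" if "h \<in> ?A" for h
      using that by (auto intro!: finprod_in_finite_sums[OF s])
    have comp: "\<pi> j \<bullet> ?f h = h j" if h: "h \<in> ?A" and j: "j \<in> I" for h j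
    proof -
      \<comment> \<open>Claimed for arbitrary finite \<open>F\<close> to allow induction; the
        support of \<open>h\<close> is substituted afterwards.\<close>
      have "\<pi> j \<bullet> finprod (hom_group C c s) (\<lambda>i. \<iota> i \<bullet> h i) F = (if j \<in> F then h j else Zero C c (X j))"
        if "finite F" "F \<subseteq> I" for F
        using that
      proof (induction F)
        case empty
        then show ?case using Comp_Zero[OF \<pi>(1)[OF j]] by simp
      next
        case (insert k F)
        have *: "\<iota> i \<bullet> h i \<in> Hom C c s" if "i \<in> I" for i
          using h that by (intro Comp_in[of _ _ "X i"] is_coproduct_in[OF s]) auto
        have hI: "h i \<in> Hom C c (X i)" if "i \<in> I" for i using h that by auto
        have k: "k \<in> I" using insert by blast
        have 1: "\<pi> j \<bullet> (\<iota> k \<bullet> h k) = (if j = k then h k else Zero C c (X j))"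
          using Comp_assoc[OF hI[OF k] is_coproduct_in[OF s k] \<pi>(1)[OF j]] \<pi>(2)[OF j k]
            Id_Comp[OF hI[OF k]] Zero_Comp[OF hI[OF k]] by (auto split: if_splits)
        have "finprod (hom_group C c s) (\<lambda>i. \<iota> i \<bullet> h i) (insert k F)
          = Plus C (\<iota> k \<bullet> h k) (finprod (hom_group C c s) (\<lambda>i. \<iota> i \<bullet> h i) F)"
          using H.finprod_insert[of F k "\<lambda>i. \<iota> i \<bullet> h i"] insert * by (auto simp: Pi_def subset_iff)
        moreover have "finprod (hom_group C c s) (\<lambda>i. \<iota> i \<bullet> h i) F \<in> Hom C c s"
          using H.finprod_closed[of "\<lambda>i. \<iota> i \<bullet> h i" F] insert * by (auto simp: Pi_def subset_iff)
        ultimately have "\<pi> j \<bullet> finprod (hom_group C c s) (\<lambda>i. \<iota> i \<bullet> h i) (insert k F)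
          = Plus C (\<pi> j \<bullet> (\<iota> k \<bullet> h k)) (\<pi> j \<bullet> finprod (hom_group C c s) (\<lambda>i. \<iota> i \<bullet> h i) F)"
          using Comp_Plus[OF *[OF k] _ \<pi>(1)[OF j]] by simp
        then show ?case
          using 1 insert hI[OF j] by (auto simp: Plus_Zero Zero_Plus Zero_in)
      qed
      from this[of "{i\<in>I. h i \<noteq> Zero C c (X i)}"] show ?thesis
        using h j by auto
    qed
    show "bij_betw ?f ?A (Hom C c s)"
    proof (rule bij_betwI[where g = "\<lambda>\<phi>. \<lambda>i\<in>I. \<pi> i \<bullet> \<phi>"])
      show "?f \<in> ?A \<rightarrow> Hom C c s"
        using finite_sums_in[OF f_in s] by blast
    next
      \<comment> \<open>\<open>finite_sums_eq_finprod\<close> yields some finite \<open>F\<close>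
        outside which the components vanish. Dropping the zero terms inside \<open>F\<close> leaves
        exactly the support over which the definition takes the sum.\<close>
      have *: "finite {i\<in>I. \<pi> i \<bullet> \<phi> \<noteq> Zero C c (X i)} \<and>
          finprod (hom_group C c s) (\<lambda>i. \<iota> i \<bullet> (\<pi> i \<bullet> \<phi>)) {i\<in>I. \<pi> i \<bullet> \<phi> \<noteq> Zero C c (X i)} = \<phi>"
        if \<phi>: "\<phi> \<in> Hom C c s" for \<phi>
      proof -
        let ?S = "{i\<in>I. \<pi> i \<bullet> \<phi> \<noteq> Zero C c (X i)}"
        obtain F where F: "finite F" "F \<subseteq> I" "?S \<subseteq> F"
          "finprod (hom_group C c s) (\<lambda>i. \<iota> i \<bullet> (\<pi> i \<bullet> \<phi>)) F = \<phi>"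
          using finite_sums_eq_finprod[OF s subsetD[OF sub \<phi>] \<pi>] by blast
        have "\<iota> i \<bullet> (\<pi> i \<bullet> \<phi>) = Zero C c s" if "i \<in> F - ?S" for i
          using that F(2) Comp_Zero[OF is_coproduct_in[OF s]] by auto
        moreover have "\<iota> i \<bullet> (\<pi> i \<bullet> \<phi>) \<in> Hom C c s" if "i \<in> F" for i
          using that F(2) Comp_in[OF Comp_in[OF \<phi> \<pi>(1)] is_coproduct_in[OF s]] by blast
        ultimately have "finprod (hom_group C c s) (\<lambda>i. \<iota> i \<bullet> (\<pi> i \<bullet> \<phi>)) ?S
            = finprod (hom_group C c s) (\<lambda>i. \<iota> i \<bullet> (\<pi> i \<bullet> \<phi>)) F"
          using F(1,3) by (intro H.finprod_mono_neutral_cong_left) (auto simp: Pi_def)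
        with F show ?thesis using finite_subset by auto
      qed
      show "(\<lambda>\<phi>. \<lambda>i\<in>I. \<pi> i \<bullet> \<phi>) \<in> Hom C c s \<rightarrow> ?A"
      proof
        fix \<phi> assume \<phi>: "\<phi> \<in> Hom C c s"
        have "{i\<in>I. (\<lambda>i\<in>I. \<pi> i \<bullet> \<phi>) i \<noteq> Zero C c (X i)} = {i\<in>I. \<pi> i \<bullet> \<phi> \<noteq> Zero C c (X i)}" by auto
        then show "(\<lambda>i\<in>I. \<pi> i \<bullet> \<phi>) \<in> ?A"
          using *[OF \<phi>] Comp_in[OF \<phi> \<pi>(1)] by auto
      qed
      show "?f (\<lambda>i\<in>I. \<pi> i \<bullet> \<phi>) = \<phi>" if \<phi>: "\<phi> \<in> Hom C c s" for \<phi>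
      proof -
        have S: "{i\<in>I. (\<lambda>i\<in>I. \<pi> i \<bullet> \<phi>) i \<noteq> Zero C c (X i)} = {i\<in>I. \<pi> i \<bullet> \<phi> \<noteq> Zero C c (X i)}" by auto
        have "?f (\<lambda>i\<in>I. \<pi> i \<bullet> \<phi>) = finprod (hom_group C c s) (\<lambda>i. \<iota> i \<bullet> (\<pi> i \<bullet> \<phi>)) {i\<in>I. \<pi> i \<bullet> \<phi> \<noteq> Zero C c (X i)}"
          unfolding S
          using Comp_in[OF Comp_in[OF \<phi> \<pi>(1)] is_coproduct_in[OF s]] by (intro H.finprod_cong') auto
        with *[OF \<phi>] show ?thesis by simp
      qed
      show "(\<lambda>i\<in>I. \<pi> i \<bullet> ?f h) = h" if "h \<in> ?A" for h
        using comp[OF that] that by (auto intro!: ext simp: restrict_def PiE_def extensional_def)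
    qed
  qed
qed

lemma compact_object_retract:
  assumes "compact_object U C y" "is_retract C x y"
  shows "compact_object U C x"
  unfolding compact_object_iff
proof (intro allI impI subsetI)
  fix I X \<iota> s \<phi>
  assume s: "I \<subseteq> U \<and> I \<prec> U \<and> is_coproduct C I X \<iota> s" and \<phi>: "\<phi> \<in> Hom C x s"
  obtain i p where ip: "i \<in> Hom C x y" "p \<in> Hom C y x" "p \<bullet> i = Id C x"
    using assms(2) by (auto simp: is_retract_def)
  have "\<phi> \<bullet> p \<in> finite_sums C I X \<iota> y s"
    using assms(1) s Comp_in[OF ip(2) \<phi>] unfolding compact_object_iff by blast
  then have "(\<phi> \<bullet> p) \<bullet> i \<in> finite_sums C I X \<iota> x s"
    using s ip(1) by (auto intro: finite_sums_Comp)
  then show "\<phi> \<in> finite_sums C I X \<iota> x s"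
    using Comp_assoc[OF ip(1,2) \<phi>] ip(3) Comp_Id[OF \<phi>] by simp
qed

end

section \<open>Coproducts and compactness under isomorphism and suspension\<close>

context category
begin

lemma iso_epi:
  assumes "is_iso C x y f" "a \<in> Hom C y z" "b \<in> Hom C y z" "a \<bullet> f = b \<bullet> f"
  shows "a = b"
proof -
  obtain g where g: "g \<in> Hom C y x" "f \<bullet> g = Id C y"
    using assms(1) by (rule is_iso_inverse)
  have "h = (h \<bullet> f) \<bullet> g" if "h \<in> Hom C y z" for h
    using Comp_assoc[OF g(1) is_iso_in[OF assms(1)] that] g(2) Comp_Id[OF that] by simp
  from this[OF assms(2)] this[OF assms(3)] assms(4) show ?thesis by argo
qed

lemma is_iso_cancel:
  assumes "is_iso C y z f" "g \<in> Hom C x y" "is_iso C x z (f \<bullet> g)"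
  shows "is_iso C x y g"
proof -
  obtain f' where f': "f' \<in> Hom C z y" "f' \<bullet> f = Id C y" "f \<bullet> f' = Id C z"
    using assms(1) by (rule is_iso_inverse)
  have "is_iso C z y f'"
    using f' is_iso_in[OF assms(1)] by (rule_tac is_isoI)
  then have "is_iso C x y (f' \<bullet> (f \<bullet> g))"
    using assms(3) by (rule_tac is_iso_Comp)
  then show ?thesis
    using Comp_assoc[OF assms(2) is_iso_in[OF assms(1)] f'(1)] f'(2) Id_Comp[OF assms(2)] by simp
qed

lemma is_coproduct_iso:
  assumes s: "is_coproduct C I X \<iota> s"
    and u: "\<And>i. i \<in> I \<Longrightarrow> is_iso C (X i) (Y i) (u i)" and v: "is_iso C s t v"
    and \<kappa>: "\<And>i. i \<in> I \<Longrightarrow> \<kappa> i \<in> Hom C (Y i) t"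
    and eq: "\<And>i. i \<in> I \<Longrightarrow> \<kappa> i \<bullet> u i = v \<bullet> \<iota> i"
  shows "is_coproduct C I Y \<kappa> t"
proof (rule is_coproductI)
  obtain v' where v': "v' \<in> Hom C t s" "v' \<bullet> v = Id C s"
    using v by (rule is_iso_inverse)
  note v_in = is_iso_in[OF v] and u_in = is_iso_in[OF u] and \<iota> = is_coproduct_in[OF s]
  fix y g assume g: "\<forall>i\<in>I. g i \<in> Hom C (Y i) y"
  obtain h where h: "h \<in> Hom C s y" "\<And>i. i \<in> I \<Longrightarrow> h \<bullet> \<iota> i = g i \<bullet> u i"
    using is_coproduct_map[OF s, of "\<lambda>i. g i \<bullet> u i" y] g Comp_in[OF u_in] by blast
  have "(h \<bullet> v') \<bullet> \<kappa> i = g i" if i: "i \<in> I" for i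
  proof (rule iso_epi[OF u[OF i] Comp_in[OF \<kappa>[OF i] Comp_in[OF v'(1) h(1)]]])
    have "((h \<bullet> v') \<bullet> \<kappa> i) \<bullet> u i = h \<bullet> (v' \<bullet> (v \<bullet> \<iota> i))"
      using Comp_assoc[OF u_in[OF i] \<kappa>[OF i] Comp_in[OF v'(1) h(1)]] eq[OF i]
        Comp_assoc[OF Comp_in[OF \<iota>[OF i] v_in] v'(1) h(1)] by simp
    also have "\<dots> = g i \<bullet> u i"
      using Comp_assoc[OF \<iota>[OF i] v_in v'(1)] v'(2) h(2)[OF i] Id_Comp[OF \<iota>[OF i]] by simp
    finally show "((h \<bullet> v') \<bullet> \<kappa> i) \<bullet> u i = g i \<bullet> u i" .
  qed (use g i in blast)
  then show "\<exists>h\<in>Hom C t y. \<forall>i\<in>I. h \<bullet> \<kappa> i = g i"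
    using Comp_in[OF v'(1) h(1)] by blast
next
  note v_in = is_iso_in[OF v] and u_in = is_iso_in[OF u] and \<iota> = is_coproduct_in[OF s]
  fix y h h' assume h: "h \<in> Hom C t y" "h' \<in> Hom C t y" and hh': "\<forall>i\<in>I. h \<bullet> \<kappa> i = h' \<bullet> \<kappa> i"
  have *: "(k \<bullet> v) \<bullet> \<iota> i = (k \<bullet> \<kappa> i) \<bullet> u i" if i: "i \<in> I" and k: "k \<in> Hom C t y" for i k
    using Comp_assoc[OF \<iota>[OF i] v_in k] Comp_assoc[OF u_in[OF i] \<kappa>[OF i] k] eq[OF i] by simp
  have "h \<bullet> v = h' \<bullet> v"
    using hh' h by (intro is_coproduct_eq[OF s Comp_in[OF v_in h(1)] Comp_in[OF v_in h(2)]]) (simp add: *)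
  then show "h = h'" by (rule iso_epi[OF v h])
qed (rule \<kappa>)

end

context triangulated_category
begin

lemma Susp_ess_surj_iso:
  obtains x u v where "is_iso C (Susp C x) y u" "u \<in> Hom C (Susp C x) y" "v \<in> Hom C y (Susp C x)"
    "v \<bullet> u = Id C (Susp C x)" "u \<bullet> v = Id C y"
proof -
  obtain x u where u: "is_iso C (Susp C x) y u"
    using Susp_ess_surj[of y] by (auto simp: isomorphic_def)
  then obtain v where "v \<in> Hom C y (Susp C x)" "v \<bullet> u = Id C (Susp C x)" "u \<bullet> v = Id C y"
    by (rule is_iso_inverse)
  with that u is_iso_in[OF u] show ?thesis by blast
qed

text \<open>\<open>Susp\<close> is an equivalence that need not be surjective on objects. A target
  \<open>y\<close> is therefore replaced by an isomorphic suspension, after which full faithfulness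
  brings maps and equations down to \<open>s\<close>.\<close>

lemma is_coproduct_Susp:
  assumes s: "is_coproduct C I X \<iota> s"
  shows "is_coproduct C I (\<lambda>i. Susp C (X i)) (\<lambda>i. SuspM C (\<iota> i)) (Susp C s)"
proof (rule is_coproductI)
  note \<iota> = is_coproduct_in[OF s]
  fix y g assume g: "\<forall>i\<in>I. g i \<in> Hom C (Susp C (X i)) y"
  obtain y' v w where v: "v \<in> Hom C (Susp C y') y" and w: "w \<in> Hom C y (Susp C y')" "v \<bullet> w = Id C y"
    by (rule Susp_ess_surj_iso)
  have "\<exists>k. k \<in> Hom C (X i) y' \<and> w \<bullet> g i = SuspM C k" if i: "i \<in> I" for i
  proof -
    obtain k where "k \<in> Hom C (X i) y'" "w \<bullet> g i = SuspM C k"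
      by (rule SuspM_surj[OF Comp_in[OF bspec[OF g i] w(1)]])
    then show ?thesis by blast
  qed
  then obtain k where k: "\<And>i. i \<in> I \<Longrightarrow> k i \<in> Hom C (X i) y'" "\<And>i. i \<in> I \<Longrightarrow> w \<bullet> g i = SuspM C (k i)"
    by metis
  obtain h where h: "h \<in> Hom C s y'" "\<And>i. i \<in> I \<Longrightarrow> h \<bullet> \<iota> i = k i"
    using is_coproduct_map[OF s k(1)] by blast
  have "(v \<bullet> SuspM C h) \<bullet> SuspM C (\<iota> i) = g i" if i: "i \<in> I" for i
  proof -
    have gi: "g i \<in> Hom C (Susp C (X i)) y" using g i by blast
    show ?thesis
      using Comp_assoc[OF SuspM_in[OF \<iota>[OF i]] SuspM_in[OF h(1)] v] SuspM_Comp[OF \<iota>[OF i] h(1)]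
        h(2)[OF i] k(2)[OF i] Comp_assoc[OF gi w(1) v] w(2) Id_Comp[OF gi] by simp
  qed
  then show "\<exists>h\<in>Hom C (Susp C s) y. \<forall>i\<in>I. h \<bullet> SuspM C (\<iota> i) = g i"
    using Comp_in[OF SuspM_in[OF h(1)] v] by blast
next
  note \<iota> = is_coproduct_in[OF s]
  fix y h h' assume h: "h \<in> Hom C (Susp C s) y" "h' \<in> Hom C (Susp C s) y"
    and hh': "\<forall>i\<in>I. h \<bullet> SuspM C (\<iota> i) = h' \<bullet> SuspM C (\<iota> i)"
  obtain y' v w where v: "v \<in> Hom C (Susp C y') y" and w: "w \<in> Hom C y (Susp C y')" "v \<bullet> w = Id C y"
    by (rule Susp_ess_surj_iso)
  obtain k where k: "k \<in> Hom C s y'" "w \<bullet> h = SuspM C k"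
    using Comp_in[OF h(1) w(1)] by (rule SuspM_surj)
  obtain k' where k': "k' \<in> Hom C s y'" "w \<bullet> h' = SuspM C k'"
    using Comp_in[OF h(2) w(1)] by (rule SuspM_surj)
  have "k = k'"
  proof (rule is_coproduct_eq[OF s k(1) k'(1)])
    fix i assume i: "i \<in> I"
    have "SuspM C (k \<bullet> \<iota> i) = SuspM C (k' \<bullet> \<iota> i)"
      using SuspM_Comp[OF \<iota>[OF i] k(1)] SuspM_Comp[OF \<iota>[OF i] k'(1)]
        Comp_assoc[OF SuspM_in[OF \<iota>[OF i]] h(1) w(1)] Comp_assoc[OF SuspM_in[OF \<iota>[OF i]] h(2) w(1)]
        hh' i k(2) k'(2) by simp
    then show "k \<bullet> \<iota> i = k' \<bullet> \<iota> i"
      by (rule SuspM_inj[OF Comp_in[OF \<iota>[OF i] k(1)] Comp_in[OF \<iota>[OF i] k'(1)]])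
  qed
  then show "h = h'"
    using k(2) k'(2) Comp_assoc[OF h(1) w(1) v] Comp_assoc[OF h(2) w(1) v] w(2)
      Id_Comp[OF h(1)] Id_Comp[OF h(2)] by simp
qed (rule SuspM_in[OF is_coproduct_in[OF s]])

lemma is_coproduct_Susp_reflect:
  assumes s: "is_coproduct C I (\<lambda>i. Susp C (X i)) (\<lambda>i. SuspM C (\<iota> i)) (Susp C s)"
    and \<iota>: "\<And>i. i \<in> I \<Longrightarrow> \<iota> i \<in> Hom C (X i) s"
  shows "is_coproduct C I X \<iota> s"
proof (rule is_coproductI)
  fix y g assume g: "\<forall>i\<in>I. g i \<in> Hom C (X i) y"
  obtain h0 where h0: "h0 \<in> Hom C (Susp C s) (Susp C y)" "\<And>i. i \<in> I \<Longrightarrow> h0 \<bullet> SuspM C (\<iota> i) = SuspM C (g i)"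
    using is_coproduct_map[OF s, of "\<lambda>i. SuspM C (g i)"] g SuspM_in by blast
  obtain h where h: "h \<in> Hom C s y" "h0 = SuspM C h" using h0(1) by (rule SuspM_surj)
  have "h \<bullet> \<iota> i = g i" if i: "i \<in> I" for i
  proof (rule SuspM_inj[OF Comp_in[OF \<iota>[OF i] h(1)]])
    show "SuspM C (h \<bullet> \<iota> i) = SuspM C (g i)"
      using SuspM_Comp[OF \<iota>[OF i] h(1)] h0(2)[OF i] h(2) by simp
  qed (use g i in blast)
  with h(1) show "\<exists>h\<in>Hom C s y. \<forall>i\<in>I. h \<bullet> \<iota> i = g i" by blast
next
  fix y h h' assume h: "h \<in> Hom C s y" "h' \<in> Hom C s y" and hh': "\<forall>i\<in>I. h \<bullet> \<iota> i = h' \<bullet> \<iota> i"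
  have "SuspM C h = SuspM C h'"
  proof (rule is_coproduct_eq[OF s SuspM_in[OF h(1)] SuspM_in[OF h(2)]])
    fix i assume i: "i \<in> I"
    then show "SuspM C h \<bullet> SuspM C (\<iota> i) = SuspM C h' \<bullet> SuspM C (\<iota> i)"
      using SuspM_Comp[OF \<iota>[OF i] h(1)] SuspM_Comp[OF \<iota>[OF i] h(2)] hh' by simp
  qed
  then show "h = h'" by (rule SuspM_inj[OF h])
qed (rule \<iota>)

text \<open>A coproduct of the \<open>X i\<close> is isomorphic to the suspension of a coproduct of
  desuspensions \<open>X' i\<close>. A map from \<open>Susp C c\<close> into it comes from a map out
  of \<open>c\<close>, to which compactness of \<open>c\<close> applies.\<close>

lemma compact_object_Susp:
  assumes "compact_object U C c"
  shows "compact_object U C (Susp C c)"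
  unfolding compact_object_iff
proof (intro allI impI subsetI)
  fix I X \<iota> s \<phi>
  assume a: "I \<subseteq> U \<and> I \<prec> U \<and> is_coproduct C I X \<iota> s" and \<phi>: "\<phi> \<in> Hom C (Susp C c) s"
  then have s: "is_coproduct C I X \<iota> s" by blast
  note \<iota> = is_coproduct_in[OF s]
  have "\<forall>i. \<exists>x u u'. u \<in> Hom C (Susp C x) (X i) \<and> u' \<in> Hom C (X i) (Susp C x) \<and>
      u' \<bullet> u = Id C (Susp C x) \<and> u \<bullet> u' = Id C (X i)"
    by (meson Susp_ess_surj_iso)
  then obtain X' u u' where u: "\<And>i. u i \<in> Hom C (Susp C (X' i)) (X i)" "\<And>i. u' i \<in> Hom C (X i) (Susp C (X' i))"
    "\<And>i. u' i \<bullet> u i = Id C (Susp C (X' i))" "\<And>i. u i \<bullet> u' i = Id C (X i)"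
    by metis
  obtain s' v v' where v: "v \<in> Hom C (Susp C s') s" "v' \<in> Hom C s (Susp C s')"
    "v' \<bullet> v = Id C (Susp C s')" "v \<bullet> v' = Id C s"
    by (rule Susp_ess_surj_iso)
  have \<iota>u: "\<iota> i \<bullet> u i \<in> Hom C (Susp C (X' i)) s" if "i \<in> I" for i
    using Comp_in[OF u(1) \<iota>[OF that]] .
  have "\<exists>k. k \<in> Hom C (X' i) s' \<and> v' \<bullet> (\<iota> i \<bullet> u i) = SuspM C k" if i: "i \<in> I" for i
  proof -
    obtain k where "k \<in> Hom C (X' i) s'" "v' \<bullet> (\<iota> i \<bullet> u i) = SuspM C k"
      by (rule SuspM_surj[OF Comp_in[OF \<iota>u[OF i] v(2)]])
    then show ?thesis by blast
  qed
  then obtain \<iota>' where \<iota>': "\<And>i. i \<in> I \<Longrightarrow> \<iota>' i \<in> Hom C (X' i) s'"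
    "\<And>i. i \<in> I \<Longrightarrow> v' \<bullet> (\<iota> i \<bullet> u i) = SuspM C (\<iota>' i)"
    by metis
  have "is_coproduct C I (\<lambda>i. Susp C (X' i)) (\<lambda>i. SuspM C (\<iota>' i)) (Susp C s')"
  proof (rule is_coproduct_iso[OF s])
    show "is_iso C (X i) (Susp C (X' i)) (u' i)" if "i \<in> I" for i
      by (rule is_isoI[OF u(2,1,4,3)])
    show "is_iso C s (Susp C s') v'"
      by (rule is_isoI[OF v(2,1,4,3)])
    show "SuspM C (\<iota>' i) \<bullet> u' i = v' \<bullet> \<iota> i" if i: "i \<in> I" for i
      using Comp_assoc[OF u(2) \<iota>u[OF i] v(2)] Comp_assoc[OF u(2,1) \<iota>[OF i]] \<iota>'(2)[OF i] u(4)
        Comp_Id[OF \<iota>[OF i]] by simp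
  qed (rule SuspM_in[OF \<iota>'(1)])
  then have s': "is_coproduct C I X' \<iota>' s'"
    by (rule is_coproduct_Susp_reflect[OF _ \<iota>'(1)])
  obtain \<phi>' where \<phi>': "\<phi>' \<in> Hom C c s'" "v' \<bullet> \<phi> = SuspM C \<phi>'"
    using Comp_in[OF \<phi> v(2)] by (rule SuspM_surj)
  have "\<phi>' \<in> finite_sums C I X' \<iota>' c s'"
    using assms a s' \<phi>'(1) unfolding compact_object_iff by blast
  \<comment> \<open>The way back is suspension followed by the isomorphism \<open>v\<close>, an
    additive operation that respects the summands.\<close>
  then have "v \<bullet> SuspM C \<phi>' \<in> finite_sums C I X \<iota> (Susp C c) s"
  proof (rule finite_sums_transport[OF s' s])
    fix i h assume i: "i \<in> I" and h: "h \<in> Hom C c (X' i)"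
    have "v \<bullet> SuspM C (\<iota>' i \<bullet> h) = v \<bullet> ((v' \<bullet> (\<iota> i \<bullet> u i)) \<bullet> SuspM C h)"
      using SuspM_Comp[OF h \<iota>'(1)[OF i]] \<iota>'(2)[OF i] by simp
    also have "\<dots> = (v \<bullet> (v' \<bullet> (\<iota> i \<bullet> u i))) \<bullet> SuspM C h"
      using Comp_assoc[OF SuspM_in[OF h] Comp_in[OF \<iota>u[OF i] v(2)] v(1)] by simp
    also have "\<dots> = (\<iota> i \<bullet> u i) \<bullet> SuspM C h"
      using Comp_assoc[OF \<iota>u[OF i] v(2) v(1)] v(4) Id_Comp[OF \<iota>u[OF i]] by simp
    also have "\<dots> = \<iota> i \<bullet> (u i \<bullet> SuspM C h)"
      using Comp_assoc[OF SuspM_in[OF h] u(1) \<iota>[OF i]] .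
    finally show "\<exists>h'\<in>Hom C (Susp C c) (X i). v \<bullet> SuspM C (\<iota>' i \<bullet> h) = \<iota> i \<bullet> h'"
      using Comp_in[OF SuspM_in[OF h] u(1)] by blast
  next
    fix f g assume f: "f \<in> Hom C c s'" and g: "g \<in> Hom C c s'"
    then show "v \<bullet> SuspM C (Plus C f g) = Plus C (v \<bullet> SuspM C f) (v \<bullet> SuspM C g)"
      using SuspM_Plus[OF f g] Comp_Plus[OF SuspM_in[OF f] SuspM_in[OF g] v(1)] by simp
  qed (rule Comp_in[OF SuspM_in v(1)])
  then show "\<phi> \<in> finite_sums C I X \<iota> (Susp C c) s"
    using \<phi>'(2) Comp_assoc[OF \<phi> v(2,1)] v(4) Id_Comp[OF \<phi>] by simp
qed

lemma compact_object_Susp_reflect: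
  assumes "compact_object U C (Susp C c)"
  shows "compact_object U C c"
  unfolding compact_object_iff
proof (intro allI impI subsetI)
  fix I X \<iota> s \<phi>
  assume a: "I \<subseteq> U \<and> I \<prec> U \<and> is_coproduct C I X \<iota> s" and \<phi>: "\<phi> \<in> Hom C c s"
  then have s: "is_coproduct C I X \<iota> s" by blast
  note \<iota> = is_coproduct_in[OF s]
  \<comment> \<open>Desuspension of maps from \<open>Susp C c\<close> to \<open>Susp C s\<close>, in
    the form required by \<open>finite_sums_transport\<close>.\<close>
  define \<Phi> where "\<Phi> = the_inv_into (Hom C c s) (SuspM C)"
  have inj: "inj_on (SuspM C) (Hom C c s)" using SuspM_bij by (rule bij_betw_imp_inj_on)
  have \<Phi>: "\<Phi> (SuspM C f) = f" if "f \<in> Hom C c s" for f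
    unfolding \<Phi>_def using the_inv_into_f_f[OF inj that] .
  have "SuspM C \<phi> \<in> finite_sums C I (\<lambda>i. Susp C (X i)) (\<lambda>i. SuspM C (\<iota> i)) (Susp C c) (Susp C s)"
    using assms a is_coproduct_Susp[OF s] SuspM_in[OF \<phi>] unfolding compact_object_iff by blast
  then have "\<Phi> (SuspM C \<phi>) \<in> finite_sums C I X \<iota> c s"
  proof (rule finite_sums_transport[OF is_coproduct_Susp[OF s] s])
    fix f assume "f \<in> Hom C (Susp C c) (Susp C s)"
    then obtain f' where f': "f' \<in> Hom C c s" "f = SuspM C f'" by (rule SuspM_surj)
    then show "\<Phi> f \<in> Hom C c s" by (simp add: \<Phi>)
    fix g assume "g \<in> Hom C (Susp C c) (Susp C s)"
    then obtain g' where g': "g' \<in> Hom C c s" "g = SuspM C g'" by (rule SuspM_surj)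
    then show "\<Phi> (Plus C f g) = Plus C (\<Phi> f) (\<Phi> g)"
      using f' \<Phi>[OF Plus_in[OF f'(1) g'(1)]] SuspM_Plus[OF f'(1) g'(1)] by (simp add: \<Phi>)
  next
    fix i h assume i: "i \<in> I" and "h \<in> Hom C (Susp C c) (Susp C (X i))"
    then obtain h' where h': "h' \<in> Hom C c (X i)" "h = SuspM C h'" by (rule_tac SuspM_surj)
    then show "\<exists>h'\<in>Hom C c (X i). \<Phi> (SuspM C (\<iota> i) \<bullet> h) = \<iota> i \<bullet> h'"
      using \<Phi>[OF Comp_in[OF h'(1) \<iota>[OF i]]] SuspM_Comp[OF h'(1) \<iota>[OF i]] by auto
  qed
  then show "\<phi> \<in> finite_sums C I X \<iota> c s" using \<Phi>[OF \<phi>] by simp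
qed

text \<open>This takes the place of the five lemma. A finite truncation \<open>p\<close> of the
  identity of \<open>s\<close> fixes \<open>\<phi> \<bullet> g\<close>, so the difference of \<phi>
  and \<open>p \<bullet> \<phi>\<close> vanishes on \<open>g\<close> and factors through the compact
  object \<open>Susp C a\<close>. Hence \<phi> is a sum of two finite sums.\<close>

lemma compact_object_third:
  assumes D: "Dist C a b c f g h" and a: "compact_object U C a" and b: "compact_object U C b"
  shows "compact_object U C c"
  unfolding compact_object_iff
proof (intro allI impI subsetI)
  fix I X \<iota> s \<phi>
  assume *: "I \<subseteq> U \<and> I \<prec> U \<and> is_coproduct C I X \<iota> s" and \<phi>: "\<phi> \<in> Hom C c s"
  then have s: "is_coproduct C I X \<iota> s" by blast
  have g: "g \<in> Hom C b c" and h: "h \<in> Hom C c (Susp C a)" using Dist_in[OF D] by auto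
  have "\<phi> \<bullet> g \<in> finite_sums C I X \<iota> b s"
    using b * Comp_in[OF g \<phi>] unfolding compact_object_iff by blast
  then obtain p where p: "p \<in> finite_sums C I X \<iota> s s" "p \<bullet> (\<phi> \<bullet> g) = \<phi> \<bullet> g"
    using finite_sums_eq_sum_components[OF s] by blast
  note p_in = finite_sums_in[OF p(1) s]
  define d where "d = Plus C \<phi> (Neg C c s (p \<bullet> \<phi>))"
  have p\<phi>: "p \<bullet> \<phi> \<in> Hom C c s" using Comp_in[OF \<phi> p_in] .
  have d: "d \<in> Hom C c s" unfolding d_def using Plus_in[OF \<phi> Neg_in[OF p\<phi>]] .
  have "d \<bullet> g = Zero C b s"
    unfolding d_def
    using Plus_Comp[OF g \<phi> Neg_in[OF p\<phi>]] Neg_Comp[OF g p\<phi>] Comp_assoc[OF g \<phi> p_in] p(2)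
      Plus_Neg[OF Comp_in[OF g \<phi>]] by simp
  then obtain l where l: "l \<in> Hom C (Susp C a) s" "l \<bullet> h = d"
    using Dist_extend[OF Dist_rotated[OF D] d] by blast
  have "l \<in> finite_sums C I X \<iota> (Susp C a) s"
    using compact_object_Susp[OF a] * l(1) unfolding compact_object_iff by blast
  then have "d \<in> finite_sums C I X \<iota> c s"
    using finite_sums_Comp[OF s _ h] l(2) by blast
  moreover have "p \<bullet> \<phi> \<in> finite_sums C I X \<iota> c s"
    using finite_sums_Comp[OF s p(1) \<phi>] .
  ultimately have "Plus C d (p \<bullet> \<phi>) \<in> finite_sums C I X \<iota> c s"
    by (rule finite_sums_Plus[OF s])
  then show "\<phi> \<in> finite_sums C I X \<iota> c s"
    unfolding d_def
    using Plus_assoc[OF \<phi> Neg_in[OF p\<phi>] p\<phi>] Neg_Plus[OF p\<phi>] Plus_Zero[OF \<phi>] by simp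
qed

lemma compact_object_zero:
  assumes "is_zero C x"
  shows "compact_object U C x"
  unfolding compact_object_iff
proof (intro allI impI subsetI)
  fix I X \<iota> s \<phi>
  assume "\<phi> \<in> Hom C x s"
  then have "\<phi> = Zero C x s" by (rule is_zero_from[OF assms])
  then show "\<phi> \<in> finite_sums C I X \<iota> x s" using finite_sums.zero by metis
qed

lemma triangulated_subcategoryI:
  assumes "\<And>x. is_zero C x \<Longrightarrow> x \<in> L"
    and "\<And>x y z f g h. \<lbrakk>Dist C x y z f g h; x \<in> L; y \<in> L\<rbrakk> \<Longrightarrow> z \<in> L"
    and "\<And>x y z f g h. \<lbrakk>Dist C x y z f g h; y \<in> L; z \<in> L\<rbrakk> \<Longrightarrow> x \<in> L"
    and "\<And>x y z f g h. \<lbrakk>Dist C x y z f g h; x \<in> L; z \<in> L\<rbrakk> \<Longrightarrow> y \<in> L"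
  shows "triangulated_subcategory C L"
  unfolding triangulated_subcategory_def
proof (intro conjI allI impI)
  show "{x. is_zero C x} \<subseteq> L" using assms(1) by blast
qed (use assms(2-4) in blast)+

text \<open>Rotation moves each vertex to the third place, up to a suspension, which compactness
  passes in both directions.\<close>

lemma triangulated_subcategory_compact: "triangulated_subcategory C {x. compact_object U C x}"
proof (rule triangulated_subcategoryI; unfold mem_Collect_eq)
  fix x y z f g h assume D: "Dist C x y z f g h"
  note D' = Dist_rotated[OF D]
  show "compact_object U C z" if "compact_object U C x" "compact_object U C y"
    using compact_object_third[OF D that] .
  show "compact_object U C x" if "compact_object U C y" "compact_object U C z"
    using compact_object_Susp_reflect[OF compact_object_third[OF D' that]] .
  show "compact_object U C y" if "compact_object U C x" "compact_object U C z"
    using compact_object_Susp_reflect[OF compact_object_third[OF Dist_rotated[OF D'] that(2)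
        compact_object_Susp[OF that(1)]]] .
qed (rule compact_object_zero)

end

section \<open>The tensor product\<close>

context closed_symmetric_monoidal_category
begin

lemma TensM_Comp_Id:
  "\<lbrakk>f \<in> Hom T x x'; f' \<in> Hom T x' x''\<rbrakk>
    \<Longrightarrow> (f' \<bullet> f) \<boxtimes>\<^sub>m Id T w = (f' \<boxtimes>\<^sub>m Id T w) \<bullet> (f \<boxtimes>\<^sub>m Id T w)"
  using TensM_Comp[OF _ _ Id_in Id_in, of f x x' f' x'' w] Comp_Id[OF Id_in, of w] by simp

lemma Id_TensM_Comp:
  "\<lbrakk>f \<in> Hom T x x'; f' \<in> Hom T x' x''\<rbrakk>
    \<Longrightarrow> Id T w \<boxtimes>\<^sub>m (f' \<bullet> f) = (Id T w \<boxtimes>\<^sub>m f') \<bullet> (Id T w \<boxtimes>\<^sub>m f)"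
  using TensM_Comp[OF Id_in Id_in, of f x x' f' x'' w] Comp_Id[OF Id_in, of w] by simp

lemma TensM_iso:
  assumes "is_iso T x x' f" "is_iso T y y' g"
  shows "is_iso T (x \<boxtimes> y) (x' \<boxtimes> y') (f \<boxtimes>\<^sub>m g)"
proof -
  obtain f' where f': "f' \<in> Hom T x' x" "f' \<bullet> f = Id T x" "f \<bullet> f' = Id T x'"
    using assms(1) by (rule is_iso_inverse)
  obtain g' where g': "g' \<in> Hom T y' y" "g' \<bullet> g = Id T y" "g \<bullet> g' = Id T y'"
    using assms(2) by (rule is_iso_inverse)
  note f = is_iso_in[OF assms(1)] and g = is_iso_in[OF assms(2)]
  show ?thesis
    by (rule is_isoI[OF TensM_in[OF f g] TensM_in[OF f'(1) g'(1)]])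
      (use TensM_Comp[OF f f'(1) g g'(1)] TensM_Comp[OF f'(1) f g'(1) g] f' g' in \<open>simp_all add: TensM_Id\<close>)
qed

lemma isomorphic_Tens:
  "\<lbrakk>isomorphic T x x'; isomorphic T y y'\<rbrakk> \<Longrightarrow> isomorphic T (x \<boxtimes> y) (x' \<boxtimes> y')"
  using TensM_iso unfolding isomorphic_def by blast

lemma isomorphic_assoc: "isomorphic T ((x \<boxtimes> y) \<boxtimes> z) (x \<boxtimes> (y \<boxtimes> z))"
  and isomorphic_commute: "isomorphic T (x \<boxtimes> y) (y \<boxtimes> x)"
  and isomorphic_unit: "isomorphic T (Unit T \<boxtimes> x) x"
  using Assoc_iso Braid_iso LUnit_iso unfolding isomorphic_def by blast+

lemma isomorphic_left_commute: "isomorphic T (x \<boxtimes> (y \<boxtimes> z)) (y \<boxtimes> (x \<boxtimes> z))"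
proof -
  have "isomorphic T (x \<boxtimes> (y \<boxtimes> z)) ((x \<boxtimes> y) \<boxtimes> z)"
    by (rule isomorphic_sym[OF isomorphic_assoc])
  also have "isomorphic T \<dots> ((y \<boxtimes> x) \<boxtimes> z)"
    by (rule isomorphic_Tens[OF isomorphic_commute isomorphic_refl])
  also have "isomorphic T \<dots> (y \<boxtimes> (x \<boxtimes> z))"
    by (rule isomorphic_assoc)
  finally show ?thesis .
qed

lemma is_retract_Tens:
  assumes "is_retract T x y"
  shows "is_retract T (w \<boxtimes> x) (w \<boxtimes> y)"
proof -
  obtain i p where "i \<in> Hom T x y" "p \<in> Hom T y x" "p \<bullet> i = Id T x"
    using assms by (auto simp: is_retract_def)
  then show ?thesis
    using Id_TensM_Comp[of i x y p x w] TensM_in[OF Id_in[of w]] TensM_Id[of w x]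
    unfolding is_retract_def by metis
qed

text \<open>A left adjoint preserves coproducts: currying turns maps out of
  \<open>s \<boxtimes> w\<close> into maps from \<open>s\<close> to \<open>IHom T w y\<close>, where
  the universal property of \<open>s\<close> applies.\<close>

lemma is_coproduct_Tens:
  assumes s: "is_coproduct T I X \<iota> s"
  shows "is_coproduct T I (\<lambda>i. X i \<boxtimes> w) (\<lambda>i. \<iota> i \<boxtimes>\<^sub>m Id T w) (s \<boxtimes> w)"
proof (rule is_coproductI)
  note \<iota> = is_coproduct_in[OF s]
  show "\<iota> i \<boxtimes>\<^sub>m Id T w \<in> Hom T (X i \<boxtimes> w) (s \<boxtimes> w)" if "i \<in> I" for i
    using TensM_in[OF \<iota>[OF that] Id_in] .
  have curry: "\<exists>f'. f' \<in> Hom T a (IHom T w y) \<and> Eval T w y \<bullet> (f' \<boxtimes>\<^sub>m Id T w) = f"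
    if "f \<in> Hom T (a \<boxtimes> w) y" for f a y
    using Eval_universal[OF that] by (rule ex1_implies_ex)
  have uncurry: "(Eval T w y \<bullet> (h \<boxtimes>\<^sub>m Id T w)) \<bullet> (\<iota> i \<boxtimes>\<^sub>m Id T w) = Eval T w y \<bullet> ((h \<bullet> \<iota> i) \<boxtimes>\<^sub>m Id T w)"
    if "i \<in> I" "h \<in> Hom T s (IHom T w y)" for h i y
    using Comp_assoc[OF TensM_in[OF \<iota>[OF that(1)] Id_in] TensM_in[OF that(2) Id_in] Eval_in]
      TensM_Comp_Id[OF \<iota>[OF that(1)] that(2), of w] by simp
  fix y
  {
    fix g assume g: "\<forall>i\<in>I. g i \<in> Hom T (X i \<boxtimes> w) y"
    have "\<forall>i\<in>I. \<exists>f'. f' \<in> Hom T (X i) (IHom T w y) \<and> Eval T w y \<bullet> (f' \<boxtimes>\<^sub>m Id T w) = g i"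
      by (rule ballI, rule curry, rule bspec[OF g])
    then obtain g' where "\<forall>i\<in>I. g' i \<in> Hom T (X i) (IHom T w y) \<and> Eval T w y \<bullet> (g' i \<boxtimes>\<^sub>m Id T w) = g i"
      by (rule exE[OF bchoice])
    then have g': "\<And>i. i \<in> I \<Longrightarrow> g' i \<in> Hom T (X i) (IHom T w y)"
      "\<And>i. i \<in> I \<Longrightarrow> Eval T w y \<bullet> (g' i \<boxtimes>\<^sub>m Id T w) = g i"
      by blast+
    obtain h where h: "h \<in> Hom T s (IHom T w y)" "\<And>i. i \<in> I \<Longrightarrow> h \<bullet> \<iota> i = g' i"
      using is_coproduct_map[OF s g'(1)] by blast
    have "(Eval T w y \<bullet> (h \<boxtimes>\<^sub>m Id T w)) \<bullet> (\<iota> i \<boxtimes>\<^sub>m Id T w) = g i" if "i \<in> I" for i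
      using uncurry[OF that h(1)] h(2)[OF that] g'(2)[OF that] by simp
    then show "\<exists>h\<in>Hom T (s \<boxtimes> w) y. \<forall>i\<in>I. h \<bullet> (\<iota> i \<boxtimes>\<^sub>m Id T w) = g i"
      using Comp_in[OF TensM_in[OF h(1) Id_in] Eval_in] by blast
  next
    fix h k assume h: "h \<in> Hom T (s \<boxtimes> w) y" and k: "k \<in> Hom T (s \<boxtimes> w) y"
      and hk: "\<forall>i\<in>I. h \<bullet> (\<iota> i \<boxtimes>\<^sub>m Id T w) = k \<bullet> (\<iota> i \<boxtimes>\<^sub>m Id T w)"
    obtain h' where h': "h' \<in> Hom T s (IHom T w y)" "Eval T w y \<bullet> (h' \<boxtimes>\<^sub>m Id T w) = h"
      using curry[OF h] by blast
    obtain k' where k': "k' \<in> Hom T s (IHom T w y)" "Eval T w y \<bullet> (k' \<boxtimes>\<^sub>m Id T w) = k"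
      using curry[OF k] by blast
    have "h' = k'"
    proof (rule is_coproduct_eq[OF s h'(1) k'(1)])
      fix i assume i: "i \<in> I"
      have "Eval T w y \<bullet> ((h' \<bullet> \<iota> i) \<boxtimes>\<^sub>m Id T w) = h \<bullet> (\<iota> i \<boxtimes>\<^sub>m Id T w)"
        using uncurry[OF i h'(1)] h'(2) by simp
      moreover have "Eval T w y \<bullet> ((k' \<bullet> \<iota> i) \<boxtimes>\<^sub>m Id T w) = h \<bullet> (\<iota> i \<boxtimes>\<^sub>m Id T w)"
        using uncurry[OF i k'(1)] k'(2) hk i by simp
      moreover have "h \<bullet> (\<iota> i \<boxtimes>\<^sub>m Id T w) \<in> Hom T (X i \<boxtimes> w) y"
        using Comp_in[OF TensM_in[OF \<iota>[OF i] Id_in] h] .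
      ultimately show "h' \<bullet> \<iota> i = k' \<bullet> \<iota> i"
        using Eval_universal[of "h \<bullet> (\<iota> i \<boxtimes>\<^sub>m Id T w)" "X i" w y] Comp_in[OF \<iota>[OF i] h'(1)] Comp_in[OF \<iota>[OF i] k'(1)]
        by blast
    qed
    then show "h = k" using h'(2) k'(2) by simp
  }
qed

end

section \<open>Annihilators, and tensoring with rigid objects\<close>

context tt_category
begin

lemma is_zero_Tens_left:
  assumes "is_zero T x"
  shows "is_zero T (x \<boxtimes> w)"
proof -
  have "Zero T x x \<boxtimes>\<^sub>m Id T w = Zero T (x \<boxtimes> w) (x \<boxtimes> w)"
    using TensM_Plus[OF Zero_in Zero_in, of x x w] Zero_Plus[OF Zero_in, of x x]
    by (intro Plus_self_eq_Zero TensM_in Zero_in Id_in) simp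
  then show ?thesis
    using assms TensM_Id[of x w] by (simp add: is_zero_iff_Id)
qed

lemma is_zero_Tens_right: "is_zero T x \<Longrightarrow> is_zero T (w \<boxtimes> x)"
  using is_zero_Tens_left is_zero_isomorphic[OF isomorphic_commute] by blast

text \<open>\<open>Tens_exact\<close> and \<open>is_coproduct_Tens\<close> keep the fixed factor on
  the right, so closure is shown for \<open>t \<boxtimes> f\<close> and carried over by the
  braiding.\<close>

lemma localizing_ideal_annihilator: "localizing_ideal U T {t. is_zero T (f \<boxtimes> t)}"
proof -
  have c: "is_zero T (f \<boxtimes> t) \<longleftrightarrow> is_zero T (t \<boxtimes> f)" for t
    by (rule is_zero_isomorphic[OF isomorphic_commute])
  have "triangulated_subcategory T {t. is_zero T (t \<boxtimes> f)}"
  proof (rule triangulated_subcategoryI; unfold mem_Collect_eq)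
    fix x y z p q r assume "Dist T x y z p q r"
    note D = Tens_exact[OF this, of f]
    show "is_zero T (z \<boxtimes> f)" if "is_zero T (x \<boxtimes> f)" "is_zero T (y \<boxtimes> f)"
      using Dist_zero_zero_third[OF D that] .
    show "is_zero T (x \<boxtimes> f)" if "is_zero T (y \<boxtimes> f)" "is_zero T (z \<boxtimes> f)"
      using Dist_zero_zero_first[OF D that] .
    show "is_zero T (y \<boxtimes> f)" if "is_zero T (x \<boxtimes> f)" "is_zero T (z \<boxtimes> f)"
      using Dist_zero_zero_second[OF D that] .
  qed (rule is_zero_Tens_left)
  moreover have "is_zero T (s \<boxtimes> f)"
    if "is_coproduct T I X \<iota> s" "\<forall>i\<in>I. is_zero T (X i \<boxtimes> f)" for I :: "'u set" and X \<iota> s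
    using is_coproduct_zero[OF is_coproduct_Tens[OF that(1)]] that(2) by blast
  ultimately have "localizing U T {t. is_zero T (t \<boxtimes> f)}"
    unfolding localizing_def by blast
  moreover have "is_zero T (f \<boxtimes> (t \<boxtimes> x))" if "is_zero T (f \<boxtimes> x)" for t x
    using is_zero_Tens_right[OF that] is_zero_isomorphic[OF isomorphic_left_commute] by blast
  ultimately show ?thesis
    unfolding localizing_ideal_def c by (simp add: c)
qed

lemma localizing_annihilator: "localizing U T {t. is_zero T (f \<boxtimes> t)}"
  using localizing_ideal_annihilator unfolding localizing_ideal_def by blast

text \<open>If \<open>\<epsilon>\<close> is the evaluation of a dual \<open>d\<close> of
  \<open>x\<close>, this is the component at \<open>z\<close> of the counit of the adjunction
  between \<open>- \<boxtimes> x\<close> and its right adjoint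
  \<open>- \<boxtimes> d\<close>.\<close>

definition Counit :: "'m \<Rightarrow> 'o \<Rightarrow> 'o \<Rightarrow> 'o \<Rightarrow> 'm" where
  "Counit \<epsilon> d x z = RUnit T z \<bullet> ((Id T z \<boxtimes>\<^sub>m \<epsilon>) \<bullet> Assoc T z d x)"

lemma Counit_in:
  assumes \<epsilon>: "\<epsilon> \<in> Hom T (d \<boxtimes> x) (Unit T)"
  shows "Counit \<epsilon> d x z \<in> Hom T ((z \<boxtimes> d) \<boxtimes> x) z"
  unfolding Counit_def
  by (rule Comp_in[OF Comp_in[OF is_iso_in[OF Assoc_iso] TensM_in[OF Id_in \<epsilon>]] is_iso_in[OF RUnit_iso]])

lemma Counit_natural:
  assumes \<epsilon>: "\<epsilon> \<in> Hom T (d \<boxtimes> x) (Unit T)" and f: "f \<in> Hom T z z'"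
  shows "Counit \<epsilon> d x z' \<bullet> ((f \<boxtimes>\<^sub>m Id T d) \<boxtimes>\<^sub>m Id T x) = f \<bullet> Counit \<epsilon> d x z"
proof -
  note A = is_iso_in[OF Assoc_iso] and R = is_iso_in[OF RUnit_iso]
  note e = TensM_in[OF Id_in \<epsilon>]
  note fd = TensM_in[OF TensM_in[OF f Id_in[of d]] Id_in[of x]]
  have f1: "f \<boxtimes>\<^sub>m Id T (d \<boxtimes> x) \<in> Hom T (z \<boxtimes> (d \<boxtimes> x)) (z' \<boxtimes> (d \<boxtimes> x))"
    by (rule TensM_in[OF f Id_in])
  have f2: "f \<boxtimes>\<^sub>m Id T (Unit T) \<in> Hom T (z \<boxtimes> Unit T) (z' \<boxtimes> Unit T)"
    by (rule TensM_in[OF f Id_in])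
  have sw: "(Id T z' \<boxtimes>\<^sub>m \<epsilon>) \<bullet> (f \<boxtimes>\<^sub>m Id T (d \<boxtimes> x)) = (f \<boxtimes>\<^sub>m Id T (Unit T)) \<bullet> (Id T z \<boxtimes>\<^sub>m \<epsilon>)"
    using TensM_Comp[OF f Id_in Id_in \<epsilon>] TensM_Comp[OF Id_in f \<epsilon> Id_in]
      Id_Comp[OF f] Comp_Id[OF f] Id_Comp[OF \<epsilon>] Comp_Id[OF \<epsilon>] by simp
  have "Counit \<epsilon> d x z' \<bullet> ((f \<boxtimes>\<^sub>m Id T d) \<boxtimes>\<^sub>m Id T x)
    = RUnit T z' \<bullet> ((Id T z' \<boxtimes>\<^sub>m \<epsilon>) \<bullet> (Assoc T z' d x \<bullet> ((f \<boxtimes>\<^sub>m Id T d) \<boxtimes>\<^sub>m Id T x)))"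
    unfolding Counit_def using Comp_assoc[OF fd Comp_in[OF A e] R] Comp_assoc[OF fd A e] by simp
  also have "Assoc T z' d x \<bullet> ((f \<boxtimes>\<^sub>m Id T d) \<boxtimes>\<^sub>m Id T x) = (f \<boxtimes>\<^sub>m Id T (d \<boxtimes> x)) \<bullet> Assoc T z d x"
    using Assoc_natural[OF f Id_in Id_in] by (simp add: TensM_Id)
  also have "(Id T z' \<boxtimes>\<^sub>m \<epsilon>) \<bullet> ((f \<boxtimes>\<^sub>m Id T (d \<boxtimes> x)) \<bullet> Assoc T z d x)
    = (f \<boxtimes>\<^sub>m Id T (Unit T)) \<bullet> ((Id T z \<boxtimes>\<^sub>m \<epsilon>) \<bullet> Assoc T z d x)"
    using Comp_assoc[OF A f1 e] sw Comp_assoc[OF A e f2] by simp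
  also have "RUnit T z' \<bullet> \<dots> = f \<bullet> Counit \<epsilon> d x z"
    unfolding Counit_def using Comp_assoc[OF Comp_in[OF A e] f2 R] RUnit_natural[OF f]
      Comp_assoc[OF Comp_in[OF A e] R f] by simp
  finally show ?thesis .
qed

text \<open>The last clause is the triangle identity with \<open>RUnit T x\<close> cancelled: the
  composite becomes the isomorphism \<open>LUnit T x\<close> once \<open>RUnit T x\<close> is
  applied. In this form it can be tensored with a further object.\<close>

lemma rigid_objectE:
  assumes "rigid_object T x"
  obtains d \<eta> \<epsilon> where "\<eta> \<in> Hom T (Unit T) (x \<boxtimes> d)" "\<epsilon> \<in> Hom T (d \<boxtimes> x) (Unit T)"
    "Counit \<epsilon> d x x \<bullet> (\<eta> \<boxtimes>\<^sub>m Id T x) = LUnit T x"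
    "is_iso T (Unit T \<boxtimes> x) (x \<boxtimes> Unit T) ((Id T x \<boxtimes>\<^sub>m \<epsilon>) \<bullet> (Assoc T x d x \<bullet> (\<eta> \<boxtimes>\<^sub>m Id T x)))"
proof -
  obtain d \<eta> \<epsilon> where \<eta>: "\<eta> \<in> Hom T (Unit T) (x \<boxtimes> d)" and \<epsilon>: "\<epsilon> \<in> Hom T (d \<boxtimes> x) (Unit T)"
    and eq: "RUnit T x \<bullet> (Id T x \<boxtimes>\<^sub>m \<epsilon>) \<bullet> Assoc T x d x \<bullet> (\<eta> \<boxtimes>\<^sub>m Id T x) = LUnit T x"
    using assms unfolding rigid_object_def by blast
  note A = is_iso_in[OF Assoc_iso] and R = is_iso_in[OF RUnit_iso]
  note e = TensM_in[OF Id_in \<epsilon>] and n = TensM_in[OF \<eta> Id_in]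
  have "is_iso T (Unit T \<boxtimes> x) (x \<boxtimes> Unit T) ((Id T x \<boxtimes>\<^sub>m \<epsilon>) \<bullet> (Assoc T x d x \<bullet> (\<eta> \<boxtimes>\<^sub>m Id T x)))"
    by (rule is_iso_cancel[OF RUnit_iso Comp_in[OF Comp_in[OF n A] e]]) (simp add: eq LUnit_iso)
  moreover have "Counit \<epsilon> d x x \<bullet> (\<eta> \<boxtimes>\<^sub>m Id T x) = LUnit T x"
    unfolding Counit_def
    using eq Comp_assoc[OF n Comp_in[OF A e] R] Comp_assoc[OF n A e] by simp
  ultimately show ?thesis using that \<eta> \<epsilon> by blast
qed

text \<open>The triangle identity splits the map induced by \<open>\<eta>\<close>; a left inverse is
  the counit followed by the inverse of \<open>LUnit T x\<close>.\<close>

lemma rigid_object_retract: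
  assumes "rigid_object T x"
  obtains d where "is_retract T (Unit T \<boxtimes> x) ((x \<boxtimes> d) \<boxtimes> x)"
proof -
  obtain d \<eta> \<epsilon> where \<eta>: "\<eta> \<in> Hom T (Unit T) (x \<boxtimes> d)" and \<epsilon>: "\<epsilon> \<in> Hom T (d \<boxtimes> x) (Unit T)"
    and eq: "Counit \<epsilon> d x x \<bullet> (\<eta> \<boxtimes>\<^sub>m Id T x) = LUnit T x"
    using assms by (rule rigid_objectE)
  obtain l where l: "l \<in> Hom T x (Unit T \<boxtimes> x)" "l \<bullet> LUnit T x = Id T (Unit T \<boxtimes> x)"
    using LUnit_iso by (rule is_iso_inverse)
  have "(l \<bullet> Counit \<epsilon> d x x) \<bullet> (\<eta> \<boxtimes>\<^sub>m Id T x) = Id T (Unit T \<boxtimes> x)"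
    using Comp_assoc[OF TensM_in[OF \<eta> Id_in] Counit_in[OF \<epsilon>] l(1)] eq l(2) by simp
  then show ?thesis
    using that Comp_in[OF Counit_in[OF \<epsilon>] l(1)] TensM_in[OF \<eta> Id_in] unfolding is_retract_def by blast
qed

text \<open>Up to isomorphism \<open>x\<close> is a retract of
  \<open>d \<boxtimes> (x \<boxtimes> x)\<close>, which \<open>k\<close> kills. This is the
  radicality of annihilators among the rigid objects.\<close>

lemma is_zero_Tens_rigid_square:
  assumes "rigid_object T x" "is_zero T (k \<boxtimes> (x \<boxtimes> x))"
  shows "is_zero T (k \<boxtimes> x)"
proof -
  obtain d where d: "is_retract T (Unit T \<boxtimes> x) ((x \<boxtimes> d) \<boxtimes> x)"
    using assms(1) by (rule rigid_object_retract)
  have "isomorphic T ((x \<boxtimes> d) \<boxtimes> x) ((d \<boxtimes> x) \<boxtimes> x)"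
    by (rule isomorphic_Tens[OF isomorphic_commute isomorphic_refl])
  also have "isomorphic T \<dots> (d \<boxtimes> (x \<boxtimes> x))"
    by (rule isomorphic_assoc)
  finally have "isomorphic T (k \<boxtimes> ((x \<boxtimes> d) \<boxtimes> x)) (k \<boxtimes> (d \<boxtimes> (x \<boxtimes> x)))"
    by (rule isomorphic_Tens[OF isomorphic_refl])
  also have "isomorphic T \<dots> (d \<boxtimes> (k \<boxtimes> (x \<boxtimes> x)))"
    by (rule isomorphic_left_commute)
  finally have "is_zero T (k \<boxtimes> ((x \<boxtimes> d) \<boxtimes> x))"
    using is_zero_isomorphic is_zero_Tens_right[OF assms(2)] by blast
  then have "is_zero T (k \<boxtimes> (Unit T \<boxtimes> x))"
    by (rule is_zero_retract[OF is_retract_Tens[OF d]])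
  then show ?thesis
    using is_zero_isomorphic[OF isomorphic_Tens[OF isomorphic_refl isomorphic_unit]] by blast
qed

text \<open>\<open>- \<boxtimes> x\<close> is left adjoint to \<open>- \<boxtimes> d\<close>, which preserves coproducts.  Of the triangle identity only
  the consequence that the composite below is an isomorphism is needed.\<close>

lemma compact_object_Tens_rigid:
  assumes y: "compact_object U T y" and x: "rigid_object T x"
  shows "compact_object U T (y \<boxtimes> x)"
proof -
  obtain d \<eta> \<epsilon> where \<eta>: "\<eta> \<in> Hom T (Unit T) (x \<boxtimes> d)" and \<epsilon>: "\<epsilon> \<in> Hom T (d \<boxtimes> x) (Unit T)"
    and m: "is_iso T (Unit T \<boxtimes> x) (x \<boxtimes> Unit T) ((Id T x \<boxtimes>\<^sub>m \<epsilon>) \<bullet> (Assoc T x d x \<bullet> (\<eta> \<boxtimes>\<^sub>m Id T x)))"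
    using x by (rule rigid_objectE)
  note A = is_iso_in[OF Assoc_iso] and R = is_iso_in[OF RUnit_iso]
  obtain r where r: "r \<in> Hom T y (y \<boxtimes> Unit T)" "r \<bullet> RUnit T y = Id T (y \<boxtimes> Unit T)" "RUnit T y \<bullet> r = Id T y"
    using RUnit_iso by (rule is_iso_inverse)
  have r_iso: "is_iso T y (y \<boxtimes> Unit T) r" by (rule is_isoI[OF r(1) R r(3,2)])
  obtain A' where A': "A' \<in> Hom T (y \<boxtimes> (x \<boxtimes> d)) ((y \<boxtimes> x) \<boxtimes> d)" "Assoc T y x d \<bullet> A' = Id T (y \<boxtimes> (x \<boxtimes> d))"
    using Assoc_iso by (rule is_iso_inverse)
  have \<eta>r: "(Id T y \<boxtimes>\<^sub>m \<eta>) \<bullet> r \<in> Hom T y (y \<boxtimes> (x \<boxtimes> d))"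
    by (rule Comp_in[OF r(1) TensM_in[OF Id_in \<eta>]])
  \<comment> \<open>The unit of the adjunction at \<open>y\<close>.\<close>
  define \<alpha> where "\<alpha> = A' \<bullet> ((Id T y \<boxtimes>\<^sub>m \<eta>) \<bullet> r)"
  have \<alpha>: "\<alpha> \<in> Hom T y ((y \<boxtimes> x) \<boxtimes> d)"
    unfolding \<alpha>_def by (rule Comp_in[OF \<eta>r A'(1)])
  have A\<alpha>: "Assoc T y x d \<bullet> \<alpha> = (Id T y \<boxtimes>\<^sub>m \<eta>) \<bullet> r"
    unfolding \<alpha>_def using Comp_assoc[OF \<eta>r A'(1) A] A'(2) Id_Comp[OF \<eta>r] by simp
  note \<alpha>x = TensM_in[OF \<alpha> Id_in[of x]]
  define \<theta>0 where "\<theta>0 = (Id T (y \<boxtimes> x) \<boxtimes>\<^sub>m \<epsilon>) \<bullet> (Assoc T (y \<boxtimes> x) d x \<bullet> (\<alpha> \<boxtimes>\<^sub>m Id T x))"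
  have \<theta>0: "\<theta>0 \<in> Hom T (y \<boxtimes> x) ((y \<boxtimes> x) \<boxtimes> Unit T)"
    unfolding \<theta>0_def by (rule Comp_in[OF Comp_in[OF \<alpha>x A] TensM_in[OF Id_in \<epsilon>]])
  \<comment> \<open>Naturality moves \<open>\<epsilon>\<close> and \<open>\<eta>\<close> past the
    associators and the pentagon reassociates, until the composite is \<open>Id T y\<close> tensored
    with the isomorphism in \<open>m\<close>, preceded by isomorphisms.\<close>
  have "Assoc T y x (Unit T) \<bullet> \<theta>0 =
    (Id T y \<boxtimes>\<^sub>m ((Id T x \<boxtimes>\<^sub>m \<epsilon>) \<bullet> (Assoc T x d x \<bullet> (\<eta> \<boxtimes>\<^sub>m Id T x)))) \<bullet>
    (Assoc T y (Unit T) x \<bullet> (r \<boxtimes>\<^sub>m Id T x))"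
  proof -
    have e2: "Id T y \<boxtimes>\<^sub>m (Id T x \<boxtimes>\<^sub>m \<epsilon>) \<in> Hom T (y \<boxtimes> (x \<boxtimes> (d \<boxtimes> x))) (y \<boxtimes> (x \<boxtimes> Unit T))"
      by (intro TensM_in Id_in \<epsilon>)
    have e1: "Id T (y \<boxtimes> x) \<boxtimes>\<^sub>m \<epsilon> \<in> Hom T ((y \<boxtimes> x) \<boxtimes> (d \<boxtimes> x)) ((y \<boxtimes> x) \<boxtimes> Unit T)"
      by (intro TensM_in Id_in \<epsilon>)
    have yA: "Id T y \<boxtimes>\<^sub>m Assoc T x d x \<in> Hom T (y \<boxtimes> ((x \<boxtimes> d) \<boxtimes> x)) (y \<boxtimes> (x \<boxtimes> (d \<boxtimes> x)))"
      by (intro TensM_in Id_in A)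
    have Ax: "Assoc T y x d \<boxtimes>\<^sub>m Id T x \<in> Hom T (((y \<boxtimes> x) \<boxtimes> d) \<boxtimes> x) ((y \<boxtimes> (x \<boxtimes> d)) \<boxtimes> x)"
      by (intro TensM_in Id_in A)
    have rx: "r \<boxtimes>\<^sub>m Id T x \<in> Hom T (y \<boxtimes> x) ((y \<boxtimes> Unit T) \<boxtimes> x)"
      by (intro TensM_in Id_in r)
    have y\<eta>: "(Id T y \<boxtimes>\<^sub>m \<eta>) \<boxtimes>\<^sub>m Id T x \<in> Hom T ((y \<boxtimes> Unit T) \<boxtimes> x) ((y \<boxtimes> (x \<boxtimes> d)) \<boxtimes> x)"
      by (intro TensM_in Id_in \<eta>)
    have \<eta>x: "\<eta> \<boxtimes>\<^sub>m Id T x \<in> Hom T (Unit T \<boxtimes> x) ((x \<boxtimes> d) \<boxtimes> x)"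
      by (intro TensM_in Id_in \<eta>)
    have y\<eta>x: "Id T y \<boxtimes>\<^sub>m (\<eta> \<boxtimes>\<^sub>m Id T x) \<in> Hom T (y \<boxtimes> (Unit T \<boxtimes> x)) (y \<boxtimes> ((x \<boxtimes> d) \<boxtimes> x))"
      by (intro TensM_in Id_in \<eta>)
    have "Assoc T y x (Unit T) \<bullet> \<theta>0 =
      (Assoc T y x (Unit T) \<bullet> (Id T (y \<boxtimes> x) \<boxtimes>\<^sub>m \<epsilon>)) \<bullet> (Assoc T (y \<boxtimes> x) d x \<bullet> (\<alpha> \<boxtimes>\<^sub>m Id T x))"
      unfolding \<theta>0_def using Comp_assoc[OF Comp_in[OF \<alpha>x A] e1 A] by simp
    also have "Assoc T y x (Unit T) \<bullet> (Id T (y \<boxtimes> x) \<boxtimes>\<^sub>m \<epsilon>) =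
      (Id T y \<boxtimes>\<^sub>m (Id T x \<boxtimes>\<^sub>m \<epsilon>)) \<bullet> Assoc T y x (d \<boxtimes> x)"
      using Assoc_natural[OF Id_in Id_in \<epsilon>, of y x] by (simp add: TensM_Id)
    also have "((Id T y \<boxtimes>\<^sub>m (Id T x \<boxtimes>\<^sub>m \<epsilon>)) \<bullet> Assoc T y x (d \<boxtimes> x)) \<bullet> (Assoc T (y \<boxtimes> x) d x \<bullet> (\<alpha> \<boxtimes>\<^sub>m Id T x))
      = (Id T y \<boxtimes>\<^sub>m (Id T x \<boxtimes>\<^sub>m \<epsilon>)) \<bullet> ((Assoc T y x (d \<boxtimes> x) \<bullet> Assoc T (y \<boxtimes> x) d x) \<bullet> (\<alpha> \<boxtimes>\<^sub>m Id T x))"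
      using Comp_assoc[OF Comp_in[OF \<alpha>x A] A e2] Comp_assoc[OF \<alpha>x A A] by simp
    also have "(Assoc T y x (d \<boxtimes> x) \<bullet> Assoc T (y \<boxtimes> x) d x) \<bullet> (\<alpha> \<boxtimes>\<^sub>m Id T x)
      = (Id T y \<boxtimes>\<^sub>m Assoc T x d x) \<bullet> (Assoc T y (x \<boxtimes> d) x \<bullet> ((Assoc T y x d \<boxtimes>\<^sub>m Id T x) \<bullet> (\<alpha> \<boxtimes>\<^sub>m Id T x)))"
      using pentagon[of y x d x] Comp_assoc[OF \<alpha>x Comp_in[OF Ax A] yA] Comp_assoc[OF \<alpha>x Ax A] by simp
    also have "(Assoc T y x d \<boxtimes>\<^sub>m Id T x) \<bullet> (\<alpha> \<boxtimes>\<^sub>m Id T x) = ((Id T y \<boxtimes>\<^sub>m \<eta>) \<boxtimes>\<^sub>m Id T x) \<bullet> (r \<boxtimes>\<^sub>m Id T x)"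
      using TensM_Comp_Id[OF \<alpha> A, of x] A\<alpha> TensM_Comp_Id[OF r(1) TensM_in[OF Id_in \<eta>], of x] by simp
    also have "Assoc T y (x \<boxtimes> d) x \<bullet> (((Id T y \<boxtimes>\<^sub>m \<eta>) \<boxtimes>\<^sub>m Id T x) \<bullet> (r \<boxtimes>\<^sub>m Id T x))
      = (Id T y \<boxtimes>\<^sub>m (\<eta> \<boxtimes>\<^sub>m Id T x)) \<bullet> (Assoc T y (Unit T) x \<bullet> (r \<boxtimes>\<^sub>m Id T x))"
      using Comp_assoc[OF rx y\<eta> A] Assoc_natural[OF Id_in \<eta> Id_in, of y x] Comp_assoc[OF rx A y\<eta>x] by simp
    also have "(Id T y \<boxtimes>\<^sub>m (Id T x \<boxtimes>\<^sub>m \<epsilon>)) \<bullet> ((Id T y \<boxtimes>\<^sub>m Assoc T x d x) \<bullet>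
        ((Id T y \<boxtimes>\<^sub>m (\<eta> \<boxtimes>\<^sub>m Id T x)) \<bullet> (Assoc T y (Unit T) x \<bullet> (r \<boxtimes>\<^sub>m Id T x))))
      = ((Id T y \<boxtimes>\<^sub>m (Id T x \<boxtimes>\<^sub>m \<epsilon>)) \<bullet> ((Id T y \<boxtimes>\<^sub>m Assoc T x d x) \<bullet> (Id T y \<boxtimes>\<^sub>m (\<eta> \<boxtimes>\<^sub>m Id T x)))) \<bullet>
        (Assoc T y (Unit T) x \<bullet> (r \<boxtimes>\<^sub>m Id T x))"
      using Comp_assoc[OF Comp_in[OF rx A] Comp_in[OF y\<eta>x yA] e2] Comp_assoc[OF Comp_in[OF rx A] y\<eta>x yA] by simp
    also have "(Id T y \<boxtimes>\<^sub>m (Id T x \<boxtimes>\<^sub>m \<epsilon>)) \<bullet> ((Id T y \<boxtimes>\<^sub>m Assoc T x d x) \<bullet> (Id T y \<boxtimes>\<^sub>m (\<eta> \<boxtimes>\<^sub>m Id T x)))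
      = Id T y \<boxtimes>\<^sub>m ((Id T x \<boxtimes>\<^sub>m \<epsilon>) \<bullet> (Assoc T x d x \<bullet> (\<eta> \<boxtimes>\<^sub>m Id T x)))"
      using Id_TensM_Comp[OF \<eta>x A, of y] Id_TensM_Comp[OF Comp_in[OF \<eta>x A] TensM_in[OF Id_in \<epsilon>], of y] by simp
    finally show ?thesis .
  qed
  moreover have "is_iso T (y \<boxtimes> x) (y \<boxtimes> (x \<boxtimes> Unit T)) \<dots>"
    by (rule is_iso_Comp[OF is_iso_Comp[OF TensM_iso[OF r_iso is_iso_Id] Assoc_iso] TensM_iso[OF is_iso_Id m]])
  ultimately have "is_iso T (y \<boxtimes> x) ((y \<boxtimes> x) \<boxtimes> Unit T) \<theta>0"
    using is_iso_cancel[OF Assoc_iso \<theta>0] by simp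
  then have "is_iso T (y \<boxtimes> x) (y \<boxtimes> x) (RUnit T (y \<boxtimes> x) \<bullet> \<theta>0)"
    by (rule is_iso_Comp[OF _ RUnit_iso])
  moreover have "RUnit T (y \<boxtimes> x) \<bullet> \<theta>0 = Counit \<epsilon> d x (y \<boxtimes> x) \<bullet> (\<alpha> \<boxtimes>\<^sub>m Id T x)"
    unfolding \<theta>0_def Counit_def
    using Comp_assoc[OF \<alpha>x Comp_in[OF A TensM_in[OF Id_in \<epsilon>]] R]
      Comp_assoc[OF \<alpha>x A TensM_in[OF Id_in \<epsilon>]] by simp
  ultimately have \<theta>: "is_iso T (y \<boxtimes> x) (y \<boxtimes> x) (Counit \<epsilon> d x (y \<boxtimes> x) \<bullet> (\<alpha> \<boxtimes>\<^sub>m Id T x))"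
    by simp
  note \<theta>_in = is_iso_in[OF \<theta>]
  obtain \<theta>' where \<theta>': "\<theta>' \<in> Hom T (y \<boxtimes> x) (y \<boxtimes> x)"
    "(Counit \<epsilon> d x (y \<boxtimes> x) \<bullet> (\<alpha> \<boxtimes>\<^sub>m Id T x)) \<bullet> \<theta>' = Id T (y \<boxtimes> x)"
    using \<theta> by (rule is_iso_inverse)
  show ?thesis
    unfolding compact_object_iff
  proof (intro allI impI subsetI)
    fix I X \<iota> s \<phi>
    assume a: "I \<subseteq> U \<and> I \<prec> U \<and> is_coproduct T I X \<iota> s" and \<phi>: "\<phi> \<in> Hom T (y \<boxtimes> x) s"
    then have s: "is_coproduct T I X \<iota> s" by blast
    note \<iota> = is_coproduct_in[OF s] and sd = is_coproduct_Tens[OF s, of d]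
    note \<phi>d = TensM_in[OF \<phi> Id_in[of d]]
    note cu = Counit_in[OF \<epsilon>]
    \<comment> \<open>The transpose of \<phi> maps the compact object \<open>y\<close> into a
      coproduct, so it is a finite sum; naturality of the counit keeps it one when it is transposed
      back.\<close>
    have "(\<phi> \<boxtimes>\<^sub>m Id T d) \<bullet> \<alpha> \<in> finite_sums T I (\<lambda>i. X i \<boxtimes> d) (\<lambda>i. \<iota> i \<boxtimes>\<^sub>m Id T d) y (s \<boxtimes> d)"
      using y a sd Comp_in[OF \<alpha> \<phi>d] unfolding compact_object_iff by blast
    then have "Counit \<epsilon> d x s \<bullet> (((\<phi> \<boxtimes>\<^sub>m Id T d) \<bullet> \<alpha>) \<boxtimes>\<^sub>m Id T x) \<in> finite_sums T I X \<iota> (y \<boxtimes> x) s"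
    proof (rule finite_sums_transport[OF sd s])
      fix i h assume i: "i \<in> I" and h: "h \<in> Hom T y (X i \<boxtimes> d)"
      note hx = TensM_in[OF h Id_in[of x]] and \<iota>d = TensM_in[OF \<iota>[OF i] Id_in[of d]]
      note \<iota>dx = TensM_in[OF \<iota>d Id_in[of x]]
      have "Counit \<epsilon> d x s \<bullet> (((\<iota> i \<boxtimes>\<^sub>m Id T d) \<bullet> h) \<boxtimes>\<^sub>m Id T x)
        = (Counit \<epsilon> d x s \<bullet> ((\<iota> i \<boxtimes>\<^sub>m Id T d) \<boxtimes>\<^sub>m Id T x)) \<bullet> (h \<boxtimes>\<^sub>m Id T x)"
        using TensM_Comp_Id[OF h \<iota>d, of x] Comp_assoc[OF hx \<iota>dx cu] by simp
      also have "\<dots> = \<iota> i \<bullet> (Counit \<epsilon> d x (X i) \<bullet> (h \<boxtimes>\<^sub>m Id T x))"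
        using Counit_natural[OF \<epsilon> \<iota>[OF i]] Comp_assoc[OF hx cu \<iota>[OF i]] by simp
      finally show "\<exists>h'\<in>Hom T (y \<boxtimes> x) (X i).
          Counit \<epsilon> d x s \<bullet> (((\<iota> i \<boxtimes>\<^sub>m Id T d) \<bullet> h) \<boxtimes>\<^sub>m Id T x) = \<iota> i \<bullet> h'"
        using Comp_in[OF hx cu] by blast
    next
      fix f g assume f: "f \<in> Hom T y (s \<boxtimes> d)" and g: "g \<in> Hom T y (s \<boxtimes> d)"
      show "Counit \<epsilon> d x s \<bullet> (Plus T f g \<boxtimes>\<^sub>m Id T x)
        = Plus T (Counit \<epsilon> d x s \<bullet> (f \<boxtimes>\<^sub>m Id T x)) (Counit \<epsilon> d x s \<bullet> (g \<boxtimes>\<^sub>m Id T x))"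
        using TensM_Plus[OF f g, of x] Comp_Plus[OF TensM_in[OF f Id_in] TensM_in[OF g Id_in] cu] by simp
    qed (rule Comp_in[OF TensM_in[OF _ Id_in] cu])
    \<comment> \<open>Transposing forth and back returns \<phi> composed with the automorphism in
      \<open>\<theta>\<close>; its inverse \<open>\<theta>'\<close> then recovers \<phi>.\<close>
    moreover have "Counit \<epsilon> d x s \<bullet> (((\<phi> \<boxtimes>\<^sub>m Id T d) \<bullet> \<alpha>) \<boxtimes>\<^sub>m Id T x)
      = \<phi> \<bullet> (Counit \<epsilon> d x (y \<boxtimes> x) \<bullet> (\<alpha> \<boxtimes>\<^sub>m Id T x))"
      using TensM_Comp_Id[OF \<alpha> \<phi>d, of x] Comp_assoc[OF \<alpha>x TensM_in[OF \<phi>d Id_in[of x]] cu]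
        Counit_natural[OF \<epsilon> \<phi>] Comp_assoc[OF \<alpha>x cu \<phi>] by simp
    ultimately have "(\<phi> \<bullet> (Counit \<epsilon> d x (y \<boxtimes> x) \<bullet> (\<alpha> \<boxtimes>\<^sub>m Id T x))) \<bullet> \<theta>' \<in> finite_sums T I X \<iota> (y \<boxtimes> x) s"
      using finite_sums_Comp[OF s _ \<theta>'(1)] by simp
    then show "\<phi> \<in> finite_sums T I X \<iota> (y \<boxtimes> x) s"
      using Comp_assoc[OF \<theta>'(1) \<theta>_in \<phi>] \<theta>'(2) Comp_Id[OF \<phi>] by simp
  qed
qed

end

section \<open>Ideals and primes\<close>

context tt_category
begin

lemma is_zero_assoc: "is_zero T ((a \<boxtimes> b) \<boxtimes> c) \<longleftrightarrow> is_zero T (a \<boxtimes> (b \<boxtimes> c))"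
  and is_zero_commute: "is_zero T (a \<boxtimes> b) \<longleftrightarrow> is_zero T (b \<boxtimes> a)"
  and is_zero_left_commute: "is_zero T (a \<boxtimes> (b \<boxtimes> c)) \<longleftrightarrow> is_zero T (b \<boxtimes> (a \<boxtimes> c))"
  and is_zero_unit: "is_zero T (Unit T \<boxtimes> a) \<longleftrightarrow> is_zero T a"
  using is_zero_isomorphic isomorphic_assoc isomorphic_commute isomorphic_left_commute isomorphic_unit
  by blast+

lemma localizing_ideal_zeros: "localizing_ideal U T {x. is_zero T x}"
  using localizing_ideal_annihilator[of U "Unit T"] by (simp add: is_zero_unit)

lemma localizing_ideal_triangulated: "localizing_ideal U T L \<Longrightarrow> triangulated_subcategory T L"
  unfolding localizing_ideal_def localizing_def by blast

lemma localizing_ideal_coproduct: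
  fixes X :: "'u \<Rightarrow> 'o"
  shows "\<lbrakk>localizing_ideal U T L; I \<subseteq> U; I \<prec> U; is_coproduct T I X \<iota> s; \<forall>i\<in>I. X i \<in> L\<rbrakk> \<Longrightarrow> s \<in> L"
  unfolding localizing_ideal_def localizing_def by blast

lemma triangulated_subcategory_Inter:
  assumes "\<And>L. L \<in> \<L> \<Longrightarrow> triangulated_subcategory T L"
  shows "triangulated_subcategory T (\<Inter>\<L>)"
proof (rule triangulated_subcategoryI; intro InterI)
  fix x y z p q r L assume D: "Dist T x y z p q r" and L: "L \<in> \<L>"
  note L' = assms[OF L, unfolded triangulated_subcategory_def]
  show "z \<in> L" if "x \<in> \<Inter>\<L>" "y \<in> \<Inter>\<L>" using that D L L' by blast
  show "x \<in> L" if "y \<in> \<Inter>\<L>" "z \<in> \<Inter>\<L>" using that D L L' by blast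
  show "y \<in> L" if "x \<in> \<Inter>\<L>" "z \<in> \<Inter>\<L>" using that D L L' by blast
qed (use assms in \<open>auto simp: triangulated_subcategory_def\<close>)

lemma localizing_ideal_Inter:
  assumes "\<forall>L\<in>\<L>. localizing_ideal U T L"
  shows "localizing_ideal U T (\<Inter>\<L>)"
  unfolding localizing_ideal_def localizing_def
proof (intro conjI ballI allI impI)
  show "triangulated_subcategory T (\<Inter>\<L>)"
    using assms by (intro triangulated_subcategory_Inter localizing_ideal_triangulated) blast
  show "t \<boxtimes> x \<in> \<Inter>\<L>" if "x \<in> \<Inter>\<L>" for t x
    using that assms unfolding localizing_ideal_def by blast
  fix I and X :: "'a \<Rightarrow> 'o" and \<iota> s
  assume I: "I \<subseteq> U \<and> I \<prec> U \<and> is_coproduct T I X \<iota> s \<and> (\<forall>i\<in>I. X i \<in> \<Inter>\<L>)"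
  show "s \<in> \<Inter>\<L>"
  proof
    fix L assume L: "L \<in> \<L>"
    with I have "\<forall>i\<in>I. X i \<in> L" by blast
    with I L assms show "s \<in> L" using localizing_ideal_coproduct by meson
  qed
qed

lemma Loc_minimal: "\<lbrakk>E \<subseteq> L; localizing U T L\<rbrakk> \<Longrightarrow> Loc U T E \<subseteq> L"
  by (rule hull_minimal)

lemma Loc_ideal_minimal: "\<lbrakk>E \<subseteq> L; localizing_ideal U T L\<rbrakk> \<Longrightarrow> Loc_ideal U T E \<subseteq> L"
  by (rule hull_minimal)

lemma localizing_ideal_Loc_ideal: "localizing_ideal U T (Loc_ideal U T E)"
  by (rule hull_in) (rule localizing_ideal_Inter)

lemma localizing_ideal_isomorphic: "\<lbrakk>localizing_ideal U T L; isomorphic T x y; x \<in> L\<rbrakk> \<Longrightarrow> y \<in> L"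
  unfolding localizing_ideal_def localizing_def using triangulated_subcategory_isomorphic by blast

lemma localizing_ideal_Tens: "\<lbrakk>localizing_ideal U T L; x \<in> L\<rbrakk> \<Longrightarrow> t \<boxtimes> x \<in> L"
  unfolding localizing_ideal_def by blast

lemma localizing_ideal_Tens': "\<lbrakk>localizing_ideal U T L; x \<in> L\<rbrakk> \<Longrightarrow> x \<boxtimes> t \<in> L"
  using localizing_ideal_isomorphic[OF _ isomorphic_commute] localizing_ideal_Tens by blast

lemma localizing_ideal_zero: "\<lbrakk>localizing_ideal U T L; is_zero T x\<rbrakk> \<Longrightarrow> x \<in> L"
  unfolding localizing_ideal_def localizing_def triangulated_subcategory_def by blast

lemma Loc_annihilator:
  assumes "\<And>x. x \<in> A \<Longrightarrow> is_zero T (k \<boxtimes> x)" "e \<in> Loc U T A"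
  shows "is_zero T (k \<boxtimes> e)"
proof -
  have "Loc U T A \<subseteq> {t. is_zero T (k \<boxtimes> t)}"
    by (rule Loc_minimal[OF _ localizing_annihilator]) (use assms(1) in blast)
  with assms(2) show ?thesis by blast
qed

text \<open>The two factors are varied one at a time: first \<open>B\<close> is enlarged with
  \<open>x\<close> in \<open>A\<close> fixed, then \<open>A\<close> with \<open>e'\<close>
  fixed.\<close>

lemma Loc_annihilator2:
  assumes "\<And>x y. \<lbrakk>x \<in> A; y \<in> B\<rbrakk> \<Longrightarrow> is_zero T (k \<boxtimes> (x \<boxtimes> y))"
    and e: "e \<in> Loc U T A" and e': "e' \<in> Loc U T B"
  shows "is_zero T (k \<boxtimes> (e \<boxtimes> e'))"
proof -
  have "is_zero T ((k \<boxtimes> x) \<boxtimes> e')" if "x \<in> A" for x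
    using Loc_annihilator[OF _ e', of "k \<boxtimes> x"] assms(1)[OF that] is_zero_assoc by blast
  moreover have "is_zero T ((k \<boxtimes> e') \<boxtimes> x)" if "is_zero T ((k \<boxtimes> x) \<boxtimes> e')" for x
    using that is_zero_isomorphic[OF isomorphic_Tens[OF isomorphic_refl isomorphic_commute]]
    unfolding is_zero_assoc by blast
  ultimately have "is_zero T ((k \<boxtimes> e') \<boxtimes> e)"
    using Loc_annihilator[OF _ e] by blast
  then show ?thesis
    using is_zero_isomorphic[OF isomorphic_Tens[OF isomorphic_refl isomorphic_commute]]
    unfolding is_zero_assoc by blast
qed

text \<open>Tensored with \<open>t\<close>, the triangle passes from \<open>e \<boxtimes> t\<close>
  through \<open>Unit T \<boxtimes> t\<close> to \<open>f \<boxtimes> t\<close>. If one outer term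
  vanishes, the other is isomorphic to the middle one.\<close>

lemma Dist_unit_absorb:
  assumes "Dist T e (Unit T) f a b c"
  shows "is_zero T (f \<boxtimes> t) \<Longrightarrow> isomorphic T t (e \<boxtimes> t)"
    and "is_zero T (e \<boxtimes> t) \<Longrightarrow> isomorphic T t (f \<boxtimes> t)"
proof -
  note D = Tens_exact[OF assms, of t]
  show "isomorphic T t (e \<boxtimes> t)" if "is_zero T (f \<boxtimes> t)"
    using Dist_zero_third_iso[OF D that] isomorphic_unit isomorphic_trans isomorphic_sym
    by (metis isomorphic_def)
  show "isomorphic T t (f \<boxtimes> t)" if "is_zero T (e \<boxtimes> t)"
    using Dist_zero_first_iso[OF D that] isomorphic_unit isomorphic_trans isomorphic_sym
    by (metis isomorphic_def)
qed

lemma thick_ideal_isomorphic: "\<lbrakk>thick_ideal U T J; isomorphic T x y; x \<in> J\<rbrakk> \<Longrightarrow> y \<in> J"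
  unfolding thick_ideal_def using triangulated_subcategory_isomorphic by blast

lemma thick_ideal_compact: "\<lbrakk>thick_ideal U T J; x \<in> J\<rbrakk> \<Longrightarrow> compact_object U T x"
  unfolding thick_ideal_def by blast

lemma thick_ideal_Tens: "\<lbrakk>thick_ideal U T J; x \<in> J; compact_object U T a\<rbrakk> \<Longrightarrow> a \<boxtimes> x \<in> J"
  unfolding thick_ideal_def by blast

lemma thick_ideal_Tens': "\<lbrakk>thick_ideal U T J; x \<in> J; compact_object U T a\<rbrakk> \<Longrightarrow> x \<boxtimes> a \<in> J"
  using thick_ideal_isomorphic[OF _ isomorphic_commute] thick_ideal_Tens by blast

lemma prime_ideal_thick: "prime_ideal U T P \<Longrightarrow> thick_ideal U T P"
  unfolding prime_ideal_def by blast

lemma prime_ideal_Tens: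
  "\<lbrakk>prime_ideal U T P; compact_object U T a; compact_object U T b; a \<boxtimes> b \<in> P\<rbrakk> \<Longrightarrow> a \<in> P \<or> b \<in> P"
  unfolding prime_ideal_def by blast

text \<open>A zero object lies in every prime, so the complement of its support is a generating open
  set that contains all primes.\<close>

lemma topspace_Spc: "topspace (Spc U T) = {P. prime_ideal U T P}"
proof -
  obtain o' where o: "is_zero T o'" using zero_object by blast
  have "supp U T o' = {}"
    using o unfolding supp_def prime_ideal_def thick_ideal_def triangulated_subcategory_def by blast
  then have "{P. prime_ideal U T P} \<in> {{P. prime_ideal U T P} - supp U T x | x. compact_object U T x}"
    using compact_object_zero[OF o] by (metis (mono_tags, lifting) Diff_empty mem_Collect_eq)
  then show ?thesis
    unfolding Spc_def topology_generated_by_topspace by blast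
qed

text \<open>Finite intersections and unions create no new separations: if an open set separates
  \<open>Q\<close> from \<open>P\<close>, so does one of the generating complements of
  supports.\<close>

lemma Spc_separation:
  assumes "openin (Spc U T) W" "Q \<in> W" "P \<notin> W" "prime_ideal U T P"
  shows "\<exists>x. compact_object U T x \<and> x \<in> Q \<and> x \<notin> P"
proof -
  have "generate_topology_on {{P. prime_ideal U T P} - supp U T x | x. compact_object U T x} W"
    using assms(1) unfolding Spc_def by (rule openin_topology_generated_by)
  then show ?thesis
    using assms(2,3)
  proof induction
    case (Basis s)
    then obtain x where "s = {P. prime_ideal U T P} - supp U T x" "compact_object U T x" by blast
    then show ?case using Basis.prems assms(4) unfolding supp_def by blast
  qed blast+
qed

end

section \<open>Thick ideals, prime ideals and vanishing on compact objects\<close>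

context rigidly_compactly_generated_tt_category
begin

lemma compact_object_Tens:
  "\<lbrakk>compact_object U T x; compact_object U T y\<rbrakk> \<Longrightarrow> compact_object U T (x \<boxtimes> y)"
  using compact_object_Tens_rigid compact_iff_rigid by blast

text \<open>The colon ideal (K : a), by means of which a maximal ideal avoiding given objects is
  shown to be prime.\<close>

lemma thick_ideal_colon:
  assumes K: "thick_ideal U T K" and a: "compact_object U T a"
  shows "thick_ideal U T {x. compact_object U T x \<and> a \<boxtimes> x \<in> K}"
proof -
  have tri: "triangulated_subcategory T K" "triangulated_subcategory T {x. compact_object U T x}"
    using K triangulated_subcategory_compact by (auto simp: thick_ideal_def)
  have c: "a \<boxtimes> x \<in> K \<longleftrightarrow> x \<boxtimes> a \<in> K" for x
    using thick_ideal_isomorphic[OF K isomorphic_commute] by blast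
  have "triangulated_subcategory T {x. compact_object U T x \<and> x \<boxtimes> a \<in> K}"
  proof (rule triangulated_subcategoryI; unfold mem_Collect_eq)
    fix x y z p q r assume D: "Dist T x y z p q r"
    note D' = Tens_exact[OF D, of a]
    show "compact_object U T z \<and> z \<boxtimes> a \<in> K"
      if "compact_object U T x \<and> x \<boxtimes> a \<in> K" "compact_object U T y \<and> y \<boxtimes> a \<in> K"
      using that D D' tri unfolding triangulated_subcategory_def mem_Collect_eq by blast
    show "compact_object U T x \<and> x \<boxtimes> a \<in> K"
      if "compact_object U T y \<and> y \<boxtimes> a \<in> K" "compact_object U T z \<and> z \<boxtimes> a \<in> K"
      using that D D' tri unfolding triangulated_subcategory_def mem_Collect_eq by blast
    show "compact_object U T y \<and> y \<boxtimes> a \<in> K"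
      if "compact_object U T x \<and> x \<boxtimes> a \<in> K" "compact_object U T z \<and> z \<boxtimes> a \<in> K"
      using that D D' tri unfolding triangulated_subcategory_def mem_Collect_eq by blast
  next
    fix x assume "is_zero T x"
    then show "compact_object U T x \<and> x \<boxtimes> a \<in> K"
      using compact_object_zero is_zero_Tens_left[of x a] tri(1) unfolding triangulated_subcategory_def by blast
  qed
  moreover have "a \<boxtimes> x \<in> K" if "is_retract T x y" "a \<boxtimes> y \<in> K" for x y
    using is_retract_Tens[OF that(1), of a] that(2) K unfolding thick_ideal_def by blast
  moreover have "a \<boxtimes> (b \<boxtimes> x) \<in> K" if "compact_object U T b" "a \<boxtimes> x \<in> K" for b x
    using thick_ideal_isomorphic[OF K isomorphic_left_commute] thick_ideal_Tens[OF K that(2,1)] .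
  ultimately show ?thesis
    unfolding thick_ideal_def c[symmetric]
    using compact_object_retract compact_object_Tens by blast
qed

lemma thick_ideal_annihilator: "thick_ideal U T {x. compact_object U T x \<and> is_zero T (k \<boxtimes> x)}"
proof -
  have tri: "triangulated_subcategory T {x. is_zero T (k \<boxtimes> x)}"
    using localizing_annihilator[of U k] unfolding localizing_def by blast
  have "triangulated_subcategory T {x. compact_object U T x \<and> is_zero T (k \<boxtimes> x)}"
    using tri triangulated_subcategory_compact[of U]
    unfolding triangulated_subcategory_def subset_eq mem_Collect_eq by blast
  moreover have "is_zero T (k \<boxtimes> x)" if "is_retract T x y" "is_zero T (k \<boxtimes> y)" for x y
    using is_zero_retract[OF is_retract_Tens[OF that(1)] that(2)] .
  moreover have "is_zero T (k \<boxtimes> (b \<boxtimes> x))" if "is_zero T (k \<boxtimes> x)" for b x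
    using is_zero_left_commute is_zero_Tens_right[OF that] by blast
  ultimately show ?thesis
    unfolding thick_ideal_def using compact_object_retract compact_object_Tens by blast
qed

text \<open>Every closure condition involves at most two members, and a chain puts any two members
  of its union into a single ideal.\<close>

lemma thick_ideal_Union_chain:
  assumes "\<C> \<noteq> {}" "\<And>K. K \<in> \<C> \<Longrightarrow> thick_ideal U T K" "\<And>K L. \<lbrakk>K \<in> \<C>; L \<in> \<C>\<rbrakk> \<Longrightarrow> K \<subseteq> L \<or> L \<subseteq> K"
  shows "thick_ideal U T (\<Union>\<C>)"
proof -
  have tri: "triangulated_subcategory T K" if "K \<in> \<C>" for K
    using assms(2)[OF that] unfolding thick_ideal_def by blast
  have both: "\<exists>K\<in>\<C>. x \<in> K \<and> y \<in> K" if "x \<in> \<Union>\<C>" "y \<in> \<Union>\<C>" for x y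
    using that assms(3) by blast
  have "triangulated_subcategory T (\<Union>\<C>)"
  proof (rule triangulated_subcategoryI)
    fix x assume "is_zero T x"
    then show "x \<in> \<Union>\<C>"
      using assms(1) tri unfolding triangulated_subcategory_def by blast
  next
    fix x y z p q r assume D: "Dist T x y z p q r"
    show "z \<in> \<Union>\<C>" if xy: "x \<in> \<Union>\<C>" "y \<in> \<Union>\<C>"
    proof -
      obtain K where K: "K \<in> \<C>" "x \<in> K" "y \<in> K" using both[OF xy] by blast
      then have "z \<in> K" using tri[OF K(1)] D unfolding triangulated_subcategory_def by blast
      with K(1) show ?thesis by blast
    qed
    show "x \<in> \<Union>\<C>" if xy: "y \<in> \<Union>\<C>" "z \<in> \<Union>\<C>"
    proof -
      obtain K where K: "K \<in> \<C>" "y \<in> K" "z \<in> K" using both[OF xy] by blast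
      then have "x \<in> K" using tri[OF K(1)] D unfolding triangulated_subcategory_def by blast
      with K(1) show ?thesis by blast
    qed
    show "y \<in> \<Union>\<C>" if xy: "x \<in> \<Union>\<C>" "z \<in> \<Union>\<C>"
    proof -
      obtain K where K: "K \<in> \<C>" "x \<in> K" "z \<in> K" using both[OF xy] by blast
      then have "y \<in> K" using tri[OF K(1)] D unfolding triangulated_subcategory_def by blast
      with K(1) show ?thesis by blast
    qed
  qed
  then show ?thesis
    using assms(2) unfolding thick_ideal_def by blast
qed

text \<open>Avoiding the tensor powers of \<open>zs 0\<close> with exponent \<open>2 ^ n\<close> amounts to avoiding all of them.\<close>

lemma exists_prime_ideal:
  assumes J: "thick_ideal U T J"
    and z: "compact_object U T (zs 0)" and zs: "\<And>n :: nat. zs (Suc n) = zs n \<boxtimes> zs n"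
    and zJ: "\<And>n. zs n \<notin> J"
  shows "\<exists>P. prime_ideal U T P \<and> J \<subseteq> P \<and> zs 0 \<notin> P"
proof -
  let ?A = "{K. thick_ideal U T K \<and> J \<subseteq> K \<and> (\<forall>n. zs n \<notin> K)}"
  have zs_compact: "compact_object U T (zs n)" for n
    by (induction n) (auto simp: zs z compact_object_Tens)
  have mono: "zs N \<in> K" if "thick_ideal U T K" "zs n \<in> K" "n \<le> N" for K n N
    using that(3)
    by (induction rule: dec_induct) (auto simp: zs that(2) intro: thick_ideal_Tens[OF that(1)] zs_compact)
  have "\<exists>M\<in>?A. \<forall>X\<in>?A. M \<subseteq> X \<longrightarrow> X = M"
  proof (rule subset_Zorn_nonempty)
    show "?A \<noteq> {}" using J zJ by blast
    fix \<C> assume \<C>: "\<C> \<noteq> {}" "subset.chain ?A \<C>"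
    then have "thick_ideal U T (\<Union>\<C>)"
      by (intro thick_ideal_Union_chain) (auto simp: subset.chain_def)
    with \<C> show "\<Union>\<C> \<in> ?A" unfolding subset.chain_def by blast
  qed
  then obtain M where M_in: "M \<in> ?A" and M_max: "\<forall>X\<in>?A. M \<subseteq> X \<longrightarrow> X = M"
    by (rule bexE)
  then have M: "thick_ideal U T M" "J \<subseteq> M" "\<And>n. zs n \<notin> M" by simp_all
  have max: "K = M" if "thick_ideal U T K" "M \<subseteq> K" "\<forall>n. zs n \<notin> K" for K
    using M_max[THEN bspec, of K] M(2) that by simp
  \<comment> \<open>The colon ideal (M : a) contains \<open>M\<close> and also \<open>b\<close>, so
    by maximality it must contain some \<open>zs n\<close>.\<close>
  have colon: "\<exists>n. a \<boxtimes> zs n \<in> M"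
    if a: "compact_object U T a" and b: "compact_object U T b" "b \<notin> M" "a \<boxtimes> b \<in> M" for a b
  proof (rule ccontr)
    assume "\<nexists>n. a \<boxtimes> zs n \<in> M"
    then have "{x. compact_object U T x \<and> a \<boxtimes> x \<in> M} = M"
      using thick_ideal_compact[OF M(1)] thick_ideal_Tens[OF M(1) _ a]
      by (intro max thick_ideal_colon[OF M(1) a]) blast+
    with b show False by blast
  qed
  have "a \<in> M \<or> b \<in> M"
    if a: "compact_object U T a" and b: "compact_object U T b" and ab: "a \<boxtimes> b \<in> M" for a b
  proof (rule ccontr)
    assume nM: "\<not> (a \<in> M \<or> b \<in> M)"
    \<comment> \<open>Two exchanges: \<open>b\<close> for some \<open>zs n\<close>, then
      \<open>a\<close> for some \<open>zs m\<close>.\<close>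
    obtain n where "a \<boxtimes> zs n \<in> M" using colon[OF a b _ ab] nM by blast
    then have "zs n \<boxtimes> a \<in> M" by (rule thick_ideal_isomorphic[OF M(1) isomorphic_commute])
    then obtain m where nm: "zs n \<boxtimes> zs m \<in> M" using colon[OF zs_compact a] nM by blast
    \<comment> \<open>Both factors are raised to this common index, each inside a colon ideal; then
      \<open>zs N \<boxtimes> zs N\<close> is \<open>zs (Suc N)\<close>, which \<open>M\<close>
      avoids.\<close>
    define N where "N = max n m"
    have "zs N \<in> {x. compact_object U T x \<and> zs n \<boxtimes> x \<in> M}"
      by (rule mono[OF thick_ideal_colon[OF M(1) zs_compact], of m])
        (use nm zs_compact in \<open>auto simp: N_def\<close>)
    then have "zs N \<boxtimes> zs n \<in> M"
      using thick_ideal_isomorphic[OF M(1) isomorphic_commute] by blast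
    then have "zs n \<in> {x. compact_object U T x \<and> zs N \<boxtimes> x \<in> M}"
      using zs_compact by blast
    then have "zs N \<in> {x. compact_object U T x \<and> zs N \<boxtimes> x \<in> M}"
      by (rule mono[OF thick_ideal_colon[OF M(1) zs_compact]]) (simp add: N_def)
    then have "zs (Suc N) \<in> M" by (simp add: zs)
    with M(3) show False by blast
  qed
  then have "prime_ideal U T M"
    unfolding prime_ideal_def using M z by blast
  with M show ?thesis by blast
qed

text \<open>\<open>P\<close> lies in a closed subset of \<open>Y\<close> with quasi-compact
  complement. By \<open>Spc_separation\<close>, each prime in that complement contains a compact
  object outside \<open>P\<close>. The tensor product of the objects from a finite subcover lies in
  every prime of the complement but, \<open>P\<close> being prime, not in \<open>P\<close>.\<close>

lemma Thomason_supp: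
  assumes "Thomason (Spc U T) Y" "P \<in> Y"
  obtains x where "compact_object U T x" "x \<notin> P" "supp U T x \<subseteq> Y"
proof -
  obtain K where K: "closedin (Spc U T) K" "compactin (Spc U T) (topspace (Spc U T) - K)" "P \<in> K" "K \<subseteq> Y"
    using assms unfolding Thomason_def by blast
  let ?W = "topspace (Spc U T) - K"
  have P: "prime_ideal U T P"
    using closedin_subset[OF K(1)] K(3) by (auto simp: topspace_Spc)
  let ?\<U> = "{{Q. prime_ideal U T Q} - supp U T x | x. compact_object U T x \<and> x \<notin> P}"
  have "\<forall>V\<in>?\<U>. openin (Spc U T) V"
    unfolding Spc_def by (blast intro: topology_generated_by_Basis)
  moreover have "?W \<subseteq> \<Union>?\<U>"
  proof
    fix Q assume Q: "Q \<in> ?W"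
    have "openin (Spc U T) ?W" using K(1) by blast
    then obtain x where "compact_object U T x" "x \<in> Q" "x \<notin> P"
      using Spc_separation[OF _ Q _ P] K(3) by blast
    with Q show "Q \<in> \<Union>?\<U>" unfolding topspace_Spc supp_def by blast
  qed
  ultimately obtain \<F> where \<F>: "finite \<F>" "\<F> \<subseteq> ?\<U>" "?W \<subseteq> \<Union>\<F>"
    using K(2) unfolding compactin_def by meson
  have "\<exists>x. compact_object U T x \<and> x \<notin> P \<and> (\<forall>Q\<in>\<Union>\<F>. x \<in> Q)"
    using \<F>(1,2)
  proof (induction \<F>)
    case empty
    \<comment> \<open>For the empty subcover any compact object outside the proper ideal
      \<open>P\<close> serves.\<close>
    have "P \<subset> {x. compact_object U T x}"
      using P unfolding prime_ideal_def thick_ideal_def by blast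
    then show ?case by blast
  next
    case (insert V \<F>)
    obtain x where x: "compact_object U T x" "x \<notin> P" "\<forall>Q\<in>\<Union>\<F>. x \<in> Q"
      using insert.IH insert.prems by blast
    obtain v where v: "V = {Q. prime_ideal U T Q} - supp U T v" "compact_object U T v" "v \<notin> P"
      using insert.prems by blast
    have "x \<boxtimes> v \<notin> P" using prime_ideal_Tens[OF P x(1) v(2)] x(2) v(3) by blast
    moreover have "x \<boxtimes> v \<in> Q" if "Q \<in> \<Union>(insert V \<F>)" for Q
    proof -
      have "prime_ideal U T Q" using that insert.prems by blast
      then have Q: "thick_ideal U T Q" by (rule prime_ideal_thick)
      have "v \<in> Q \<or> x \<in> Q" using that x(3) v(1) unfolding supp_def by blast
      then show ?thesis
        using thick_ideal_Tens[OF Q _ x(1)] thick_ideal_Tens'[OF Q _ v(2)] by blast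
    qed
    ultimately show ?case using compact_object_Tens[OF x(1) v(2)] by blast
  qed
  then obtain x where x: "compact_object U T x" "x \<notin> P" "\<forall>Q\<in>\<Union>\<F>. x \<in> Q" by blast
  have "supp U T x \<subseteq> K"
    using x(3) \<F>(3) unfolding supp_def topspace_Spc by blast
  with x that K(4) show ?thesis by blast
qed

lemma supp_Tens:
  assumes "compact_object U T x" "compact_object U T y"
  shows "supp U T (x \<boxtimes> y) \<subseteq> supp U T x \<inter> supp U T y"
  using thick_ideal_Tens[OF prime_ideal_thick _ assms(1)] thick_ideal_Tens'[OF prime_ideal_thick _ assms(2)]
  unfolding supp_def by blast

lemma supp_subset_topspace: "supp U T x \<subseteq> topspace (Spc U T)"
  unfolding supp_def topspace_Spc by blast

text \<open>This replaces the classification of thick ideals: the compact objects killed by \<open>k\<close> form a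
  radical ideal, hence an intersection of primes, and each prime in \<open>Y \<union> Y'\<close> misses some \<open>x\<close> killed
  by \<open>k\<close>.\<close>

lemma annihilates_supported_on_Un:
  assumes Y: "Thomason (Spc U T) Y" and Y': "Thomason (Spc U T) Y'"
    and k: "\<And>x. x \<in> compacts_supported_on U T Y \<Longrightarrow> is_zero T (k \<boxtimes> x)"
    and k': "\<And>x. x \<in> compacts_supported_on U T Y' \<Longrightarrow> is_zero T (k \<boxtimes> x)"
    and z: "compact_object U T z" "supp U T z \<subseteq> Y \<union> Y'"
  shows "is_zero T (k \<boxtimes> z)"
proof (rule ccontr)
  assume nz: "\<not> is_zero T (k \<boxtimes> z)"
  let ?J = "{x. compact_object U T x \<and> is_zero T (k \<boxtimes> x)}"
  define zs where "zs = rec_nat z (\<lambda>_ x. x \<boxtimes> x)"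
  have zs: "zs 0 = z" "\<And>n. zs (Suc n) = zs n \<boxtimes> zs n" by (simp_all add: zs_def)
  have "compact_object U T (zs n)" for n
    by (induction n) (auto simp: zs z(1) compact_object_Tens)
  \<comment> \<open>The iterated squares never enter the annihilator, which is radical by
    rigidity.\<close>
  then have "\<not> is_zero T (k \<boxtimes> zs n)" for n
    using nz is_zero_Tens_rigid_square compact_iff_rigid by (induction n) (auto simp: zs)
  then have "\<exists>P. prime_ideal U T P \<and> ?J \<subseteq> P \<and> zs 0 \<notin> P"
    by (intro exists_prime_ideal thick_ideal_annihilator) (auto simp: zs z(1))
  then obtain P where P: "prime_ideal U T P" "?J \<subseteq> P" "z \<notin> P" by (auto simp: zs)
  then have "P \<in> Y \<union> Y'" using z(2) unfolding supp_def by blast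
  then obtain x where "compact_object U T x" "x \<notin> P" "supp U T x \<subseteq> Y \<or> supp U T x \<subseteq> Y'"
    using Thomason_supp[OF Y] Thomason_supp[OF Y'] by (metis UnE)
  then show False
    using k k' P(2) unfolding compacts_supported_on_def by blast
qed

section \<open>The objects \<open>g(P)\<close>\<close>

text \<open>The first two facts reduce statements about \<open>e\<close> and \<open>f\<close> to
  compact objects supported on \<open>Y\<close>; the last two turn vanishing into
  absorption.\<close>

lemma idempotent_triangleD:
  assumes "idempotent_triangle U T Y e f"
  shows "e \<in> Loc U T (compacts_supported_on U T Y)"
    and "x \<in> compacts_supported_on U T Y \<Longrightarrow> is_zero T (f \<boxtimes> x)"
    and "is_zero T (f \<boxtimes> t) \<Longrightarrow> isomorphic T t (e \<boxtimes> t)"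
    and "is_zero T (e \<boxtimes> t) \<Longrightarrow> isomorphic T t (f \<boxtimes> t)"
proof -
  have eq: "Loc_ideal U T {e} = Loc U T (compacts_supported_on U T Y)"
    "{t. is_zero T (f \<boxtimes> t)} = Loc U T (compacts_supported_on U T Y)"
    using assms unfolding idempotent_triangle_def by auto
  show "e \<in> Loc U T (compacts_supported_on U T Y)"
    unfolding eq(1)[symmetric] by (rule hull_inc) simp
  show "is_zero T (f \<boxtimes> x)" if "x \<in> compacts_supported_on U T Y"
    using hull_inc[OF that, of "localizing U T"] unfolding eq(2)[symmetric] by simp
  obtain a b c where D: "Dist T e (Unit T) f a b c"
    using assms unfolding idempotent_triangle_def by blast
  show "is_zero T (f \<boxtimes> t) \<Longrightarrow> isomorphic T t (e \<boxtimes> t)"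
    and "is_zero T (e \<boxtimes> t) \<Longrightarrow> isomorphic T t (f \<boxtimes> t)"
    using Dist_unit_absorb[OF D] by blast+
qed

lemma point_objectsE:
  assumes "g \<in> point_objects U T P"
  obtains e1 f1 e2 f2 Y1 Y2 where "g = e1 \<boxtimes> f2" "Thomason (Spc U T) Y1" "Thomason (Spc U T) Y2"
    "{P} = Y1 \<inter> (topspace (Spc U T) - Y2)"
    "idempotent_triangle U T Y1 e1 f1" "idempotent_triangle U T Y2 e2 f2"
  using assms unfolding point_objects_def mem_Collect_eq by (elim exE conjE) (rule that)

text \<open>Rearranged, the product is \<open>f2 \<boxtimes> f2'\<close> applied to
  \<open>e1 \<boxtimes> e1'\<close>. It suffices to replace \<open>e1\<close> and \<open>e1'\<close>
  by compact objects supported on \<open>Y1\<close> and \<open>Y1'\<close>, whose tensor product is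
  supported where \<open>f2\<close> or \<open>f2'\<close> annihilates.\<close>

lemma point_objects_orthogonal:
  assumes "g \<in> point_objects U T P" "g' \<in> point_objects U T Q" "P \<noteq> Q"
  shows "is_zero T (g \<boxtimes> g')"
proof -
  obtain e1 f1 e2 f2 Y1 Y2 where g: "g = e1 \<boxtimes> f2" "Thomason (Spc U T) Y1" "Thomason (Spc U T) Y2"
    "{P} = Y1 \<inter> (topspace (Spc U T) - Y2)"
    and i1: "idempotent_triangle U T Y1 e1 f1" and i2: "idempotent_triangle U T Y2 e2 f2"
    using assms(1) by (rule point_objectsE)
  obtain e1' f1' e2' f2' Y1' Y2' where g': "g' = e1' \<boxtimes> f2'" "Thomason (Spc U T) Y1'" "Thomason (Spc U T) Y2'"
    "{Q} = Y1' \<inter> (topspace (Spc U T) - Y2')"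
    and i1': "idempotent_triangle U T Y1' e1' f1'" and i2': "idempotent_triangle U T Y2' e2' f2'"
    using assms(2) by (rule point_objectsE)
  have "is_zero T ((f2 \<boxtimes> f2') \<boxtimes> (x \<boxtimes> y))"
    if "x \<in> compacts_supported_on U T Y1" "y \<in> compacts_supported_on U T Y1'" for x y
  proof (rule annihilates_supported_on_Un[OF g(3) g'(3)])
    show "is_zero T ((f2 \<boxtimes> f2') \<boxtimes> x)" if "x \<in> compacts_supported_on U T Y2" for x
      using is_zero_Tens_right[OF idempotent_triangleD(2)[OF i2 that], of f2']
      by (simp add: is_zero_assoc is_zero_left_commute)
    show "is_zero T ((f2 \<boxtimes> f2') \<boxtimes> x)" if "x \<in> compacts_supported_on U T Y2'" for x
      using is_zero_Tens_right[OF idempotent_triangleD(2)[OF i2' that], of f2]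
      by (simp add: is_zero_assoc)
    have xy: "compact_object U T x" "compact_object U T y" "supp U T x \<subseteq> Y1" "supp U T y \<subseteq> Y1'"
      using that unfolding compacts_supported_on_def by auto
    show "compact_object U T (x \<boxtimes> y)" using compact_object_Tens[OF xy(1,2)] .
    \<comment> \<open>A common point of \<open>Y1\<close> and \<open>Y1'\<close> outside
      \<open>Y2 \<union> Y2'\<close> would equal both \<open>P\<close> and \<open>Q\<close>.\<close>
    have "Y1 \<inter> Y1' \<inter> topspace (Spc U T) \<subseteq> Y2 \<union> Y2'"
      using g(4) g'(4) assms(3) by blast
    then show "supp U T (x \<boxtimes> y) \<subseteq> Y2 \<union> Y2'"
      using supp_Tens[OF xy(1,2)] xy(3,4) supp_subset_topspace by blast
  qed
  then have z: "is_zero T ((f2 \<boxtimes> f2') \<boxtimes> (e1 \<boxtimes> e1'))"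
    using idempotent_triangleD(1)[OF i1] idempotent_triangleD(1)[OF i1'] by (rule Loc_annihilator2)
  have "isomorphic T ((f2 \<boxtimes> f2') \<boxtimes> (e1 \<boxtimes> e1')) ((e1 \<boxtimes> f2) \<boxtimes> (e1' \<boxtimes> f2'))"
  proof -
    have "isomorphic T ((f2 \<boxtimes> f2') \<boxtimes> (e1 \<boxtimes> e1')) (e1 \<boxtimes> ((f2 \<boxtimes> f2') \<boxtimes> e1'))"
      by (rule isomorphic_left_commute)
    also have "isomorphic T \<dots> (e1 \<boxtimes> (f2 \<boxtimes> (e1' \<boxtimes> f2')))"
    proof (rule isomorphic_Tens[OF isomorphic_refl])
      have "isomorphic T ((f2 \<boxtimes> f2') \<boxtimes> e1') (f2 \<boxtimes> (f2' \<boxtimes> e1'))" by (rule isomorphic_assoc)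
      also have "isomorphic T \<dots> (f2 \<boxtimes> (e1' \<boxtimes> f2'))"
        by (rule isomorphic_Tens[OF isomorphic_refl isomorphic_commute])
      finally show "isomorphic T ((f2 \<boxtimes> f2') \<boxtimes> e1') (f2 \<boxtimes> (e1' \<boxtimes> f2'))" .
    qed
    also have "isomorphic T \<dots> ((e1 \<boxtimes> f2) \<boxtimes> (e1' \<boxtimes> f2'))"
      by (rule isomorphic_sym[OF isomorphic_assoc])
    finally show ?thesis .
  qed
  from is_zero_isomorphic[OF this] z show ?thesis
    unfolding g(1) g'(1) by blast
qed

text \<open>An object killed by \<open>f1'\<close> absorbs \<open>e1'\<close>, and one killed by
  \<open>e2'\<close> absorbs \<open>f2'\<close>. So it is enough that \<open>f1'\<close> and
  \<open>e2'\<close> kill \<open>g\<close>, since annihilators are localizing ideals and then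
  contain the ideal generated by \<open>g\<close>.\<close>

lemma point_objects_absorb:
  assumes g: "g \<in> point_objects U T P" and g': "g' \<in> point_objects U T P"
    and t: "t \<in> Loc_ideal U T {g}"
  shows "isomorphic T t (g' \<boxtimes> t)"
proof -
  obtain e1 f1 e2 f2 Y1 Y2 where g_eq: "g = e1 \<boxtimes> f2" and Y: "Thomason (Spc U T) Y1" "Thomason (Spc U T) Y2"
    "{P} = Y1 \<inter> (topspace (Spc U T) - Y2)"
    and i1: "idempotent_triangle U T Y1 e1 f1" and i2: "idempotent_triangle U T Y2 e2 f2"
    using g by (rule point_objectsE)
  obtain e1' f1' e2' f2' Y1' Y2' where g'_eq: "g' = e1' \<boxtimes> f2'" and Y': "Thomason (Spc U T) Y1'" "Thomason (Spc U T) Y2'"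
    "{P} = Y1' \<inter> (topspace (Spc U T) - Y2')"
    and i1': "idempotent_triangle U T Y1' e1' f1'" and i2': "idempotent_triangle U T Y2' e2' f2'"
    using g' by (rule point_objectsE)
  have "is_zero T (f2 \<boxtimes> (x \<boxtimes> y))"
    if "x \<in> compacts_supported_on U T Y1" "y \<in> compacts_supported_on U T Y2'" for x y
  proof (rule idempotent_triangleD(2)[OF i2])
    have xy: "compact_object U T x" "compact_object U T y" "supp U T x \<subseteq> Y1" "supp U T y \<subseteq> Y2'"
      using that unfolding compacts_supported_on_def by auto
    \<comment> \<open>A point of \<open>Y1\<close> outside \<open>Y2\<close> is \<open>P\<close>,
      which does not lie in \<open>Y2'\<close>.\<close>
    have "Y1 \<inter> Y2' \<inter> topspace (Spc U T) \<subseteq> Y2"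
      using Y(3) Y'(3) by blast
    then show "x \<boxtimes> y \<in> compacts_supported_on U T Y2"
      using supp_Tens[OF xy(1,2)] xy(3,4) supp_subset_topspace compact_object_Tens[OF xy(1,2)]
      unfolding compacts_supported_on_def by blast
  qed
  then have "is_zero T (f2 \<boxtimes> (e1 \<boxtimes> e2'))"
    using idempotent_triangleD(1)[OF i1] idempotent_triangleD(1)[OF i2'] by (rule Loc_annihilator2)
  then have "is_zero T ((e1 \<boxtimes> f2) \<boxtimes> e2')"
    by (simp add: is_zero_assoc is_zero_left_commute)
  then have e2'g: "is_zero T (e2' \<boxtimes> g)"
    unfolding g_eq using is_zero_commute by blast
  have "is_zero T ((f2 \<boxtimes> f1') \<boxtimes> x)" if "x \<in> compacts_supported_on U T Y1" for x
  proof (rule annihilates_supported_on_Un[OF Y(2) Y'(1)])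
    show "is_zero T ((f2 \<boxtimes> f1') \<boxtimes> x)" if "x \<in> compacts_supported_on U T Y2" for x
      using is_zero_Tens_right[OF idempotent_triangleD(2)[OF i2 that], of f1']
      by (simp add: is_zero_assoc is_zero_left_commute)
    show "is_zero T ((f2 \<boxtimes> f1') \<boxtimes> x)" if "x \<in> compacts_supported_on U T Y1'" for x
      using is_zero_Tens_right[OF idempotent_triangleD(2)[OF i1' that], of f2]
      by (simp add: is_zero_assoc)
    show "compact_object U T x" using that unfolding compacts_supported_on_def by blast
    \<comment> \<open>A point of \<open>Y1\<close> outside \<open>Y2\<close> is \<open>P\<close>,
      which lies in \<open>Y1'\<close>.\<close>
    have "Y1 \<inter> topspace (Spc U T) \<subseteq> Y2 \<union> Y1'" using Y(3) Y'(3) by blast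
    then show "supp U T x \<subseteq> Y2 \<union> Y1'"
      using that supp_subset_topspace unfolding compacts_supported_on_def by blast
  qed
  then have "is_zero T ((f2 \<boxtimes> f1') \<boxtimes> e1)"
    using idempotent_triangleD(1)[OF i1] by (rule Loc_annihilator)
  then have "is_zero T (e1 \<boxtimes> (f2 \<boxtimes> f1'))"
    using is_zero_commute by blast
  then have "is_zero T ((e1 \<boxtimes> f2) \<boxtimes> f1')"
    by (simp add: is_zero_assoc)
  then have f1'g: "is_zero T (f1' \<boxtimes> g)"
    unfolding g_eq using is_zero_commute by blast
  have "Loc_ideal U T {g} \<subseteq> {t. is_zero T (h \<boxtimes> t)}" if "is_zero T (h \<boxtimes> g)" for h
    by (rule Loc_ideal_minimal[OF _ localizing_ideal_annihilator]) (use that in simp)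
  then have z: "is_zero T (e2' \<boxtimes> t)" "is_zero T (f1' \<boxtimes> t)"
    using e2'g f1'g t by blast+
  have "isomorphic T t (e1' \<boxtimes> t)"
    using idempotent_triangleD(3)[OF i1' z(2)] .
  also have "isomorphic T \<dots> (e1' \<boxtimes> (f2' \<boxtimes> t))"
    using isomorphic_Tens[OF isomorphic_refl idempotent_triangleD(4)[OF i2' z(1)]] .
  also have "isomorphic T \<dots> ((e1' \<boxtimes> f2') \<boxtimes> t)"
    by (rule isomorphic_sym[OF isomorphic_assoc])
  finally show ?thesis unfolding g'_eq .
qed

lemma tensor_image_point_object:
  assumes g: "g \<in> point_objects U T P"
  shows "tensor_image T g = Loc_ideal U T {g}"
proof
  have "g \<boxtimes> t \<in> Loc_ideal U T {g}" for t
    by (rule localizing_ideal_Tens'[OF localizing_ideal_Loc_ideal]) (simp add: hull_inc)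
  then show "tensor_image T g \<subseteq> Loc_ideal U T {g}"
    unfolding tensor_image_def
    using localizing_ideal_isomorphic[OF localizing_ideal_Loc_ideal isomorphic_sym] by blast
  show "Loc_ideal U T {g} \<subseteq> tensor_image T g"
    unfolding tensor_image_def using point_objects_absorb[OF g g] by blast
qed

text \<open>With the braiding, two applications show that any two choices are isomorphic. The
  absorbing form is the convenient one for exchanging choices inside tensor products.\<close>

lemma point_objects_isomorphic:
  assumes "g \<in> point_objects U T P" "g' \<in> point_objects U T P"
  shows "isomorphic T g (g' \<boxtimes> g)"
  by (rule point_objects_absorb[OF assms]) (simp add: hull_inc)

text \<open>Any choice of the point object decides: if \<open>g\<close> kills \<open>t\<close>, then
  so does \<open>g \<boxtimes> g'\<close>, which is isomorphic to \<open>g'\<close>.\<close>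

lemma Supp_iff:
  assumes "P \<in> topspace (Spc U T)" "g \<in> point_objects U T P"
  shows "P \<in> Supp U T t \<longleftrightarrow> \<not> is_zero T (g \<boxtimes> t)"
proof -
  have "is_zero T (g' \<boxtimes> t)" if "g' \<in> point_objects U T P" "is_zero T (g \<boxtimes> t)" for g'
  proof -
    have "isomorphic T (g' \<boxtimes> t) ((g \<boxtimes> g') \<boxtimes> t)"
      by (rule isomorphic_Tens[OF point_objects_isomorphic[OF that(1) assms(2)] isomorphic_refl])
    moreover have "is_zero T ((g \<boxtimes> g') \<boxtimes> t)"
      using is_zero_Tens_right[OF that(2), of g'] by (simp add: is_zero_assoc is_zero_left_commute)
    ultimately show ?thesis using is_zero_isomorphic by blast
  qed
  then show ?thesis using assms unfolding Supp_def by blast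
qed

section \<open>Supports of localizing ideals and the two implications\<close>

definition Supp_class :: "'o set \<Rightarrow> 'o set set" where
  "Supp_class L = (\<Union>t\<in>L. Supp U T t)"

lemma Supp_class_subset: "Supp_class L \<subseteq> topspace (Spc U T)"
  unfolding Supp_class_def Supp_def by blast

text \<open>A point object at \<open>Q\<close> that kills all generators kills the whole
  ideal.\<close>

lemma Supp_class_Loc_ideal:
  assumes "Q \<in> Supp_class (Loc_ideal U T E)"
  obtains t where "t \<in> E" "Q \<in> Supp U T t"
proof -
  obtain s g where s: "s \<in> Loc_ideal U T E" and g: "Q \<in> topspace (Spc U T)" "g \<in> point_objects U T Q" "\<not> is_zero T (g \<boxtimes> s)"
    using assms unfolding Supp_class_def Supp_def by blast
  have "\<not> E \<subseteq> {t. is_zero T (g \<boxtimes> t)}"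
    using Loc_ideal_minimal[OF _ localizing_ideal_annihilator, of E g U] s g(3) by blast
  then show ?thesis using that g unfolding Supp_def by blast
qed

lemma Supp_point_object:
  assumes "g \<in> point_objects U T P"
  shows "Supp U T g \<subseteq> {P}"
  using point_objects_orthogonal[OF _ assms] unfolding Supp_def by blast

lemma Supp_zero: "is_zero T t \<Longrightarrow> Supp U T t = {}"
  unfolding Supp_def using is_zero_Tens_right by blast

lemma bijection_of_minimality:
  assumes l2g: "local_to_global_principle U T"
    and min: "\<And>P. P \<in> topspace (Spc U T) \<Longrightarrow> \<exists>g \<in> point_objects U T P. minimal_localizing_ideal U T (Loc_ideal U T {g})"
  shows "bij_betw Supp_class {L. localizing_ideal U T L} (Pow (topspace (Spc U T)))"
proof -
  define \<Lambda> where "\<Lambda> Y = Loc_ideal U T {g. \<exists>P\<in>Y. g \<in> point_objects U T P}" for Y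
  have \<Lambda>: "localizing_ideal U T (\<Lambda> Y)" for Y
    unfolding \<Lambda>_def by (rule localizing_ideal_Loc_ideal)
  have \<Lambda>_inc: "g \<in> \<Lambda> Y" if "P \<in> Y" "g \<in> point_objects U T P" for g P Y
    unfolding \<Lambda>_def by (rule hull_inc) (use that in blast)
  \<comment> \<open>\<open>h\<close> is the choice whose ideal is minimal, \<open>g\<close> an
    arbitrary one. The nonzero object \<open>h \<boxtimes> t\<close> lies in \<open>L\<close> and in
    the ideal of \<open>h\<close>, so that ideal is contained in \<open>L\<close>; and
    \<open>g\<close> is isomorphic to \<open>h \<boxtimes> g\<close>.\<close>
  have inc: "g \<in> L" if L: "localizing_ideal U T L" and P: "P \<in> Supp_class L" and g: "g \<in> point_objects U T P" for L P g
  proof -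
    have Pt: "P \<in> topspace (Spc U T)" using P Supp_class_subset by blast
    obtain h where h: "h \<in> point_objects U T P" and hmin: "minimal_localizing_ideal U T (Loc_ideal U T {h})"
      using min[OF Pt] by blast
    obtain t where t: "t \<in> L" "\<not> is_zero T (h \<boxtimes> t)"
      using P Supp_iff[OF Pt h] unfolding Supp_class_def by blast
    have h_in: "h \<in> Loc_ideal U T {h}" by (rule hull_inc) simp
    have "localizing_ideal U T (L \<inter> Loc_ideal U T {h})"
      using localizing_ideal_Inter[of "{L, Loc_ideal U T {h}}" U] L localizing_ideal_Loc_ideal[of U "{h}"] by simp
    moreover have "h \<boxtimes> t \<in> L \<inter> Loc_ideal U T {h}"
      using localizing_ideal_Tens[OF L t(1)] localizing_ideal_Tens'[OF localizing_ideal_Loc_ideal h_in] by blast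
    ultimately have "L \<inter> Loc_ideal U T {h} = Loc_ideal U T {h}"
      using hmin t(2) unfolding minimal_localizing_ideal_def by blast
    then have "h \<in> L" using h_in by blast
    then have "h \<boxtimes> g \<in> L" by (rule localizing_ideal_Tens'[OF L])
    then show "g \<in> L"
      by (rule localizing_ideal_isomorphic[OF L isomorphic_sym[OF point_objects_isomorphic[OF g h]]])
  qed
  have left: "\<Lambda> (Supp_class L) = L" if L: "localizing_ideal U T L" for L
  proof
    show "\<Lambda> (Supp_class L) \<subseteq> L"
      unfolding \<Lambda>_def by (rule Loc_ideal_minimal[OF _ L]) (use inc[OF L] in blast)
    show "L \<subseteq> \<Lambda> (Supp_class L)"
    proof
      fix t assume t: "t \<in> L"
      \<comment> \<open>The pieces from which the local-to-global principle rebuilds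
        \<open>t\<close>: such a piece is zero off the support of \<open>t\<close>, and on it a
        multiple of a generator.\<close>
      have "t \<boxtimes> g \<in> \<Lambda> (Supp_class L)" if P: "P \<in> topspace (Spc U T)" and g: "g \<in> point_objects U T P" for P g
      proof (cases "P \<in> Supp U T t")
        case True
        then have "P \<in> Supp_class L" using t unfolding Supp_class_def by blast
        from \<Lambda>_inc[OF this g] show ?thesis by (rule localizing_ideal_Tens[OF \<Lambda>])
      next
        case False
        then have "is_zero T (t \<boxtimes> g)" using Supp_iff[OF P g] is_zero_commute by blast
        then show ?thesis by (rule localizing_ideal_zero[OF \<Lambda>])
      qed
      then have "Loc_ideal U T {t \<boxtimes> g | P g. P \<in> topspace (Spc U T) \<and> g \<in> point_objects U T P} \<subseteq> \<Lambda> (Supp_class L)"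
        by (intro Loc_ideal_minimal \<Lambda>) blast
      then have "Loc_ideal U T {t} \<subseteq> \<Lambda> (Supp_class L)"
        using l2g unfolding local_to_global_principle_def by metis
      then show "t \<in> \<Lambda> (Supp_class L)" using hull_inc[of t "{t}"] by blast
    qed
  qed
  have right: "Supp_class (\<Lambda> Y) = Y" if Y: "Y \<subseteq> topspace (Spc U T)" for Y
  proof
    show "Supp_class (\<Lambda> Y) \<subseteq> Y"
    proof
      fix Q assume "Q \<in> Supp_class (\<Lambda> Y)"
      then obtain t where "t \<in> {g. \<exists>P\<in>Y. g \<in> point_objects U T P}" "Q \<in> Supp U T t"
        unfolding \<Lambda>_def by (rule Supp_class_Loc_ideal)
      then show "Q \<in> Y" using Supp_point_object by blast
    qed
    show "Y \<subseteq> Supp_class (\<Lambda> Y)"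
    proof
      fix P assume P: "P \<in> Y"
      then have Pt: "P \<in> topspace (Spc U T)" using Y by blast
      obtain g where g: "g \<in> point_objects U T P" and gmin: "minimal_localizing_ideal U T (Loc_ideal U T {g})"
        using min[OF Pt] by blast
      \<comment> \<open>A minimal ideal is nonzero; and a nonzero \<open>g\<close>, being isomorphic
        to \<open>g \<boxtimes> g\<close>, is supported at \<open>P\<close>.\<close>
      have "\<not> is_zero T g"
      proof
        assume "is_zero T g"
        then have "Loc_ideal U T {g} \<subseteq> {x. is_zero T x}"
          by (intro Loc_ideal_minimal localizing_ideal_zeros) simp
        moreover have "{x. is_zero T x} \<subseteq> Loc_ideal U T {g}"
          using localizing_ideal_zero[OF localizing_ideal_Loc_ideal] by blast
        ultimately show False using gmin unfolding minimal_localizing_ideal_def by blast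
      qed
      then have "P \<in> Supp U T g"
        using Supp_iff[OF Pt g] is_zero_isomorphic[OF point_objects_isomorphic[OF g g]] by blast
      then show "P \<in> Supp_class (\<Lambda> Y)"
        using \<Lambda>_inc[OF P g] unfolding Supp_class_def by blast
    qed
  qed
  show ?thesis
    by (rule bij_betwI[where g = \<Lambda>]) (use left right \<Lambda> Supp_class_subset in auto)
qed

lemma minimality_of_bijection:
  assumes bij: "bij_betw Supp_class {L. localizing_ideal U T L} (Pow (topspace (Spc U T)))"
  shows "local_to_global_principle U T"
    and "P \<in> topspace (Spc U T) \<Longrightarrow> \<exists>g \<in> point_objects U T P. tensor_image T g = Loc_ideal U T {g} \<and>
      minimal_localizing_ideal U T (Loc_ideal U T {g})"
proof -
  have inj: "L = L'" if "localizing_ideal U T L" "localizing_ideal U T L'" "Supp_class L = Supp_class L'" for L L'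
    using bij that unfolding bij_betw_def inj_on_def by blast
  have mono: "Supp_class L \<subseteq> Supp_class L'" if "L \<subseteq> L'" for L L'
    using that unfolding Supp_class_def by blast
  have zeros: "Supp_class {x. is_zero T x} = {}"
    unfolding Supp_class_def using Supp_zero by blast
  show "local_to_global_principle U T"
    unfolding local_to_global_principle_def
  proof
    fix t
    let ?E = "{t \<boxtimes> g | P g. P \<in> topspace (Spc U T) \<and> g \<in> point_objects U T P}"
    have "t \<in> Loc_ideal U T {t}" by (rule hull_inc) simp
    then have "?E \<subseteq> Loc_ideal U T {t}"
      using localizing_ideal_Tens'[OF localizing_ideal_Loc_ideal] by blast
    then have sub: "Loc_ideal U T ?E \<subseteq> Loc_ideal U T {t}"
      by (rule Loc_ideal_minimal[OF _ localizing_ideal_Loc_ideal])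
    \<comment> \<open>By injectivity the equality of the two ideals can be checked on supports; the
      reverse inclusion is monotonicity.\<close>
    have "Supp_class (Loc_ideal U T {t}) \<subseteq> Supp_class (Loc_ideal U T ?E)"
    proof
      fix P assume "P \<in> Supp_class (Loc_ideal U T {t})"
      then have "P \<in> Supp U T t" by (rule Supp_class_Loc_ideal) simp
      then obtain g where P: "P \<in> topspace (Spc U T)" and g: "g \<in> point_objects U T P" and nz: "\<not> is_zero T (g \<boxtimes> t)"
        unfolding Supp_def by blast
      have "t \<boxtimes> g \<in> Loc_ideal U T ?E" by (rule hull_inc) (use P g in blast)
      \<comment> \<open>Tensoring \<open>t \<boxtimes> g\<close> with \<open>g\<close> once more
        does not change it up to isomorphism, so the result stays nonzero.\<close>
      moreover have "P \<in> Supp U T (t \<boxtimes> g)"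
      proof -
        have "isomorphic T (t \<boxtimes> g) (t \<boxtimes> (g \<boxtimes> g))"
          by (rule isomorphic_Tens[OF isomorphic_refl point_objects_isomorphic[OF g g]])
        then have "is_zero T (t \<boxtimes> g) \<longleftrightarrow> is_zero T (g \<boxtimes> (t \<boxtimes> g))"
          using is_zero_isomorphic is_zero_left_commute by blast
        then show ?thesis
          using Supp_iff[OF P g] nz is_zero_commute by blast
      qed
      ultimately show "P \<in> Supp_class (Loc_ideal U T ?E)" unfolding Supp_class_def by blast
    qed
    then show "Loc_ideal U T {t} = Loc_ideal U T ?E"
      using mono[OF sub] by (intro inj localizing_ideal_Loc_ideal) blast
  qed
  assume P: "P \<in> topspace (Spc U T)"
  have "{P} \<in> Supp_class ` {L. localizing_ideal U T L}"
    using bij P unfolding bij_betw_def by simp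
  then obtain t g where g: "g \<in> point_objects U T P" and nz: "\<not> is_zero T (g \<boxtimes> t)"
    unfolding Supp_class_def Supp_def by blast
  have "minimal_localizing_ideal U T (Loc_ideal U T {g})"
    unfolding minimal_localizing_ideal_def
  proof (intro conjI allI impI)
    show "localizing_ideal U T (Loc_ideal U T {g})" by (rule localizing_ideal_Loc_ideal)
    have "g \<in> Loc_ideal U T {g}" by (rule hull_inc) simp
    moreover have "\<not> is_zero T g" using nz is_zero_Tens_left by blast
    ultimately show "Loc_ideal U T {g} \<noteq> {x. is_zero T x}" by blast
    have "Supp_class (Loc_ideal U T {g}) \<subseteq> {P}"
    proof
      fix Q assume "Q \<in> Supp_class (Loc_ideal U T {g})"
      then have "Q \<in> Supp U T g" by (rule Supp_class_Loc_ideal) simp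
      then show "Q \<in> {P}" using Supp_point_object[OF g] by blast
    qed
    \<comment> \<open>With empty support, injectivity would identify this ideal with the ideal of
      zero objects.\<close>
    moreover have "Supp_class (Loc_ideal U T {g}) \<noteq> {}"
      using inj[OF localizing_ideal_Loc_ideal localizing_ideal_zeros] zeros
        \<open>Loc_ideal U T {g} \<noteq> {x. is_zero T x}\<close> by blast
    ultimately have Supp_g: "Supp_class (Loc_ideal U T {g}) = {P}" by blast
    fix L assume L: "localizing_ideal U T L \<and> L \<subseteq> Loc_ideal U T {g}"
    have "Supp_class L \<subseteq> {P}"
      using mono[of L "Loc_ideal U T {g}"] Supp_g L by simp
    \<comment> \<open>Both possible supports are already realized, by the ideal of zero objects and
      by the ideal of \<open>g\<close>, so injectivity leaves no third ideal.\<close>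
    then consider "Supp_class L = {}" | "Supp_class L = {P}" by blast
    then show "L = {x. is_zero T x} \<or> L = Loc_ideal U T {g}"
    proof cases
      case 1
      have "L = {x. is_zero T x}"
        by (rule inj[OF conjunct1[OF L] localizing_ideal_zeros]) (simp only: 1 zeros)
      then show ?thesis ..
    next
      case 2
      have "L = Loc_ideal U T {g}"
        by (rule inj[OF conjunct1[OF L] localizing_ideal_Loc_ideal]) (simp only: 2 Supp_g)
      then show ?thesis ..
    qed
  qed
  then show "\<exists>g \<in> point_objects U T P. tensor_image T g = Loc_ideal U T {g} \<and>
      minimal_localizing_ideal U T (Loc_ideal U T {g})"
    using g tensor_image_point_object[OF g] by blast
qed

end

theorem theoremA:
  fixes U :: "'u set" and T :: "('o, 'm) tt_cat"
  assumes "rigidly_compactly_generated_tt_category U T"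
    and "weakly_noetherian (Spc U T)"
  shows "(local_to_global_principle U T \<and>
          (\<forall>P \<in> topspace (Spc U T). \<exists>g \<in> point_objects U T P.
             tensor_image T g = Loc_ideal U T {g} \<and>
             minimal_localizing_ideal U T (Loc_ideal U T {g})))
     \<longleftrightarrow> bij_betw (\<lambda>L. \<Union>t\<in>L. Supp U T t)
           {L. localizing_ideal U T L} (Pow (topspace (Spc U T)))"
proof -
  interpret rigidly_compactly_generated_tt_category U T by (rule assms(1))
  have eq: "(\<lambda>L. \<Union>t\<in>L. Supp U T t) = Supp_class"
    by (rule ext) (simp add: Supp_class_def)
  show ?thesis
    unfolding eq
  proof
    assume a: "local_to_global_principle U T \<and>
          (\<forall>P \<in> topspace (Spc U T). \<exists>g \<in> point_objects U T P.
             tensor_image T g = Loc_ideal U T {g} \<and>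
             minimal_localizing_ideal U T (Loc_ideal U T {g}))"
    show "bij_betw Supp_class {L. localizing_ideal U T L} (Pow (topspace (Spc U T)))"
      by (rule bijection_of_minimality) (use a in blast)+
  next
    assume bij: "bij_betw Supp_class {L. localizing_ideal U T L} (Pow (topspace (Spc U T)))"
    show "local_to_global_principle U T \<and>
          (\<forall>P \<in> topspace (Spc U T). \<exists>g \<in> point_objects U T P.
             tensor_image T g = Loc_ideal U T {g} \<and>
             minimal_localizing_ideal U T (Loc_ideal U T {g}))"
      using minimality_of_bijection[OF bij] by blast
  qed
qed

end
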